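(* Let $G = \mathrm{GL}_n(\mathbb{C})$ and $K = \mathrm{GL}_p(\mathbb{C}) \times \mathrm{GL}_q(\mathbb{C})$ with $n = p + q$, embedded block diagonally (type AIII). Let $P$ be a parabolic subgroup of $G$ and $Q$ a parabolic subgroup of $K$. If $P$ and $Q$ are among the following list (1)--(3), then there are finitely many $K$-orbits in $G/P \times K/Q$ (diagonal action). (1) $P$ is any parabolic subgroup of $G$, and $Q = Q_1 \times Q_2$ is a parabolic subgroup of $K$ which satisfies (i) $Q_1$ is of partition type $(1, p-1)$ and $Q_2 = \mathrm{GL}_q$; or (ii) $Q_1 = \mathrm{GL}_p$ and $Q_2$ is of partition type $(q-1, 1)$. (2) $P$ is a maximal parabolic subgroup of $G$, and $Q$ is any parabolic subgroup of $K$. (3) $P = P_{\lambda}$ is a parabolic subgroup of $G$ corresponding to a composition $\lambda$ of length $3$, and $Q$ is a maximal parabolic subgroup of $K$.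
   Context: For a composition $\lambda = (\lambda_1, \dots, \lambda_\ell)$ of $N$ (an ordered tuple of positive integers with sum $N$; its length is $\ell$), $P_\lambda$ denotes the standard block upper triangular parabolic subgroup of $\mathrm{GL}_N$ with diagonal blocks of sizes $\lambda_1, \dots, \lambda_\ell$, i.e. the stabilizer of a partial flag of subspaces of $\mathbb{C}^N$ of dimensions $\lambda_1, \lambda_1 + \lambda_2, \dots, \lambda_1 + \cdots + \lambda_\ell$. A parabolic subgroup of $\mathrm{GL}_N$ is of partition type $\lambda$ if it is conjugate to $P_\lambda$. $K$ is the fixed point subgroup of conjugation by $\mathrm{diag}(1_p, -1_q)$ on $\mathrm{GL}_n$, with $p, q \ge 1$ (the involution is non-trivial). *)

theory Defs
  imports
    "HOL-Algebra.Left_Coset"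
    "HOL-Algebra.Group_Action"
    "Jordan_Normal_Form.Determinant"
begin

text \<open>\<^term>\<open>GL n\<close> is the complex general linear group; the last argument of \<^const>\<open>ring_mat\<close> is
  an irrelevant record extension.\<close>

definition GL :: "nat \<Rightarrow> complex mat monoid" where
  "GL n = units_of (ring_mat TYPE(complex) n ())"

definition block_diag :: "complex mat \<Rightarrow> complex mat \<Rightarrow> complex mat" where
  "block_diag a d = four_block_mat a (0\<^sub>m (dim_row a) (dim_col d)) (0\<^sub>m (dim_row d) (dim_col a)) d"

definition block_prod :: "complex mat set \<Rightarrow> complex mat set \<Rightarrow> complex mat set" where
  "block_prod A D = {block_diag a d | a d. a \<in> A \<and> d \<in> D}"

definition GL_GL :: "nat \<Rightarrow> nat \<Rightarrow> complex mat monoid" where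
  "GL_GL p q = (GL (p + q))\<lparr>carrier := block_prod (carrier (GL p)) (carrier (GL q))\<rparr>"

definition conjugate_in :: "complex mat monoid \<Rightarrow> complex mat set \<Rightarrow> complex mat set \<Rightarrow> bool" where
  "conjugate_in H A B \<longleftrightarrow> (\<exists>h\<in>carrier H. B = (h <#\<^bsub>H\<^esub> A) #>\<^bsub>H\<^esub> (inv\<^bsub>H\<^esub> h))"

text \<open>The definition of Borel subgroups is meant for \<open>H = GL n\<close> and \<open>H = GL_GL p q\<close> only: there
  the upper triangular elements of \<open>H\<close> form a Borel subgroup, and all Borel subgroups are conjugate.
  A parabolic subgroup is one that contains a Borel subgroup; in particular \<open>H\<close> itself is
  parabolic.\<close>

definition borel_subgroup :: "complex mat monoid \<Rightarrow> complex mat set \<Rightarrow> bool" where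
  "borel_subgroup H B \<longleftrightarrow> conjugate_in H {b \<in> carrier H. upper_triangular b} B"

definition parabolic_subgroup :: "complex mat monoid \<Rightarrow> complex mat set \<Rightarrow> bool" where
  "parabolic_subgroup H P \<longleftrightarrow> subgroup P H \<and> (\<exists>B. borel_subgroup H B \<and> B \<subseteq> P)"

definition maximal_parabolic_subgroup :: "complex mat monoid \<Rightarrow> complex mat set \<Rightarrow> bool" where
  "maximal_parabolic_subgroup H P \<longleftrightarrow>
     parabolic_subgroup H P \<and> P \<noteq> carrier H \<and>
     (\<forall>P'. parabolic_subgroup H P' \<and> P \<subseteq> P' \<longrightarrow> P' = P \<or> P' = carrier H)"

definition composition_of :: "nat \<Rightarrow> nat list \<Rightarrow> bool" where
  "composition_of N l \<longleftrightarrow> sum_list l = N \<and> (\<forall>x\<in>set l. 0 < x)"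

text \<open>Let \<open>l = [\<lambda>\<^sub>1, \<lambda>\<^sub>2, \<dots>]\<close>. With 0-based matrix indices, the \<open>k\<close>-th condition says that \<open>g\<close> maps the span of the first
  \<open>s = \<lambda>\<^sub>1 + \<dots> + \<lambda>\<^sub>k\<close> standard basis vectors into itself; together they say that \<open>g\<close> is block
  upper triangular with diagonal blocks of sizes \<open>\<lambda>\<^sub>1, \<lambda>\<^sub>2, \<dots>\<close>.\<close>

definition standard_parabolic :: "nat list \<Rightarrow> complex mat set" where
  "standard_parabolic l =
     {g \<in> carrier (GL (sum_list l)). \<forall>k\<le>length l. let s = sum_list (take k l) in
        \<forall>i\<in>{s..<sum_list l}. \<forall>j<s. g $$ (i, j) = 0}"

definition partition_type :: "nat \<Rightarrow> nat list \<Rightarrow> complex mat set \<Rightarrow> bool" where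
  "partition_type N l P \<longleftrightarrow> composition_of N l \<and> conjugate_in (GL N) (standard_parabolic l) P"

text \<open>The diagonal action of a subgroup \<open>K\<close> of \<open>G\<close> on \<open>G/P \<times> K/Q\<close> by left translation of left cosets.\<close>

definition double_flag :: "complex mat monoid \<Rightarrow> complex mat monoid \<Rightarrow> complex mat set \<Rightarrow>
    complex mat set \<Rightarrow> (complex mat set \<times> complex mat set) set" where
  "double_flag G K P Q = (lcosets\<^bsub>G\<^esub> P) \<times> (lcosets\<^bsub>K\<^esub> Q)"

definition diagonal_action :: "complex mat monoid \<Rightarrow> complex mat monoid \<Rightarrow> complex mat \<Rightarrow>
    complex mat set \<times> complex mat set \<Rightarrow> complex mat set \<times> complex mat set" where
  "diagonal_action G K k = (\<lambda>(X, Y). (k <#\<^bsub>G\<^esub> X, k <#\<^bsub>K\<^esub> Y))"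

lemma group_GL: "group (GL n)"
proof -
  interpret R: ring "ring_mat TYPE(complex) n ()" by (rule ring_mat)
  show ?thesis unfolding GL_def by (rule R.units_group)
qed

lemma GL_sel [simp]: "g \<otimes>\<^bsub>GL n\<^esub> h = g * h" "\<one>\<^bsub>GL n\<^esub> = 1\<^sub>m n"
  by (simp_all add: GL_def units_of_def ring_mat_def)

lemma carrier_GL: "carrier (GL n) = {g \<in> carrier_mat n n. det g \<noteq> 0}"
proof -
  let ?R = "ring_mat TYPE(complex) n ()"
  have "g \<in> Units ?R \<longleftrightarrow> g \<in> carrier_mat n n \<and> det g \<noteq> 0" for g
    using det_non_zero_imp_unit[of g n "()"] unit_imp_det_non_zero[of g n "()"]
    by (auto simp: Units_def ring_mat_def)
  then show ?thesis by (auto simp: GL_def units_of_def)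
qed

text \<open>\<^term>\<open>GL_GL p q\<close> is the fixed point group of conjugation by \<open>diag(1\<^sub>p, -1\<^sub>q)\<close>.\<close>

lemma carrier_GL_GL_fixed_points:
  fixes p q :: nat
  defines "s \<equiv> block_diag (1\<^sub>m p) (- 1\<^sub>m q)"
  shows "carrier (GL_GL p q) =
    {g \<in> carrier (GL (p + q)). s \<otimes>\<^bsub>GL (p + q)\<^esub> g \<otimes>\<^bsub>GL (p + q)\<^esub> inv\<^bsub>GL (p + q)\<^esub> s = g}"
proof -
  interpret group "GL (p + q)" by (rule group_GL)
  have sdef: "s = four_block_mat (1\<^sub>m p) (0\<^sub>m p q) (0\<^sub>m q p) (- 1\<^sub>m q)"
    by (simp add: s_def block_diag_def)
  have mult: "s * four_block_mat a b c d * s = four_block_mat a (- b) (- c) d"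
    if "a \<in> carrier_mat p p" "b \<in> carrier_mat p q" "c \<in> carrier_mat q p" "d \<in> carrier_mat q q"
    for a b c d :: "complex mat"
    using that
    by (simp add: sdef mult_four_block_mat[of _ p p _ q _ q _ _ p _ q]
        uminus_mult_left_mat uminus_mult_right_mat)
  have ss: "s * s = 1\<^sub>m (p + q)"
    proof -
    have "- (0\<^sub>m p q :: complex mat) = 0\<^sub>m p q" by (rule eq_matI) auto
    then show ?thesis
      by (simp add: sdef mult_four_block_mat[of _ p p _ q _ q _ _ p _ q]
          uminus_mult_left_mat uminus_mult_right_mat)
  qed
  have sc: "s \<in> carrier_mat (p + q) (p + q)" by (simp add: sdef)
  have "det s * det s = 1" using det_mult[OF sc sc] ss by simp
  hence sG: "s \<in> carrier (GL (p + q))" using sc by (auto simp: carrier_GL)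
  have inv: "inv\<^bsub>GL (p + q)\<^esub> s = s" using inv_equality[of s s] ss sG by simp
  have det: "det (four_block_mat a (0\<^sub>m p q) (0\<^sub>m q p) d) = det a * det d"
    if "a \<in> carrier_mat p p" "d \<in> carrier_mat q q" for a d :: "complex mat"
    using that det_four_block_mat_lower_left_zero[of a p "0\<^sub>m p q" q "0\<^sub>m q p" d] by simp
  have main: "g \<in> block_prod (carrier (GL p)) (carrier (GL q)) \<longleftrightarrow> s * g * s = g"
    if g: "g \<in> carrier (GL (p + q))" for g
  proof
    assume "g \<in> block_prod (carrier (GL p)) (carrier (GL q))"
    then show "s * g * s = g"
      using mult by (auto simp: block_prod_def block_diag_def carrier_GL)
  next
    assume fixed: "s * g * s = g"
    obtain a b c d where sp: "split_block g p p = (a, b, c, d)" by (metis prod_cases4)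
    have gc: "dim_row g = p + q" "dim_col g = p + q" using g by (auto simp: carrier_GL)
    note bl = split_block[OF sp gc]
    have "four_block_mat a (- b) (- c) d = four_block_mat a b c d"
      using mult[OF bl(1-4)] fixed bl(5) by simp
    hence eq: "four_block_mat a (- b) (- c) d $$ (i, j) = four_block_mat a b c d $$ (i, j)" for i j by simp
    have "b = 0\<^sub>m p q"
    proof (rule eq_matI)
      fix i j assume "i < dim_row (0\<^sub>m p q :: complex mat)" "j < dim_col (0\<^sub>m p q :: complex mat)"
      then show "b $$ (i, j) = 0\<^sub>m p q $$ (i, j)" using eq[of i "p + j"] bl(1-4) by auto
    qed (use bl in auto)
    moreover have "c = 0\<^sub>m q p"
    proof (rule eq_matI)
      fix i j assume "i < dim_row (0\<^sub>m q p :: complex mat)" "j < dim_col (0\<^sub>m q p :: complex mat)"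
      then show "c $$ (i, j) = 0\<^sub>m q p $$ (i, j)" using eq[of "p + i" j] bl(1-4) by auto
    qed (use bl in auto)
    ultimately have gb: "g = four_block_mat a (0\<^sub>m p q) (0\<^sub>m q p) d" using bl(5) by simp
    have "det a * det d \<noteq> 0" using g gb det[OF bl(1,4)] by (simp add: carrier_GL)
    then have "a \<in> carrier (GL p)" "d \<in> carrier (GL q)" using bl(1,4) by (auto simp: carrier_GL)
    moreover have "g = block_diag a d" using gb bl(1,4) by (auto simp: block_diag_def)
    ultimately show "g \<in> block_prod (carrier (GL p)) (carrier (GL q))"
      unfolding block_prod_def by blast
  qed
  have sub: "block_prod (carrier (GL p)) (carrier (GL q)) \<subseteq> carrier (GL (p + q))"
    using det by (auto simp: block_prod_def block_diag_def carrier_GL)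
  have "carrier (GL_GL p q) = block_prod (carrier (GL p)) (carrier (GL q))"
    by (simp add: GL_GL_def)
  then show ?thesis using main sub inv by auto
qed

lemma subgroup_GL_GL: "subgroup (carrier (GL_GL p q)) (GL (p + q))"
proof -
  interpret group "GL (p + q)" by (rule group_GL)
  define s :: "complex mat" where "s = block_diag (1\<^sub>m p) (- 1\<^sub>m q)"
  have s: "s \<in> carrier (GL (p + q))"
  proof -
    have "det s = det (1\<^sub>m p :: complex mat) * det (- 1\<^sub>m q :: complex mat)"
      unfolding s_def block_diag_def
      using det_four_block_mat_lower_left_zero[of "1\<^sub>m p" p "0\<^sub>m p q" q "0\<^sub>m q p" "- 1\<^sub>m q :: complex mat"]
      by simp
    also have "- 1\<^sub>m q = (- 1 :: complex) \<cdot>\<^sub>m 1\<^sub>m q" by (rule eq_matI) auto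
    finally show ?thesis by (auto simp: carrier_GL s_def block_diag_def det_smult)
  qed
  have fix_iff: "s \<otimes>\<^bsub>GL (p + q)\<^esub> g \<otimes>\<^bsub>GL (p + q)\<^esub> inv\<^bsub>GL (p + q)\<^esub> s = g \<longleftrightarrow>
      s \<otimes>\<^bsub>GL (p + q)\<^esub> g = g \<otimes>\<^bsub>GL (p + q)\<^esub> s" if "g \<in> carrier (GL (p + q))" for g
    using that s by (metis inv_solve_right' m_closed)
  have car: "carrier (GL_GL p q) =
      {g \<in> carrier (GL (p + q)). s \<otimes>\<^bsub>GL (p + q)\<^esub> g = g \<otimes>\<^bsub>GL (p + q)\<^esub> s}"
    using carrier_GL_GL_fixed_points[of p q] fix_iff unfolding s_def by blast
  show ?thesis
  proof (rule subgroupI)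
    show "carrier (GL_GL p q) \<noteq> {}" using s unfolding car by auto
  next
    fix g assume "g \<in> carrier (GL_GL p q)"
    then show "inv\<^bsub>GL (p + q)\<^esub> g \<in> carrier (GL_GL p q)"
      using s unfolding car
      by (smt (verit) inv_closed inv_solve_left' inv_solve_right m_assoc m_closed mem_Collect_eq)
  next
    fix g h assume "g \<in> carrier (GL_GL p q)" "h \<in> carrier (GL_GL p q)"
    then show "g \<otimes>\<^bsub>GL (p + q)\<^esub> h \<in> carrier (GL_GL p q)"
      using s unfolding car by (smt (verit) m_assoc m_closed mem_Collect_eq)
  qed (auto simp: car)
qed

lemma group_GL_GL: "group (GL_GL p q)"
proof -
  have "GL_GL p q = (GL (p + q))\<lparr>carrier := carrier (GL_GL p q)\<rparr>"
    by (simp add: GL_GL_def)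
  then show ?thesis
    using group.subgroup_imp_group[OF group_GL subgroup_GL_GL, of p q] by simp
qed

end

theory Submission
  imports Defs
begin

text \<open>An orbit of \<open>K\<close> on \<open>G/P \<times> K/Q\<close> is the same as a double coset \<open>Q g P\<close> in \<open>G\<close>. Write \<open>\<complex>\<^sup>n = V\<^sub>1 \<oplus> V\<^sub>2\<close>
  for the decomposition that defines \<open>K\<close>. The columns of \<open>g\<close> span, from left to right, the subspaces of
  the flag that \<open>g\<close> represents in \<open>G/P\<close>; its rows fall into two classes, the coordinates on \<open>V\<^sub>1\<close> and
  those on \<open>V\<^sub>2\<close>. Passing to another element of the double coset means row operations from \<open>Q\<close>, which
  never mix the two classes, and column operations from \<open>P\<close>. In each of the three cases these operations
  suffice to make all relevant entries equal to \<open>0\<close> or \<open>1\<close>, and there are only finitely many matrices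
  with such entries.

  The obstacle is that both classes of rows share the columns. After one class has been brought to the
  shape of a partial permutation matrix, the other class may only be treated by column operations whose
  effect on the first class can be undone by row operations there. Such an operation adds column \<open>l\<close>
  to column \<open>k\<close>; it can be undone if column \<open>k\<close> vanishes on the first class only when column \<open>l\<close> does, and
  if the row of the pivot of \<open>k\<close> may be added to the row of the pivot of \<open>l\<close> (\<open>transport\<close>). Elimination
  works with every group of operations given by a total preorder (\<open>elimination\<close>), so what matters is
  whether the operations that can be undone contain such a group, or one made from two total preorders.

  If \<open>P\<close> is the stabiliser of one subspace \<open>W\<close>, it is enough to treat the smallest \<open>Q\<close>, the stabiliser of full
  flags of \<open>V\<^sub>1\<close> and \<open>V\<^sub>2\<close>. All columns spanning \<open>W\<close> may be mixed, and the operations that can be undone on \<open>V\<^sub>1\<close> are those for a total preorder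
  (\<open>two_chain_elimination\<close>). This settles the case of a maximal \<open>P\<close>.

  If \<open>P\<close> stabilises \<open>W\<^sub>1 \<subseteq> W\<^sub>2\<close> and \<open>Q\<close> stabilises a subspace \<open>U\<close> of one summand, \<open>W\<^sub>2\<close> is normalised first. The
  operations on the columns of \<open>W\<^sub>2\<close> that can be undone on both classes are governed by two ranks of a
  column, which of \<open>0\<close>, \<open>U\<close> and the summand of \<open>U\<close> its projection to that summand reaches, and whether it
  projects to \<open>0\<close> on the other summand. The columns split into two classes on each of which these
  ranks agree with one total preorder. Hence \<open>W\<^sub>1\<close>, as a subspace of \<open>W\<^sub>2\<close>, is again a
  subspace relative to two flags, and the previous elimination applies a second time.

  If \<open>P\<close> is a Borel subgroup and \<open>Q\<close> stabilises only a line of \<open>V\<^sub>1\<close> or a hyperplane of \<open>V\<^sub>2\<close>, then \<open>K\<close> itself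
  brings \<open>g\<close> to a normal form \<open>X\<close> with entries \<open>0\<close> and \<open>1\<close> (\<open>flag_normal_form\<close>). The nonzero entries of \<open>X\<close>
  link each row of one class to at most one row of the other, so every diagonal
  matrix on one summand extends to diagonal matrices \<open>s\<close> and \<open>\<tau>\<close> with \<open>s X = X \<tau>\<close> (\<open>torus_scaling\<close>). This
  torus rescales the coordinates of the line or the hyperplane to \<open>0\<close> and \<open>1\<close>.

  About abstract parabolic subgroups one fact is needed: a maximal one contains a conjugate of the
  stabiliser of a subspace, in \<open>\<complex>\<^sup>n\<close> for \<open>G\<close> and in \<open>V\<^sub>1\<close> or \<open>V\<^sub>2\<close> for \<open>K\<close>. It follows from
  \<open>full_or_stabilises\<close>: a subgroup containing the upper triangular matrices either fixes a coordinate
  subspace or produces all transvections.\<close>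

section \<open>Invertible matrices supported on a relation\<close>

lemma mult_entry:
  assumes "A \<in> carrier_mat n n" "B \<in> carrier_mat n n" "i < n" "j < n"
  shows "(A * B) $$ (i, j) = (\<Sum>k<n. A $$ (i, k) * B $$ (k, j))"
  using assms by (auto simp: scalar_prod_def lessThan_atLeast0 intro!: sum.cong)

lemma square_assoc:
  fixes A B C :: "'a::field mat"
  assumes "A \<in> carrier_mat n n" "B \<in> carrier_mat n n" "C \<in> carrier_mat n n"
  shows "A * B * C = A * (B * C)"
  using assms by (rule assoc_mult_mat)

lemma square_transpose:
  fixes A B :: "'a::field mat"
  assumes "A \<in> carrier_mat n n" "B \<in> carrier_mat n n"
  shows "transpose_mat (A * B) = transpose_mat B * transpose_mat A"
  using assms by (rule transpose_mult)

lemma left_inverse_cancel: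
  fixes A B C :: "'a::field mat"
  assumes "A \<in> carrier_mat n n" "B \<in> carrier_mat n n" "C \<in> carrier_mat n n" "A * B = 1\<^sub>m n"
  shows "A * (B * C) = C"
  using assms by (simp flip: square_assoc[of A n B C])

text \<open>Entries of products are expanded as sums by \<open>mult_entry\<close>; the default rule would turn them into
  scalar products of rows and columns.\<close>

declare index_mult_mat(1) [simp del]

text \<open>A pair outside \<open>R\<close> fixes the entry to that of the identity matrix. For reflexive \<open>R\<close> this only says
  that the support lies in \<open>R\<close>; an index \<open>i\<close> with no pair in \<open>R\<close> makes row and column \<open>i\<close> trivial, so that the same
  notion covers operations confined to a set of rows or columns.\<close>

definition id_off :: "nat \<Rightarrow> (nat \<Rightarrow> nat \<Rightarrow> bool) \<Rightarrow> 'a::field mat \<Rightarrow> bool" where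
  "id_off n R b \<longleftrightarrow> b \<in> carrier_mat n n \<and>
     (\<forall>i<n. \<forall>j<n. \<not> R i j \<longrightarrow> b $$ (i, j) = (if i = j then 1 else 0))"

text \<open>The inverse is required to have the same shape, which makes this a group by construction for every
  transitive \<open>R\<close>. Borel subgroups, stabilisers of coordinate subspaces, the symmetric subgroup and the
  torus are all of this form.\<close>

definition units_on :: "nat \<Rightarrow> (nat \<Rightarrow> nat \<Rightarrow> bool) \<Rightarrow> 'a::field mat set" where
  "units_on n R = {b. id_off n R b \<and> (\<exists>b'. id_off n R b' \<and> b * b' = 1\<^sub>m n \<and> b' * b = 1\<^sub>m n)}"

lemma units_onI:
  assumes "id_off n R b" "id_off n R b'" "b * b' = 1\<^sub>m n" "b' * b = 1\<^sub>m n"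
  shows "b \<in> units_on n R"
  using assms unfolding units_on_def by blast

lemma units_onE:
  assumes "b \<in> units_on n R"
  obtains b' where "b' \<in> units_on n R" "b * b' = 1\<^sub>m n" "b' * b = 1\<^sub>m n"
  using assms unfolding units_on_def by blast

lemma units_on_carrier: "b \<in> units_on n R \<Longrightarrow> b \<in> carrier_mat n n"
  by (simp add: units_on_def id_off_def)

lemma units_on_off:
  assumes "b \<in> units_on n R" "i < n" "j < n" "\<not> R i j"
  shows "b $$ (i, j) = (if i = j then 1 else 0)"
  using assms by (simp add: units_on_def id_off_def)

lemma units_on_mono:
  assumes "b \<in> units_on n R" "\<And>i j. i < n \<Longrightarrow> j < n \<Longrightarrow> R i j \<Longrightarrow> S i j"
  shows "b \<in> units_on n S"
  using assms unfolding units_on_def id_off_def by blast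

text \<open>In the product, a term through the index \<open>k\<close> differs from a term of the identity only if \<open>(i, k)\<close> or
  \<open>(k, j)\<close> lies in \<open>R\<close>; if both do, so does \<open>(i, j)\<close>.\<close>

lemma id_off_mult:
  assumes "transp R" "id_off n R b" "id_off n R c"
  shows "id_off n R (b * c)"
proof -
  have bc: "b \<in> carrier_mat n n" "c \<in> carrier_mat n n" using assms by (auto simp: id_off_def)
  have "(b * c) $$ (i, j) = (if i = j then 1 else 0)" if ij: "i < n" "j < n" "\<not> R i j" for i j
  proof -
    have "b $$ (i, k) * c $$ (k, j) = (if k = i then (if i = j then 1 else 0) else 0)"
      if k: "k < n" for k
    proof (cases "R i k")
      case True
      then have "\<not> R k j" using ij assms(1) by (meson transpE)
      then have "c $$ (k, j) = (if k = j then 1 else 0)" "k \<noteq> j"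
        using assms(3) ij k True by (auto simp: id_off_def)
      then show ?thesis by auto
    next
      case False
      then have "b $$ (i, k) = (if i = k then 1 else 0)" "c $$ (i, j) = (if i = j then 1 else 0)"
        using assms(2,3) ij k by (auto simp: id_off_def)
      then show ?thesis by auto
    qed
    then show ?thesis using ij bc by (simp add: mult_entry)
  qed
  then show ?thesis using bc by (auto simp: id_off_def)
qed

lemma inverse_pair_mult:
  fixes b c :: "'a::field mat"
  assumes "b \<in> carrier_mat n n" "c \<in> carrier_mat n n" "b' \<in> carrier_mat n n" "c' \<in> carrier_mat n n"
    and "b * b' = 1\<^sub>m n" "c * c' = 1\<^sub>m n"
  shows "(b * c) * (c' * b') = 1\<^sub>m n"
proof -
  have "(b * c) * (c' * b') = b * (c * c') * b'"
    using assms(1-4) by (simp add: assoc_mult_mat[where ?n\<^sub>1=n and ?n\<^sub>2=n and ?n\<^sub>3=n and ?n\<^sub>4=n])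
  then show ?thesis using assms by simp
qed

lemma units_on_mult:
  assumes "transp R" "b \<in> units_on n R" "c \<in> units_on n R"
  shows "b * c \<in> units_on n R"
proof -
  obtain b' where b': "id_off n R b'" "b * b' = 1\<^sub>m n" "b' * b = 1\<^sub>m n"
    using assms unfolding units_on_def by blast
  obtain c' where c': "id_off n R c'" "c * c' = 1\<^sub>m n" "c' * c = 1\<^sub>m n"
    using assms unfolding units_on_def by blast
  have o: "id_off n R b" "id_off n R c" using assms by (auto simp: units_on_def)
  have car: "b \<in> carrier_mat n n" "c \<in> carrier_mat n n" "b' \<in> carrier_mat n n" "c' \<in> carrier_mat n n"
    using b' c' o by (auto simp: id_off_def)
  show ?thesis
    using o b' c' car by (intro units_onI[of _ _ _ "c' * b'"] id_off_mult assms inverse_pair_mult)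
qed

lemma units_on_one: "1\<^sub>m n \<in> units_on n R"
  by (rule units_onI[of _ _ _ "1\<^sub>m n"]) (auto simp: id_off_def)

lemma units_on_transpose:
  assumes "b \<in> units_on n R"
  shows "transpose_mat b \<in> units_on n (\<lambda>i j. R j i)"
proof -
  obtain b' where b': "id_off n R b'" "b * b' = 1\<^sub>m n" "b' * b = 1\<^sub>m n"
    using assms unfolding units_on_def by blast
  have o: "id_off n R b" using assms by (auto simp: units_on_def)
  have car: "b \<in> carrier_mat n n" "b' \<in> carrier_mat n n" using b' o by (auto simp: id_off_def)
  have "transpose_mat b * transpose_mat b' = 1\<^sub>m n" "transpose_mat b' * transpose_mat b = 1\<^sub>m n"
    using b' by (simp_all flip: transpose_mult[OF car] transpose_mult[OF car(2,1)])
  moreover have "id_off n (\<lambda>i j. R j i) (transpose_mat b)" "id_off n (\<lambda>i j. R j i) (transpose_mat b')"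
    using o b' by (auto simp: id_off_def)
  ultimately show ?thesis by (intro units_onI)
qed

text \<open>Row operations confined to a set of rows leave the other rows unchanged, and a row that does change
  depends only on itself and the rows added to it. With the three lemmas that follow, this keeps track of one
  block of a matrix while another one is being transformed.\<close>

lemma units_on_mult_row:
  assumes "b \<in> units_on n R" "M \<in> carrier_mat n n" "i < n" "j < n" "\<And>k. \<not> R i k"
  shows "(b * M) $$ (i, j) = M $$ (i, j)"
proof -
  have "b $$ (i, k) * M $$ (k, j) = (if k = i then M $$ (i, j) else 0)" if "k < n" for k
    using that assms by (auto simp: units_on_off[OF assms(1)])
  then show ?thesis using assms units_on_carrier[OF assms(1)] by (simp add: mult_entry)
qed

lemma units_on_mult_col:
  assumes "c \<in> units_on n S" "M \<in> carrier_mat n n" "i < n" "j < n" "\<And>k. \<not> S k j"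
  shows "(M * c) $$ (i, j) = M $$ (i, j)"
proof -
  have "M $$ (i, k) * c $$ (k, j) = (if k = j then M $$ (i, j) else 0)" if "k < n" for k
    using that assms by (auto simp: units_on_off[OF assms(1)])
  then show ?thesis using assms units_on_carrier[OF assms(1)] by (simp add: mult_entry)
qed

lemma units_on_mult_row_cong:
  assumes "b \<in> units_on n R" "M \<in> carrier_mat n n" "M' \<in> carrier_mat n n" "i < n" "j < n"
    and "M $$ (i, j) = M' $$ (i, j)"
    and "\<And>k. k < n \<Longrightarrow> R i k \<Longrightarrow> M $$ (k, j) = M' $$ (k, j)"
  shows "(b * M) $$ (i, j) = (b * M') $$ (i, j)"
proof -
  have "b $$ (i, k) * M $$ (k, j) = b $$ (i, k) * M' $$ (k, j)" if "k < n" for k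
    using that assms units_on_off[OF assms(1), of i k] by (cases "R i k") auto
  then show ?thesis
    using assms units_on_carrier[OF assms(1)] by (subst (1 2) mult_entry) (auto intro!: sum.cong)
qed

lemma units_on_mult_col_cong:
  assumes "c \<in> units_on n S" "M \<in> carrier_mat n n" "M' \<in> carrier_mat n n" "i < n" "j < n"
    and "M $$ (i, j) = M' $$ (i, j)"
    and "\<And>k. k < n \<Longrightarrow> S k j \<Longrightarrow> M $$ (i, k) = M' $$ (i, k)"
  shows "(M * c) $$ (i, j) = (M' * c) $$ (i, j)"
proof -
  have "M $$ (i, k) * c $$ (k, j) = M' $$ (i, k) * c $$ (k, j)" if "k < n" for k
    using that assms units_on_off[OF assms(1), of k j] by (cases "S k j") auto
  then show ?thesis
    using assms units_on_carrier[OF assms(1)] by (subst (1 2) mult_entry) (auto intro!: sum.cong)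
qed

section \<open>Elimination with totally preordered rows and columns\<close>

text \<open>The rank \<open>\<rho>\<close> need not be injective: ranks with ties give block triangular groups, and a constant rank
  gives the full linear group on \<open>I\<close>.\<close>

definition chain :: "nat set \<Rightarrow> (nat \<Rightarrow> nat) \<Rightarrow> nat \<Rightarrow> nat \<Rightarrow> bool" where
  "chain I \<rho> i j \<longleftrightarrow> i \<in> I \<and> j \<in> I \<and> \<rho> i \<le> \<rho> j"

lemma transp_chain: "transp (chain I \<rho>)"
  by (auto simp: transp_def chain_def)

text \<open>The block with rows \<open>I\<close> and columns \<open>J\<close> is a rook placement: entries \<open>0\<close> and \<open>1\<close>, with at most one
  \<open>1\<close> in each of its rows and columns.\<close>

definition partial_perm_on :: "nat set \<Rightarrow> nat set \<Rightarrow> 'a::field mat \<Rightarrow> bool" where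
  "partial_perm_on I J M \<longleftrightarrow> (\<forall>i\<in>I. \<forall>j\<in>J. M $$ (i, j) = 0 \<or> M $$ (i, j) = 1) \<and>
     (\<forall>i\<in>I. \<forall>i'\<in>I. \<forall>j\<in>J. M $$ (i, j) \<noteq> 0 \<and> M $$ (i', j) \<noteq> 0 \<longrightarrow> i = i') \<and>
     (\<forall>i\<in>I. \<forall>j\<in>J. \<forall>j'\<in>J. M $$ (i, j) \<noteq> 0 \<and> M $$ (i, j') \<noteq> 0 \<longrightarrow> j = j')"

lemma partial_perm_onD:
  assumes "partial_perm_on I J M"
  shows "i \<in> I \<Longrightarrow> j \<in> J \<Longrightarrow> M $$ (i, j) \<noteq> 0 \<Longrightarrow> M $$ (i, j) = 1"
    and "i \<in> I \<Longrightarrow> i' \<in> I \<Longrightarrow> j \<in> J \<Longrightarrow> M $$ (i, j) \<noteq> 0 \<Longrightarrow> M $$ (i', j) \<noteq> 0 \<Longrightarrow> i = i'"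
    and "i \<in> I \<Longrightarrow> j \<in> J \<Longrightarrow> j' \<in> J \<Longrightarrow> M $$ (i, j) \<noteq> 0 \<Longrightarrow> M $$ (i, j') \<noteq> 0 \<Longrightarrow> j = j'"
  using assms unfolding partial_perm_on_def by blast+

lemma partial_perm_on_cong:
  assumes "\<And>i j. i \<in> I \<Longrightarrow> j \<in> J \<Longrightarrow> M $$ (i, j) = M' $$ (i, j)" "partial_perm_on I J M'"
  shows "partial_perm_on I J M"
  using assms(2) unfolding partial_perm_on_def by (simp add: assms(1))

lemma partial_perm_on_transpose:
  assumes "M \<in> carrier_mat n n" "I \<subseteq> {..<n}" "J \<subseteq> {..<n}" "partial_perm_on I J (transpose_mat M)"
  shows "partial_perm_on J I M"
proof -
  have "transpose_mat M $$ (i, j) = M $$ (j, i)" if "i \<in> I" "j \<in> J" for i j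
    using that assms(1-3) by (intro index_transpose_mat) auto
  then show ?thesis using assms(4) unfolding partial_perm_on_def by (smt (verit))
qed

text \<open>The identity with column \<open>r\<close> replaced by \<open>u\<close>. As a left factor it adds multiples of row \<open>r\<close> to the other
  rows and rescales row \<open>r\<close>, which is one whole step of Gaussian elimination; its transpose does the same for
  columns as a right factor.\<close>

definition column_mat :: "nat \<Rightarrow> nat \<Rightarrow> (nat \<Rightarrow> 'a::field) \<Rightarrow> 'a mat" where
  "column_mat n r u = mat n n (\<lambda>(i, j). if j = r then u i else if i = j then 1 else 0)"

lemma column_mat_carrier [simp]: "column_mat n r u \<in> carrier_mat n n"
  by (simp add: column_mat_def)

lemma dim_column_mat [simp]: "dim_row (column_mat n r u) = n" "dim_col (column_mat n r u) = n"
  by (simp_all add: column_mat_def)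

lemma index_column_mat [simp]:
  "i < n \<Longrightarrow> j < n \<Longrightarrow> column_mat n r u $$ (i, j) = (if j = r then u i else if i = j then 1 else 0)"
  by (simp add: column_mat_def)

lemma column_mat_mult:
  assumes "M \<in> carrier_mat n n" "r < n" "i < n" "j < n"
  shows "(column_mat n r u * M) $$ (i, j) = u i * M $$ (r, j) + (if i = r then 0 else M $$ (i, j))"
proof -
  have "column_mat n r u $$ (i, k) * M $$ (k, j) =
      (if k = r then u i * M $$ (r, j) else 0) + (if k = i then (if i = r then 0 else M $$ (i, j)) else 0)"
    if "k < n" for k
    using assms that by simp
  then show ?thesis
    using assms column_mat_carrier[of n r u]
    by (simp add: mult_entry sum.distrib del: index_column_mat column_mat_carrier)
qed

lemma mult_column_mat_transpose:
  fixes M :: "'a::field mat"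
  assumes "M \<in> carrier_mat n n" "r < n" "i < n" "j < n"
  shows "(M * transpose_mat (column_mat n r v)) $$ (i, j) = v j * M $$ (i, r) + (if j = r then 0 else M $$ (i, j))"
proof -
  have Mt: "transpose_mat M \<in> carrier_mat n n" and c: "transpose_mat (column_mat n r v) \<in> carrier_mat n n"
    using assms by auto
  have "transpose_mat (M * transpose_mat (column_mat n r v)) = column_mat n r v * transpose_mat M"
    using square_transpose[OF assms(1) c] by simp
  moreover have "transpose_mat (M * transpose_mat (column_mat n r v)) $$ (j, i) =
      (M * transpose_mat (column_mat n r v)) $$ (i, j)"
    using assms c by (intro index_transpose_mat) auto
  ultimately have "(M * transpose_mat (column_mat n r v)) $$ (i, j) = (column_mat n r v * transpose_mat M) $$ (j, i)"
    by simp
  also have "\<dots> = v j * transpose_mat M $$ (r, i) + (if j = r then 0 else transpose_mat M $$ (j, i))"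
    by (rule column_mat_mult[OF Mt assms(2,4,3)])
  finally show ?thesis using assms by auto
qed

lemma column_mat_inverse:
  assumes "r < n" "u r \<noteq> 0"
  shows "column_mat n r u * column_mat n r (\<lambda>i. if i = r then 1 / u r else - u i / u r) = 1\<^sub>m n"
  using assms by (intro eq_matI) (auto simp: column_mat_mult
)

lemma column_mat_units:
  assumes r: "r < n" and u: "u r \<noteq> 0" and R: "R r r"
    and supp: "\<And>i. i < n \<Longrightarrow> i \<noteq> r \<Longrightarrow> u i \<noteq> 0 \<Longrightarrow> R i r"
  shows "column_mat n r u \<in> units_on n R"
proof -
  let ?u = "\<lambda>i. if i = r then 1 / u r else - u i / u r"
  have "(\<lambda>i. if i = r then 1 / ?u r else - ?u i / ?u r) = u" using u by auto
  then have 2: "column_mat n r ?u * column_mat n r u = 1\<^sub>m n"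
    using column_mat_inverse[of r n ?u] r u by simp
  show ?thesis
    using assms by (intro units_onI[OF _ _ column_mat_inverse[of r n u] 2]) (auto simp: id_off_def column_mat_def)
qed

text \<open>Row \<open>r\<close> has the largest rank, so multiples of it may be added to all rows of \<open>I\<close>, which clears column
  \<open>j\<close>. The pivot \<open>j\<close> has the smallest rank among the columns that are nonzero in row \<open>r\<close>, so it may be added
  to all of them, which clears row \<open>r\<close>.\<close>

lemma pivot_step:
  fixes M :: "'a::field mat"
  assumes M: "M \<in> carrier_mat n n" and I: "I \<subseteq> {..<n}" and J: "J \<subseteq> {..<n}"
    and r: "r \<in> I" "\<And>i. i \<in> I \<Longrightarrow> \<rho> i \<le> \<rho> r"
    and j: "j \<in> J" "M $$ (r, j) \<noteq> 0" "\<And>k. k \<in> J \<Longrightarrow> M $$ (r, k) \<noteq> 0 \<Longrightarrow> \<sigma> j \<le> \<sigma> k"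
  shows "\<exists>b\<in>units_on n (chain I \<rho>). \<exists>c\<in>units_on n (chain J \<sigma>).
     (\<forall>k\<in>J. (b * M * c) $$ (r, k) = (if k = j then 1 else 0)) \<and>
     (\<forall>i\<in>I. (b * M * c) $$ (i, j) = (if i = r then 1 else 0))"
proof -
  have rn: "r < n" and jn: "j < n" using r j I J by auto
  define u where "u i = (if i = r then 1 / M $$ (r, j) else if i \<in> I then - M $$ (i, j) / M $$ (r, j) else 0)" for i
  define b where "b = column_mat n r u"
  define M' where "M' = b * M"
  define v where "v k = (if k = j then 1 else if k \<in> J then - M' $$ (r, k) else 0)" for k
  define c where "c = transpose_mat (column_mat n j v)"
  have M'c: "M' \<in> carrier_mat n n" using M mult_carrier_mat[OF column_mat_carrier] by (simp add: M'_def b_def)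
  have M': "M' $$ (i, k) = u i * M $$ (r, k) + (if i = r then 0 else M $$ (i, k))"
    if "i < n" "k < n" for i k
    using that M rn by (simp add: M'_def b_def column_mat_mult)
  have b: "b \<in> units_on n (chain I \<rho>)"
    unfolding b_def using rn r j by (intro column_mat_units) (auto simp: chain_def u_def split: if_splits)
  have "column_mat n j v \<in> units_on n (\<lambda>i k. chain J \<sigma> k i)"
  proof (rule column_mat_units)
    fix i assume i: "i < n" "i \<noteq> j" "v i \<noteq> 0"
    then have "i \<in> J" "M' $$ (r, i) \<noteq> 0" by (auto simp: v_def split: if_splits)
    then have "M $$ (r, i) \<noteq> 0" using M'[of r i] rn i by auto
    then show "chain J \<sigma> j i" using j \<open>i \<in> J\<close> by (auto simp: chain_def)
  qed (use jn j in \<open>auto simp: chain_def v_def\<close>)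
  then have c: "c \<in> units_on n (chain J \<sigma>)"
    using units_on_transpose[of "column_mat n j v"] by (force simp: c_def)
  have Mc: "(M' * c) $$ (i, k) = v k * M' $$ (i, j) + (if k = j then 0 else M' $$ (i, k))"
    if "i < n" "k < n" for i k
    unfolding c_def by (rule mult_column_mat_transpose[OF M'c jn that])
  have rj: "M' $$ (r, j) = 1" using M'[of r j] rn jn j by (simp add: u_def)
  have ij: "M' $$ (i, j) = 0" if "i \<in> I" "i \<noteq> r" for i
    using M'[of i j] that I jn j by (auto simp: u_def)
  have "(M' * c) $$ (r, k) = (if k = j then 1 else 0)" if "k \<in> J" for k
    using Mc[of r k] rn that J rj by (auto simp: v_def)
  moreover have "(M' * c) $$ (i, j) = (if i = r then 1 else 0)" if "i \<in> I" for i
    using Mc[of i j] jn that I rj ij by (auto simp: v_def)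
  ultimately show ?thesis using b c unfolding M'_def by blast
qed

text \<open>A Bruhat decomposition for rectangular blocks. The rows are treated by decreasing rank. A row that vanishes on the
  columns still available is left alone; otherwise \<open>pivot_step\<close> isolates one entry, and the
  induction continues without its row and column.\<close>

lemma elimination:
  fixes M :: "'a::field mat"
  assumes I: "I \<subseteq> {..<n}" and J: "J \<subseteq> {..<n}" and M: "M \<in> carrier_mat n n"
  shows "\<exists>b\<in>units_on n (chain I \<rho>). \<exists>c\<in>units_on n (chain J \<sigma>). partial_perm_on I J (b * M * c)"
proof -
  have "finite I" using I finite_subset by blast
  then show ?thesis using I J M
  proof (induction I arbitrary: J M rule: finite_ranking_induct[where f=\<rho>])
    case empty
    show ?case
      by (rule bexI[OF _ units_on_one], rule bexI[OF _ units_on_one]) (simp add: partial_perm_on_def)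
  next
    case (insert r I)
    show ?case
    proof (cases "r \<in> I")
      case True
      then show ?thesis using insert by (simp add: insert_absorb)
    next
      case rI: False
      have rn: "r < n" and In: "I \<subseteq> {..<n}" using insert.prems by auto
      have sub: "b \<in> units_on n (chain (insert r I) \<rho>)" if "b \<in> units_on n (chain I \<rho>)" for b :: "'a mat"
        using that by (rule units_on_mono) (auto simp: chain_def)
      show ?thesis
      proof (cases "\<forall>k\<in>J. M $$ (r, k) = 0")
        case zero: True
        obtain b c where b: "b \<in> units_on n (chain I \<rho>)" and c: "c \<in> units_on n (chain J \<sigma>)"
          and pp: "partial_perm_on I J (b * M * c)"
          using insert.IH[OF In insert.prems(2,3)] by blast
        have bc: "b \<in> carrier_mat n n" "c \<in> carrier_mat n n" using b c units_on_carrier by auto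
        have row: "(b * M * c) $$ (r, k) = 0" if k: "k \<in> J" for k
        proof -
          have "(b * M) $$ (r, l) = 0" if "l \<in> J" for l
            using units_on_mult_row[OF b insert.prems(3) rn, of l] rI zero that insert.prems(2)
            by (auto simp: chain_def)
          then have "(b * M * c) $$ (r, k) = (0\<^sub>m n n * c) $$ (r, k)"
            using k insert.prems bc
            by (intro units_on_mult_col_cong[OF c]) (auto simp: chain_def subset_iff)
          then show ?thesis using rn k insert.prems(2) bc by auto
        qed
        have "partial_perm_on (insert r I) J (b * M * c)"
          using pp row unfolding partial_perm_on_def by blast
        then show ?thesis using sub[OF b] c by blast
      next
        case False
        then obtain j where j: "j \<in> J" "M $$ (r, j) \<noteq> 0"
            "\<And>k. k \<in> J \<Longrightarrow> M $$ (r, k) \<noteq> 0 \<Longrightarrow> \<sigma> j \<le> \<sigma> k"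
          using ex_has_least_nat[of "\<lambda>k. k \<in> J \<and> M $$ (r, k) \<noteq> 0" _ \<sigma>] by blast
        obtain b1 c1 where b1: "b1 \<in> units_on n (chain (insert r I) \<rho>)" and c1: "c1 \<in> units_on n (chain J \<sigma>)"
          and row1: "\<And>k. k \<in> J \<Longrightarrow> (b1 * M * c1) $$ (r, k) = (if k = j then 1 else 0)"
          and col1: "\<And>i. i \<in> insert r I \<Longrightarrow> (b1 * M * c1) $$ (i, j) = (if i = r then 1 else 0)"
          using pivot_step[OF insert.prems(3,1,2), of r \<rho> j \<sigma>] insert.hyps j by blast
        define M1 where "M1 = b1 * M * c1"
        have bc1: "b1 \<in> carrier_mat n n" "c1 \<in> carrier_mat n n" using b1 c1 units_on_carrier by auto
        have M1c: "M1 \<in> carrier_mat n n" using bc1 insert.prems by (simp add: M1_def)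
        obtain b c where b: "b \<in> units_on n (chain I \<rho>)" and c: "c \<in> units_on n (chain (J - {j}) \<sigma>)"
          and pp: "partial_perm_on I (J - {j}) (b * M1 * c)"
          using insert.IH[OF In _ M1c, of "J - {j}"] insert.prems(2) by blast
        have bc: "b \<in> carrier_mat n n" "c \<in> carrier_mat n n" using b c units_on_carrier by auto
        have jn: "j < n" using j insert.prems by auto
        have bM1c: "b * M1 \<in> carrier_mat n n" using bc M1c by simp
        have rowb: "(b * M1) $$ (r, k) = (if k = j then 1 else 0)" if "k \<in> J" for k
          using units_on_mult_row[OF b M1c rn, of k] rI that insert.prems(2) row1
          by (auto simp: chain_def M1_def)
        have colj: "(b * M1 * c) $$ (i, j) = (b * M1) $$ (i, j)" if "i < n" for i
          using units_on_mult_col[OF c bM1c that jn] by (auto simp: chain_def)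
        have colj0: "(b * M1) $$ (i, j) = 0" if "i \<in> I" for i
        proof -
          have "(b * M1) $$ (i, j) = (b * 0\<^sub>m n n) $$ (i, j)"
            using that In jn M1c col1 rI
            by (intro units_on_mult_row_cong[OF b]) (auto simp: chain_def M1_def)
          then show ?thesis using that In jn bc by auto
        qed
        have row: "(b * M1 * c) $$ (r, k) = 0" if k: "k \<in> J - {j}" for k
        proof -
          have "(b * M1 * c) $$ (r, k) = (0\<^sub>m n n * c) $$ (r, k)"
            using k insert.prems bM1c rowb
            by (intro units_on_mult_col_cong[OF c]) (auto simp: chain_def subset_iff)
          then show ?thesis using rn k insert.prems(2) bc by auto
        qed
        have rj: "(b * M1 * c) $$ (r, j) = 1" using colj[OF rn] rowb j by simp
        have cj: "(b * M1 * c) $$ (i, j) = 0" if "i \<in> I" for i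
          using colj[of i] colj0[OF that] that In by auto
        have nonzero: "i = r \<and> k = j \<or> i \<in> I \<and> k \<in> J - {j}"
          if "i \<in> insert r I" "k \<in> J" "(b * M1 * c) $$ (i, k) \<noteq> 0" for i k
          using that row cj by blast
        have "partial_perm_on (insert r I) J (b * M1 * c)"
          unfolding partial_perm_on_def
        proof (intro conjI ballI impI)
          fix i k assume "i \<in> insert r I" "k \<in> J"
          then show "(b * M1 * c) $$ (i, k) = 0 \<or> (b * M1 * c) $$ (i, k) = 1"
            using pp rj nonzero[of i k] unfolding partial_perm_on_def by blast
        next
          fix i i' k assume "i \<in> insert r I" "i' \<in> insert r I" "k \<in> J"
            "(b * M1 * c) $$ (i, k) \<noteq> 0 \<and> (b * M1 * c) $$ (i', k) \<noteq> 0"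
          then show "i = i'"
            using pp nonzero[of i k] nonzero[of i' k] unfolding partial_perm_on_def by blast
        next
          fix i k k' assume "i \<in> insert r I" "k \<in> J" "k' \<in> J"
            "(b * M1 * c) $$ (i, k) \<noteq> 0 \<and> (b * M1 * c) $$ (i, k') \<noteq> 0"
          then show "k = k'"
            using pp rI nonzero[of i k] nonzero[of i k'] unfolding partial_perm_on_def by blast
        qed
        moreover have "b * M1 * c = (b * b1) * M * (c1 * c)"
          using bc bc1 insert.prems(3) M1c unfolding M1_def
          by (simp add: assoc_mult_mat[where ?n\<^sub>1=n and ?n\<^sub>2=n and ?n\<^sub>3=n and ?n\<^sub>4=n])
        moreover have "b * b1 \<in> units_on n (chain (insert r I) \<rho>)"
          by (intro units_on_mult transp_chain sub b b1)
        moreover have "c1 * c \<in> units_on n (chain J \<sigma>)"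
          by (intro units_on_mult transp_chain c1 units_on_mono[OF c]) (auto simp: chain_def)
        ultimately show ?thesis by metis
      qed
    qed
  qed
qed

section \<open>Elimination in two blocks sharing their columns\<close>

text \<open>On the block, \<open>M\<close> identifies its nonzero columns with its nonzero rows. Moving \<open>c\<close> along this bijection
  and extending it by the identity gives \<open>b\<close>. The hypothesis \<open>dom\<close> says that \<open>c\<close> maps the kernel of the block into
  itself; it is what makes the construction multiplicative, hence \<open>b\<close> invertible, and what makes
  \<open>b M\<close> agree with \<open>M c\<close> on the vanishing columns.\<close>

lemma transport:
  fixes M c :: "'a::field mat"
  assumes I: "I \<subseteq> {..<n}" and J: "J \<subseteq> {..<n}" and M: "M \<in> carrier_mat n n"
    and pp: "partial_perm_on I J M" and c: "c \<in> units_on n S"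
    and S: "\<And>l k. S l k \<Longrightarrow> l \<in> J \<and> k \<in> J"
    and dom: "\<And>l k i. S l k \<Longrightarrow> i \<in> I \<Longrightarrow> M $$ (i, l) \<noteq> 0 \<Longrightarrow> \<exists>i'\<in>I. M $$ (i', k) \<noteq> 0"
    and R: "\<And>l k i i'. S l k \<Longrightarrow> i \<in> I \<Longrightarrow> i' \<in> I \<Longrightarrow> M $$ (i, l) \<noteq> 0 \<Longrightarrow> M $$ (i', k) \<noteq> 0 \<Longrightarrow> R i i'"
  shows "\<exists>b\<in>units_on n R. \<forall>i\<in>I. \<forall>k\<in>J. (b * M) $$ (i, k) = (M * c) $$ (i, k)"
proof -
  \<comment> \<open>\<open>im\<close> is the set of nonzero rows of the block, and \<open>f\<close> sends such a row to the column of its \<open>1\<close>.\<close>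
  define im where "im = {i \<in> I. \<exists>l\<in>J. M $$ (i, l) \<noteq> 0}"
  define f where "f i = (SOME l. l \<in> J \<and> M $$ (i, l) \<noteq> 0)" for i
  have f: "f i \<in> J" "M $$ (i, f i) \<noteq> 0" "f i < n" if "i \<in> im" for i
  proof -
    have "\<exists>l. l \<in> J \<and> M $$ (i, l) \<noteq> 0" using that by (auto simp: im_def)
    from someI_ex[OF this] show "f i \<in> J" "M $$ (i, f i) \<noteq> 0" by (auto simp: f_def)
    then show "f i < n" using J by auto
  qed
  have imI: "i \<in> I" "i < n" if "i \<in> im" for i using that I by (auto simp: im_def)
  have f1: "M $$ (i, f i) = 1" if "i \<in> im" for i
    using partial_perm_onD(1)[OF pp imI(1) f(1,2)] that by blast
  have f_eq: "i \<in> im \<and> l = f i" if "i \<in> I" "l \<in> J" "M $$ (i, l) \<noteq> 0" for i l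
  proof -
    have "i \<in> im" using that by (auto simp: im_def)
    then show ?thesis using partial_perm_onD(3)[OF pp that(1,2) f(1) that(3) f(2)] by blast
  qed
  have inj: "inj_on f im"
  proof (rule inj_onI)
    fix i j assume a: "i \<in> im" "j \<in> im" "f i = f j"
    then show "i = j"
      using partial_perm_onD(2)[OF pp imI(1) imI(1) f(1) f(2), of i j] f(2)[of j] by metis
  qed
  define T where "T c = mat n n (\<lambda>(i, j). if i \<in> im \<and> j \<in> im then c $$ (f i, f j) else if i = j then 1 else 0)"
    for c :: "'a mat"
  have Tc: "T c \<in> carrier_mat n n" for c by (simp add: T_def)
  have Te: "T c $$ (i, j) = (if i \<in> im \<and> j \<in> im then c $$ (f i, f j) else if i = j then 1 else 0)"
    if "i < n" "j < n" for c i j using that by (simp add: T_def)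
  have T_off: "id_off n R (T c)" if "id_off n S c" for c
    unfolding id_off_def
  proof (intro conjI allI impI Tc)
    fix i j assume ij: "i < n" "j < n" "\<not> R i j"
    show "T c $$ (i, j) = (if i = j then 1 else 0)"
    proof (cases "i \<in> im \<and> j \<in> im")
      case True
      then have "\<not> S (f i) (f j)" using R[of "f i" "f j" i j] f imI ij by blast
      then have "c $$ (f i, f j) = (if f i = f j then 1 else 0)"
        using that f True unfolding id_off_def by blast
      then show ?thesis using True ij inj by (simp add: Te inj_on_eq_iff)
    qed (use ij in \<open>auto simp: Te\<close>)
  qed
  have off_dom: "c $$ (f i, l) = 0" if "id_off n S c" "i \<in> im" "l < n" "l \<notin> f ` im" for c i l
  proof -
    have "\<not> S (f i) l"
    proof
      assume s: "S (f i) l"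
      then obtain i' where "i' \<in> I" "M $$ (i', l) \<noteq> 0" using dom f imI \<open>i \<in> im\<close> by blast
      then show False using f_eq S[OF s] that by blast
    qed
    moreover have "l \<noteq> f i" using that by auto
    ultimately show ?thesis using that f unfolding id_off_def by metis
  qed
  have T_mult: "T c * T c' = T (c * c')" if cc: "id_off n S c" "id_off n S c'" for c c'
  proof (rule eq_matI)
    fix i j assume "i < dim_row (T (c * c'))" "j < dim_col (T (c * c'))"
    then have ij: "i < n" "j < n" using Tc[of "c * c'"] by auto
    have car: "c \<in> carrier_mat n n" "c' \<in> carrier_mat n n" using cc by (auto simp: id_off_def)
    have prod: "(T c * T c') $$ (i, j) = (\<Sum>k<n. T c $$ (i, k) * T c' $$ (k, j))"
      using mult_entry[OF Tc Tc ij] .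
    show "(T c * T c') $$ (i, j) = T (c * c') $$ (i, j)"
    proof (cases "i \<in> im \<and> j \<in> im")
      case True
      have "(\<Sum>k<n. T c $$ (i, k) * T c' $$ (k, j)) = (\<Sum>k\<in>im. c $$ (f i, f k) * c' $$ (f k, f j))"
        using True ij imI by (intro sum.mono_neutral_cong_right) (auto simp: Te)
      also have "\<dots> = (\<Sum>l\<in>f ` im. c $$ (f i, l) * c' $$ (l, f j))"
        using inj by (simp add: sum.reindex)
      also have "\<dots> = (\<Sum>l<n. c $$ (f i, l) * c' $$ (l, f j))"
        using True f off_dom[OF cc(1)] by (intro sum.mono_neutral_left) auto
      also have "\<dots> = T (c * c') $$ (i, j)"
        using True ij f car by (simp add: Te mult_entry)
      finally show ?thesis using prod by simp
    next
      case False
      show ?thesis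
      proof (cases "i \<in> im")
        case True
        then have j: "j \<notin> im" "i \<noteq> j" using False by auto
        have "T c $$ (i, k) * T c' $$ (k, j) = 0" if "k < n" for k
          using True j ij that by (cases "k = j") (simp_all add: Te)
        then have "(T c * T c') $$ (i, j) = 0" using prod by (simp del: mult_eq_0_iff)
        then show ?thesis using ij j True by (simp add: Te)
      next
        case i: False
        have "T c $$ (i, k) * T c' $$ (k, j) = (if k = i then T c' $$ (i, j) else 0)" if "k < n" for k
          using i ij that by (cases "k = i") (simp_all add: Te)
        then show ?thesis using prod ij i by (simp add: Te)
      qed
    qed
  qed (simp_all add: carrier_matD[OF Tc])
  obtain c' where c'': "c' \<in> units_on n S" and c': "c * c' = 1\<^sub>m n" "c' * c = 1\<^sub>m n"
    using units_onE[OF c] by metis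
  have c0: "id_off n S c" "id_off n S c'" using c c'' by (simp_all add: units_on_def)
  have T1: "T (1\<^sub>m n) = 1\<^sub>m n"
    using f inj by (intro eq_matI) (auto simp: Te inj_on_eq_iff carrier_matD[OF Tc])
  have "T c \<in> units_on n R"
    using T_off[OF c0(1)] T_off[OF c0(2)] T_mult[OF c0] T_mult[OF c0(2,1)] c' T1
    by (intro units_onI[of _ _ _ "T c'"]) auto
  moreover have "(T c * M) $$ (i, k) = (M * c) $$ (i, k)" if ik: "i \<in> I" "k \<in> J" for i k
  proof -
    have n: "i < n" "k < n" using ik I J by auto
    have c_out: "c $$ (l, k) = 0" if "l < n" "l \<notin> J" for l
      using c0(1) that S[of l k] n ik unfolding id_off_def by metis
    have prod1: "(T c * M) $$ (i, k) = (\<Sum>j<n. T c $$ (i, j) * M $$ (j, k))"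
      using mult_entry[OF Tc M n] .
    have prod2: "(M * c) $$ (i, k) = (\<Sum>l<n. M $$ (i, l) * c $$ (l, k))"
      using mult_entry[OF M units_on_carrier[OF c] n] .
    show ?thesis
    proof (cases "i \<in> im")
      case False
      then have z: "M $$ (i, l) = 0" if "l \<in> J" for l using that ik by (auto simp: im_def)
      then have "M $$ (i, l) * c $$ (l, k) = 0" if "l < n" for l using that c_out by (cases "l \<in> J") auto
      moreover have "T c $$ (i, j) * M $$ (j, k) = 0" if "j < n" for j
        using that False n z ik by (auto simp: Te)
      ultimately show ?thesis using prod1 prod2 by (simp del: mult_eq_0_iff)
    next
      case True
      have "M $$ (i, l) * c $$ (l, k) = (if l = f i then c $$ (f i, k) else 0)" if "l < n" for l
      proof (cases "l = f i")
        case False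
        then have "M $$ (i, l) = 0 \<or> c $$ (l, k) = 0" using f_eq[of i l] ik c_out that by blast
        then show ?thesis using False by auto
      qed (simp add: f1[OF True])
      then have r: "(M * c) $$ (i, k) = c $$ (f i, k)" using prod2 f[OF True] by simp
      show ?thesis
      proof (cases "k \<in> f ` im")
        case kim: True
        then obtain j0 where j0: "j0 \<in> im" "k = f j0" by blast
        have "T c $$ (i, j) * M $$ (j, k) = (if j = j0 then c $$ (f i, k) else 0)" if "j < n" for j
        proof (cases "j \<in> im")
          case j: True
          show ?thesis
          proof (cases "j = j0")
            case True
            then show ?thesis using \<open>i \<in> im\<close> j0 that n f1[OF j0(1)] by (simp add: Te)
          next
            case False
            then have "k \<noteq> f j" using j j0 inj by (auto simp: inj_on_eq_iff)
            then have "M $$ (j, k) = 0" using f_eq[of j k] imI[OF j] ik by blast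
            then show ?thesis using False by simp
          qed
        next
          case False
          then show ?thesis using True that n j0 by (auto simp: Te)
        qed
        then show ?thesis using r prod1 imI[OF j0(1)] by simp
      next
        case kim: False
        have "T c $$ (i, j) * M $$ (j, k) = 0" if "j < n" for j
        proof (cases "j \<in> im")
          case j: True
          then have "k \<noteq> f j" using kim by blast
          then have "M $$ (j, k) = 0" using f_eq[of j k] imI[OF j] ik by blast
          then show ?thesis by simp
        next
          case False
          then have "j \<noteq> i" using True by blast
          then show ?thesis using that n False by (simp add: Te)
        qed
        then show ?thesis using r prod1 off_dom[OF c0(1) True n(2) kim] by (simp del: mult_eq_0_iff)
      qed
    qed
  qed
  ultimately show ?thesis by blast
qed

text \<open>The inverse of the row operation from \<open>transport\<close>, phrased for an arbitrary matrix \<open>Y\<close> that agrees with \<open>M c\<close> on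
  the block. This allows other rows to be changed in between.\<close>

lemma transport_repair:
  fixes M c :: "'a::field mat"
  assumes I: "I \<subseteq> {..<n}" and J: "J \<subseteq> {..<n}" and M: "M \<in> carrier_mat n n"
    and pp: "partial_perm_on I J M" and c: "c \<in> units_on n S"
    and S: "\<And>l k. S l k \<Longrightarrow> l \<in> J \<and> k \<in> J"
    and dom: "\<And>l k i. S l k \<Longrightarrow> i \<in> I \<Longrightarrow> M $$ (i, l) \<noteq> 0 \<Longrightarrow> \<exists>i'\<in>I. M $$ (i', k) \<noteq> 0"
    and R: "\<And>l k i i'. S l k \<Longrightarrow> i \<in> I \<Longrightarrow> i' \<in> I \<Longrightarrow> M $$ (i, l) \<noteq> 0 \<Longrightarrow> M $$ (i', k) \<noteq> 0 \<Longrightarrow> R i i'"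
    and RI: "\<And>i i'. R i i' \<Longrightarrow> i \<in> I \<and> i' \<in> I"
  shows "\<exists>b\<in>units_on n R. \<forall>Y \<in> carrier_mat n n.
     (\<forall>i\<in>I. \<forall>k\<in>J. Y $$ (i, k) = (M * c) $$ (i, k)) \<longrightarrow>
     (\<forall>i\<in>I. \<forall>k\<in>J. (b * Y) $$ (i, k) = M $$ (i, k)) \<and>
     (\<forall>i\<in>{..<n} - I. \<forall>k<n. (b * Y) $$ (i, k) = Y $$ (i, k))"
proof -
  obtain b where b: "b \<in> units_on n R" and bM: "\<forall>i\<in>I. \<forall>k\<in>J. (b * M) $$ (i, k) = (M * c) $$ (i, k)"
    proof -
    have "\<exists>b\<in>units_on n R. \<forall>i\<in>I. \<forall>k\<in>J. (b * M) $$ (i, k) = (M * c) $$ (i, k)"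
      by (rule transport[OF I J M pp c]) (fact S | fact dom | fact R)+
    then show thesis using that by blast
  qed
  obtain b' where b': "b' \<in> units_on n R" "b' * b = 1\<^sub>m n" using units_onE[OF b] by metis
  have car: "b \<in> carrier_mat n n" "b' \<in> carrier_mat n n" using b b' units_on_carrier by auto
  have "(b' * Y) $$ (i, k) = M $$ (i, k)"
    if "Y \<in> carrier_mat n n" "\<forall>i\<in>I. \<forall>k\<in>J. Y $$ (i, k) = (M * c) $$ (i, k)" "i \<in> I" "k \<in> J" for Y i k
  proof -
    have "(b' * Y) $$ (i, k) = (b' * (b * M)) $$ (i, k)"
      using that I J M RI bM mult_carrier_mat[OF car(1) M]
      by (intro units_on_mult_row_cong[OF b'(1)]) auto
    then show ?thesis using left_inverse_cancel[OF car(2,1) M b'(2)] by simp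
  qed
  moreover have "(b' * Y) $$ (i, k) = Y $$ (i, k)"
    if "Y \<in> carrier_mat n n" "i \<in> {..<n} - I" "k < n" for Y i k
    using that RI by (intro units_on_mult_row[OF b'(1)]) auto
  ultimately show ?thesis using b' by blast
qed

text \<open>After the block \<open>I0\<close> has been reduced, the columns are ranked by \<open>0\<close> if they vanish on \<open>I0\<close>, and by one
  plus the rank of the row of their pivot otherwise. Elimination on \<open>I1\<close> with this rank uses only column
  operations whose effect on \<open>I0\<close> is undone by row operations respecting \<open>\<rho>\<close>.\<close>

lemma two_chain_elimination:
  fixes M :: "'a::field mat"
  assumes I0: "I0 \<subseteq> {..<n}" and I1: "I1 \<subseteq> {..<n}" and disj: "I0 \<inter> I1 = {}"
    and J: "J \<subseteq> {..<n}" and M: "M \<in> carrier_mat n n"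
  shows "\<exists>b\<in>units_on n (\<lambda>i j. chain I0 \<rho> i j \<or> chain I1 \<rho> i j).
    \<exists>c\<in>units_on n (\<lambda>i j. i \<in> J \<and> j \<in> J).
      partial_perm_on I0 J (b * M * c) \<and> partial_perm_on I1 J (b * M * c)"
proof -
  let ?R = "\<lambda>i j. chain I0 \<rho> i j \<or> chain I1 \<rho> i j" and ?S = "\<lambda>i j. i \<in> J \<and> j \<in> J"
  have tR: "transp ?R" using disj by (auto simp: transp_def chain_def)
  have tS: "transp ?S" by (auto simp: transp_def)
  obtain b1 c1 where b1: "b1 \<in> units_on n (chain I0 \<rho>)" and c1: "c1 \<in> units_on n (chain J (\<lambda>_. 0))"
    and pp1: "partial_perm_on I0 J (b1 * M * c1)"
    using elimination[OF I0 J M] by blast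
  define M1 where "M1 = b1 * M * c1"
  have car1: "b1 \<in> carrier_mat n n" "c1 \<in> carrier_mat n n" using b1 c1 units_on_carrier by auto
  have M1: "M1 \<in> carrier_mat n n" using car1 M by (simp add: M1_def)
  define \<sigma> where "\<sigma> k = (if \<exists>i\<in>I0. M1 $$ (i, k) \<noteq> 0
    then Suc (\<rho> (SOME i. i \<in> I0 \<and> M1 $$ (i, k) \<noteq> 0)) else 0)" for k
  have \<sigma>: "\<sigma> k = Suc (\<rho> i)" if "i \<in> I0" "k \<in> J" "M1 $$ (i, k) \<noteq> 0" for i k
  proof -
    have "\<exists>i. i \<in> I0 \<and> M1 $$ (i, k) \<noteq> 0" using that by blast
    from someI_ex[OF this] have "(SOME i. i \<in> I0 \<and> M1 $$ (i, k) \<noteq> 0) = i"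
      using partial_perm_onD(2)[OF pp1 _ that(1,2)] that(3) unfolding M1_def by blast
    then show ?thesis using that by (auto simp: \<sigma>_def)
  qed
  obtain b2 c2 where b2: "b2 \<in> units_on n (chain I1 \<rho>)" and c2: "c2 \<in> units_on n (chain J \<sigma>)"
    and pp2: "partial_perm_on I1 J (b2 * M1 * c2)"
    using elimination[OF I1 J M1] by blast
  have car2: "b2 \<in> carrier_mat n n" "c2 \<in> carrier_mat n n" using b2 c2 units_on_carrier by auto
  have "\<exists>b\<in>units_on n (chain I0 \<rho>). \<forall>Y \<in> carrier_mat n n.
     (\<forall>i\<in>I0. \<forall>k\<in>J. Y $$ (i, k) = (M1 * c2) $$ (i, k)) \<longrightarrow>
     (\<forall>i\<in>I0. \<forall>k\<in>J. (b * Y) $$ (i, k) = M1 $$ (i, k)) \<and>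
     (\<forall>i\<in>{..<n} - I0. \<forall>k<n. (b * Y) $$ (i, k) = Y $$ (i, k))"
  proof (rule transport_repair[OF I0 J M1 _ c2])
    show "partial_perm_on I0 J M1" using pp1 by (simp add: M1_def)
  next
    fix l k i assume a: "chain J \<sigma> l k" "i \<in> I0" "M1 $$ (i, l) \<noteq> 0"
    then have "\<sigma> k \<noteq> 0" using \<sigma>[of i l] by (auto simp: chain_def)
    then show "\<exists>i'\<in>I0. M1 $$ (i', k) \<noteq> 0" by (auto simp: \<sigma>_def split: if_splits)
  next
    fix l k i i' assume "chain J \<sigma> l k" "i \<in> I0" "i' \<in> I0" "M1 $$ (i, l) \<noteq> 0" "M1 $$ (i', k) \<noteq> 0"
    then show "chain I0 \<rho> i i'" using \<sigma>[of i l] \<sigma>[of i' k] by (auto simp: chain_def)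
  qed (auto simp: chain_def)
  then obtain b3 where b3: "b3 \<in> units_on n (chain I0 \<rho>)"
    and fix3: "\<And>Y. Y \<in> carrier_mat n n \<Longrightarrow> \<forall>i\<in>I0. \<forall>k\<in>J. Y $$ (i, k) = (M1 * c2) $$ (i, k) \<Longrightarrow>
     (\<forall>i\<in>I0. \<forall>k\<in>J. (b3 * Y) $$ (i, k) = M1 $$ (i, k)) \<and>
     (\<forall>i\<in>{..<n} - I0. \<forall>k<n. (b3 * Y) $$ (i, k) = Y $$ (i, k))"
    by blast
  have car3: "b3 \<in> carrier_mat n n" using b3 units_on_carrier by auto
  define Y where "Y = b2 * (M1 * c2)"
  have M1c2: "M1 * c2 \<in> carrier_mat n n" using M1 car2 by simp
  have Y: "Y \<in> carrier_mat n n" using M1c2 car2 by (simp add: Y_def)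
  have Y0: "Y $$ (i, k) = (M1 * c2) $$ (i, k)" if "i \<in> I0" "k \<in> J" for i k
    unfolding Y_def using that I0 J disj by (intro units_on_mult_row[OF b2 M1c2]) (auto simp: chain_def)
  have top: "\<forall>i\<in>I0. \<forall>k\<in>J. (b3 * Y) $$ (i, k) = M1 $$ (i, k)"
    and bot: "\<forall>i\<in>{..<n} - I0. \<forall>k<n. (b3 * Y) $$ (i, k) = Y $$ (i, k)"
    using fix3[OF Y] Y0 by blast+
  have "partial_perm_on I0 J (b3 * Y)"
    by (rule partial_perm_on_cong[OF _ pp1[folded M1_def]]) (use top in blast)
  moreover have "partial_perm_on I1 J (b3 * Y)"
  proof (rule partial_perm_on_cong[of I1 J _ Y])
    show "(b3 * Y) $$ (i, j) = Y $$ (i, j)" if "i \<in> I1" "j \<in> J" for i j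
      using bot that I1 J disj by blast
    show "partial_perm_on I1 J Y"
      using pp2 square_assoc[OF car2(1) M1 car2(2)] by (simp add: Y_def)
  qed
  moreover have "b3 * Y = (b3 * (b2 * b1)) * M * (c1 * c2)"
    using car1 car2 car3 M M1 unfolding Y_def M1_def by (simp add: square_assoc[where n=n])
  moreover have "b3 * (b2 * b1) \<in> units_on n ?R"
    by (intro units_on_mult[OF tR] units_on_mono[OF b1] units_on_mono[OF b2] units_on_mono[OF b3]) auto
  moreover have "c1 * c2 \<in> units_on n ?S"
    by (intro units_on_mult[OF tS] units_on_mono[OF c1] units_on_mono[OF c2]) (auto simp: chain_def)
  ultimately show ?thesis
    by (intro bexI[of _ "b3 * (b2 * b1)"] bexI[of _ "c1 * c2"]) simp_all
qed

text \<open>Transposition reverses the direction in which a rank is respected.\<close>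

lemma two_chain_elimination_columns:
  fixes M :: "'a::field mat"
  assumes J0: "J0 \<subseteq> {..<n}" and J1: "J1 \<subseteq> {..<n}" and disj: "J0 \<inter> J1 = {}"
    and I: "I \<subseteq> {..<n}" and M: "M \<in> carrier_mat n n"
  shows "\<exists>b\<in>units_on n (\<lambda>i j. i \<in> I \<and> j \<in> I).
    \<exists>c\<in>units_on n (\<lambda>i j. chain J0 \<sigma> j i \<or> chain J1 \<sigma> j i).
      partial_perm_on I J0 (b * M * c) \<and> partial_perm_on I J1 (b * M * c)"
proof -
  have Mt: "transpose_mat M \<in> carrier_mat n n" using M by simp
  obtain b c where b: "b \<in> units_on n (\<lambda>i j. chain J0 \<sigma> i j \<or> chain J1 \<sigma> i j)"
    and c: "c \<in> units_on n (\<lambda>i j. i \<in> I \<and> j \<in> I)"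
    and pp: "partial_perm_on J0 I (b * transpose_mat M * c)" "partial_perm_on J1 I (b * transpose_mat M * c)"
    using two_chain_elimination[OF J0 J1 disj I Mt] by blast
  have car: "b \<in> carrier_mat n n" "c \<in> carrier_mat n n" using b c units_on_carrier by auto
  have "transpose_mat (transpose_mat c * (M * transpose_mat b)) = b * transpose_mat M * c"
    using car M Mt by (simp add: square_transpose[where n=n] square_assoc[where n=n])
  then have t: "transpose_mat (transpose_mat c * M * transpose_mat b) = b * transpose_mat M * c"
    using car M by (simp add: square_assoc[where n=n])
  have N: "transpose_mat c * M * transpose_mat b \<in> carrier_mat n n" using car M by simp
  have "partial_perm_on I J0 (transpose_mat c * M * transpose_mat b)"
    "partial_perm_on I J1 (transpose_mat c * M * transpose_mat b)"
    using partial_perm_on_transpose[OF N J0 I] partial_perm_on_transpose[OF N J1 I] pp t by simp_all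
  moreover have "transpose_mat c \<in> units_on n (\<lambda>i j. i \<in> I \<and> j \<in> I)"
    using units_on_transpose[OF c] by (rule units_on_mono) auto
  ultimately show ?thesis using units_on_transpose[OF b] by blast
qed

section \<open>Double cosets in the general linear group\<close>

lemma units_on_GL:
  assumes "b \<in> units_on n R" shows "b \<in> carrier (GL n)"
proof -
  obtain b' where b': "b' \<in> units_on n R" "b * b' = 1\<^sub>m n" using units_onE[OF assms] by metis
  have "det b * det b' = 1"
    using det_mult[OF units_on_carrier[OF assms] units_on_carrier[OF b'(1)]] b'(2) by simp
  then show ?thesis using units_on_carrier[OF assms] by (auto simp: carrier_GL)
qed

lemma GL_units_on: "carrier (GL n) = units_on n (\<lambda>_ _. True)"
proof
  show "carrier (GL n) \<subseteq> units_on n (\<lambda>_ _. True)"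
  proof
    interpret group "GL n" by (rule group_GL)
    fix g assume g: "g \<in> carrier (GL n)"
    then have "g * inv\<^bsub>GL n\<^esub> g = 1\<^sub>m n" "inv\<^bsub>GL n\<^esub> g * g = 1\<^sub>m n" "inv\<^bsub>GL n\<^esub> g \<in> carrier (GL n)"
      using r_inv[OF g] l_inv[OF g] by simp_all
    then show "g \<in> units_on n (\<lambda>_ _. True)"
      using g by (intro units_onI[of _ _ _ "inv\<^bsub>GL n\<^esub> g"]) (auto simp: id_off_def carrier_GL)
  qed
qed (auto intro: units_on_GL)

lemma GL_E:
  assumes "g \<in> carrier (GL n)"
  obtains g' where "g' \<in> carrier (GL n)" "g * g' = 1\<^sub>m n" "g' * g = 1\<^sub>m n"
  using assms units_onE unfolding GL_units_on by metis

lemma GL_mult: "g \<in> carrier (GL n) \<Longrightarrow> h \<in> carrier (GL n) \<Longrightarrow> g * h \<in> carrier (GL n)"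
  unfolding GL_units_on by (rule units_on_mult) (simp_all add: transp_def)

lemma GL_carrier_mat: "g \<in> carrier (GL n) \<Longrightarrow> g \<in> carrier_mat n n"
  by (simp add: carrier_GL)

text \<open>\<open>Q\<close> and \<open>P\<close> are sets rather than subgroups: what is shown for a concrete group of matrices then passes to
  every set that contains a conjugate of it.\<close>

definition finite_double_cosets :: "nat \<Rightarrow> complex mat set \<Rightarrow> complex mat set \<Rightarrow> bool" where
  "finite_double_cosets n Q P \<longleftrightarrow>
     (\<exists>F. finite F \<and> F \<subseteq> carrier (GL n) \<and> (\<forall>g\<in>carrier (GL n). \<exists>u\<in>Q. \<exists>f\<in>F. \<exists>v\<in>P. g = u * f * v))"

text \<open>Finitely many labels suffice if elements with a common label lie in the same double coset: choose one
  representative for each label that occurs.\<close>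

lemma finite_double_cosetsI:
  assumes fin: "finite Y"
    and ex: "\<And>g. g \<in> carrier (GL n) \<Longrightarrow> \<exists>y\<in>Y. \<Phi> g y"
    and rel: "\<And>g g' y. g \<in> carrier (GL n) \<Longrightarrow> g' \<in> carrier (GL n) \<Longrightarrow> \<Phi> g y \<Longrightarrow> \<Phi> g' y \<Longrightarrow>
      \<exists>u\<in>Q. \<exists>v\<in>P. g = u * g' * v"
  shows "finite_double_cosets n Q P"
proof -
  define r where "r y = (SOME g. g \<in> carrier (GL n) \<and> \<Phi> g y)" for y
  define F where "F = r ` {y \<in> Y. \<exists>g\<in>carrier (GL n). \<Phi> g y}"
  have r: "r y \<in> carrier (GL n) \<and> \<Phi> (r y) y" if "g \<in> carrier (GL n)" "\<Phi> g y" for g y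
    unfolding r_def by (rule someI[of _ g]) (use that in blast)
  have "\<exists>u\<in>Q. \<exists>f\<in>F. \<exists>v\<in>P. g = u * f * v" if g: "g \<in> carrier (GL n)" for g
  proof -
    obtain y where y: "y \<in> Y" "\<Phi> g y" using ex[OF g] by blast
    have "r y \<in> F" using y g by (auto simp: F_def)
    moreover obtain u v where "u \<in> Q" "v \<in> P" "g = u * r y * v"
      using rel[OF g _ y(2), of "r y"] r[OF g y(2)] by auto
    ultimately show ?thesis by blast
  qed
  moreover have "finite F" "F \<subseteq> carrier (GL n)" using fin r by (auto simp: F_def)
  ultimately show ?thesis unfolding finite_double_cosets_def by blast
qed

lemma finite_double_cosets_conj:
  assumes fin: "finite_double_cosets n Q P"
    and sub: "Q \<subseteq> carrier (GL n)" "P \<subseteq> carrier (GL n)"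
    and x: "x \<in> carrier (GL n)" "x' \<in> carrier (GL n)" "x * x' = 1\<^sub>m n"
    and y: "y \<in> carrier (GL n)" "y' \<in> carrier (GL n)" "y * y' = 1\<^sub>m n"
    and Q: "\<And>u. u \<in> Q \<Longrightarrow> x * u * x' \<in> Q2" and P: "\<And>v. v \<in> P \<Longrightarrow> y * v * y' \<in> P2"
  shows "finite_double_cosets n Q2 P2"
proof -
  obtain F where F: "finite F" "F \<subseteq> carrier (GL n)"
    "\<forall>g\<in>carrier (GL n). \<exists>u\<in>Q. \<exists>f\<in>F. \<exists>v\<in>P. g = u * f * v"
    using fin unfolding finite_double_cosets_def by auto
  note car = x(1,2)[THEN GL_carrier_mat] y(1,2)[THEN GL_carrier_mat]
  have x': "x' * x = 1\<^sub>m n" using mat_mult_left_right_inverse[OF car(1,2) x(3)] .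
  have y': "y' * y = 1\<^sub>m n" using mat_mult_left_right_inverse[OF car(3,4) y(3)] .
  have "\<exists>u\<in>Q2. \<exists>f\<in>(\<lambda>f. x * f * y') ` F. \<exists>v\<in>P2. g = u * f * v" if g: "g \<in> carrier (GL n)" for g
  proof -
    obtain u f v where ufv: "u \<in> Q" "f \<in> F" "v \<in> P" "x' * g * y = u * f * v"
      using bspec[OF F(3), of "x' * g * y"] x y g by (auto intro: GL_mult)
    have car2: "u \<in> carrier_mat n n" "f \<in> carrier_mat n n" "v \<in> carrier_mat n n" "g \<in> carrier_mat n n"
      using ufv F sub g GL_carrier_mat by blast+
    have "g = x * (x' * g * y) * y'"
      using car car2 x y by (simp add: square_assoc[where n=n] left_inverse_cancel[where n=n])
    also have "\<dots> = (x * u * x') * (x * f * y') * (y * v * y')"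
      unfolding ufv(4) using car car2 x' y'
      by (simp add: square_assoc[where n=n] left_inverse_cancel[where n=n])
    finally show ?thesis using Q[OF ufv(1)] P[OF ufv(3)] ufv(2) by blast
  qed
  moreover have "(\<lambda>f. x * f * y') ` F \<subseteq> carrier (GL n)" using F(2) x y GL_mult by blast
  ultimately show ?thesis using F(1) unfolding finite_double_cosets_def by blast
qed

lemma double_coset_relI:
  assumes Q: "transp R" "b \<in> units_on n R" "b2 \<in> units_on n R"
    and P: "transp S" "c \<in> units_on n S" "c2 \<in> units_on n S" "h \<in> units_on n S"
    and g: "g \<in> carrier (GL n)" "g2 \<in> carrier (GL n)" and eq: "b * g * c = b2 * g2 * c2 * h"
  shows "\<exists>u\<in>units_on n R. \<exists>v\<in>units_on n S. g = u * g2 * v"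
proof -
  obtain b' where b': "b' \<in> units_on n R" "b' * b = 1\<^sub>m n" using units_onE[OF Q(2)] by metis
  obtain c' where c': "c' \<in> units_on n S" "c * c' = 1\<^sub>m n" using units_onE[OF P(2)] by metis
  note car = units_on_carrier[OF Q(2)] units_on_carrier[OF Q(3)] units_on_carrier[OF P(2)]
    units_on_carrier[OF P(3)] units_on_carrier[OF P(4)] units_on_carrier[OF b'(1)]
    units_on_carrier[OF c'(1)] GL_carrier_mat[OF g(1)] GL_carrier_mat[OF g(2)]
  have "g = b' * (b * g * c) * c'"
    using car b' c' by (simp add: square_assoc[where n=n] left_inverse_cancel[where n=n])
  also have "\<dots> = (b' * b2) * g2 * (c2 * h * c')"
    unfolding eq using car by (simp add: square_assoc[where n=n])
  finally show ?thesis
    using Q P b' c' by (intro bexI[of _ "b' * b2"] bexI[of _ "c2 * h * c'"]) (auto intro!: units_on_mult)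
qed

text \<open>The first \<open>m\<close> columns of \<open>M\<close> form the zero-one matrix with support \<open>S\<close>.\<close>

definition pattern :: "nat \<Rightarrow> nat \<Rightarrow> complex mat \<Rightarrow> (nat \<times> nat) set \<Rightarrow> bool" where
  "pattern n m M S \<longleftrightarrow> (\<forall>i<n. \<forall>k<m. M $$ (i, k) = of_bool ((i, k) \<in> S))"

lemma pattern_exists:
  assumes "\<And>i k. i < n \<Longrightarrow> k < m \<Longrightarrow> M $$ (i, k) = 0 \<or> M $$ (i, k) = 1" "m \<le> n"
  shows "\<exists>S\<in>Pow ({..<n} \<times> {..<n}). pattern n m M S"
proof -
  have "pattern n m M ({(i, k). M $$ (i, k) = 1} \<inter> {..<n} \<times> {..<n})"
    using assms by (fastforce simp: pattern_def of_bool_def)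
  then show ?thesis by blast
qed

lemma finite_patterns: "finite (Pow ({..<n::nat} \<times> {..<n::nat}))"
  by simp

lemma pattern_unique:
  assumes "pattern n n X S" "pattern n n Y S" "X \<in> carrier_mat n n" "Y \<in> carrier_mat n n"
  shows "X = Y"
proof (rule eq_matI)
  fix i j assume "i < dim_row Y" "j < dim_col Y"
  then have "i < n" "j < n" using assms(4) by auto
  then show "X $$ (i, j) = Y $$ (i, j)" using assms(1,2) by (simp only: pattern_def)
qed (use assms(3,4) in auto)

lemma mult_pattern_column:
  assumes "A \<in> carrier_mat n n" "X \<in> carrier_mat n n" "Y \<in> carrier_mat n n"
    and "\<And>l. l < n \<Longrightarrow> X $$ (l, k) = Y $$ (l, k)" "i < n" "k < n"
  shows "(A * X) $$ (i, k) = (A * Y) $$ (i, k)"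
  using assms by (simp add: mult_entry)

text \<open>The first \<open>m2\<close> columns of \<open>X x\<close> are determined up to the action of \<open>x\<close> by the pattern of \<open>X\<close>, and
  the first \<open>m1\<close> columns of \<open>x\<close> by its own pattern. So \<open>X x\<close> and \<open>Y y\<close> represent the same pair of subspaces,
  and their quotient stabilises the coordinate subspaces of dimensions \<open>m1\<close> and \<open>m2\<close>.\<close>

lemma prefix_quotient:
  assumes X: "X \<in> carrier (GL n)" "Y \<in> carrier (GL n)" "pattern n m2 X S" "pattern n m2 Y S"
    and x: "x \<in> units_on n (\<lambda>i j. j < m2 \<longrightarrow> i < m2)" "y \<in> units_on n (\<lambda>i j. j < m2 \<longrightarrow> i < m2)"
      "pattern n m1 x S'" "pattern n m1 y S'"
    and inv: "Y' \<in> carrier (GL n)" "Y' * Y = 1\<^sub>m n" "y' \<in> units_on n (\<lambda>i j. j < m2 \<longrightarrow> i < m2)" "y' * y = 1\<^sub>m n"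
    and m: "m1 \<le> m2" "m2 \<le> n"
  shows "id_off n (\<lambda>i j. (j < m1 \<longrightarrow> i < m1) \<and> (j < m2 \<longrightarrow> i < m2)) (y' * (Y' * (X * x)))"
proof -
  let ?P = "\<lambda>i j. j < m2 \<longrightarrow> i < m2"
  note car = X(1,2)[THEN GL_carrier_mat] x(1,2)[THEN units_on_carrier] GL_carrier_mat[OF inv(1)] units_on_carrier[OF inv(3)]
  have colXx: "(Y' * (X * x)) $$ (l, k) = x $$ (l, k)" if lk: "l < n" "k < m2" for l k
  proof -
    have "(X * x) $$ (l, k) = (Y * x) $$ (l, k)" if "l < n" for l
      using that lk m X by (intro units_on_mult_col_cong[OF x(1) car(1,2)]) (auto simp: pattern_def)
    then have "(Y' * (X * x)) $$ (l, k) = (Y' * (Y * x)) $$ (l, k)"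
      using lk m car by (intro mult_pattern_column[where n=n]) auto
    then show ?thesis using car inv by (simp add: left_inverse_cancel[where n=n])
  qed
  have h: "(y' * (Y' * (X * x))) $$ (i, k) = (y' * x) $$ (i, k)" if "i < n" "k < m2" for i k
    using colXx that m car by (intro mult_pattern_column[where n=n]) auto
  have h1: "(y' * (Y' * (X * x))) $$ (i, k) = (if i = k then 1 else 0)" if ik: "i < n" "k < m1" for i k
  proof -
    have "(y' * x) $$ (i, k) = (y' * y) $$ (i, k)"
      using ik m car x(3,4) by (intro mult_pattern_column[where n=n]) (auto simp: pattern_def)
    then show ?thesis using h[of i k] ik m inv by simp
  qed
  have "y' * x \<in> units_on n ?P" using inv x by (intro units_on_mult) (auto simp: transp_def)
  then have h2: "(y' * (Y' * (X * x))) $$ (i, k) = 0" if "i < n" "k < m2" "\<not> i < m2" for i k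
    using units_on_off[of "y' * x" n ?P i k] h[of i k] that m by auto
  show ?thesis unfolding id_off_def using h1 h2 m car by auto
qed

section \<open>A subspace relative to two full flags\<close>

text \<open>The first \<open>m\<close> columns, which span the subspace, are brought to zero-one form by
  \<open>two_chain_elimination\<close>. Two matrices with the same first \<open>m\<close> columns differ by a right factor in the stabiliser.\<close>

lemma finite_double_cosets_subspace:
  assumes "m \<le> n"
  shows "finite_double_cosets n (units_on n (\<lambda>i j. (i < p \<longleftrightarrow> j < p) \<and> i \<le> j))
    (units_on n (\<lambda>i j. j < m \<longrightarrow> i < m))" (is "finite_double_cosets n (units_on n ?R) (units_on n ?S)")
proof (rule finite_double_cosetsI[OF finite_patterns[of n],
      where \<Phi> = "\<lambda>g S. \<exists>b\<in>units_on n ?R. \<exists>c\<in>units_on n ?S. pattern n m (b * g * c) S"])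
  have tR: "transp ?R" and tS: "transp ?S" by (auto simp: transp_def)
  {
    fix g assume g: "g \<in> carrier (GL n)"
    let ?I0 = "{..<p} \<inter> {..<n}" and ?I1 = "{p..<n}"
    obtain b c where b: "b \<in> units_on n (\<lambda>i j. chain ?I0 (\<lambda>i. i) i j \<or> chain ?I1 (\<lambda>i. i) i j)"
      and c: "c \<in> units_on n (\<lambda>i j. i \<in> {..<m} \<and> j \<in> {..<m})"
      and pp: "partial_perm_on ?I0 {..<m} (b * g * c)" "partial_perm_on ?I1 {..<m} (b * g * c)"
      using two_chain_elimination[of ?I0 n ?I1 "{..<m}" g "\<lambda>i. i"] g assms GL_carrier_mat by fastforce
    have "(b * g * c) $$ (i, k) = 0 \<or> (b * g * c) $$ (i, k) = 1" if "i < n" "k < m" for i k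
      using partial_perm_onD(1)[OF pp(1), of i k] partial_perm_onD(1)[OF pp(2), of i k] that
      by (cases "i < p") auto
    then obtain S where "S \<in> Pow ({..<n} \<times> {..<n})" "pattern n m (b * g * c) S"
      using pattern_exists[OF _ assms, of "b * g * c"] by metis
    moreover have "b \<in> units_on n ?R" by (rule units_on_mono[OF b]) (auto simp: chain_def)
    moreover have "c \<in> units_on n ?S" by (rule units_on_mono[OF c]) auto
    ultimately show "\<exists>S\<in>Pow ({..<n} \<times> {..<n}). \<exists>b\<in>units_on n ?R. \<exists>c\<in>units_on n ?S. pattern n m (b * g * c) S"
      by blast
  next
    fix g g2 S
    assume g: "g \<in> carrier (GL n)" "g2 \<in> carrier (GL n)"
      and "\<exists>b\<in>units_on n ?R. \<exists>c\<in>units_on n ?S. pattern n m (b * g * c) S"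
        "\<exists>b\<in>units_on n ?R. \<exists>c\<in>units_on n ?S. pattern n m (b * g2 * c) S"
    then obtain b c b2 c2 where b: "b \<in> units_on n ?R" "b2 \<in> units_on n ?R"
      and c: "c \<in> units_on n ?S" "c2 \<in> units_on n ?S"
      and pat: "pattern n m (b * g * c) S" "pattern n m (b2 * g2 * c2) S" by blast
    define X where "X = b * g * c"
    define Y where "Y = b2 * g2 * c2"
    have XY: "X \<in> carrier (GL n)" "Y \<in> carrier (GL n)"
      using b c g unfolding X_def Y_def by (auto intro!: GL_mult intro: units_on_GL)
    obtain X' where X': "X' \<in> carrier (GL n)" "X' * X = 1\<^sub>m n" "X * X' = 1\<^sub>m n" using GL_E[OF XY(1)] by metis
    obtain Y' where Y': "Y' \<in> carrier (GL n)" "Y' * Y = 1\<^sub>m n" "Y * Y' = 1\<^sub>m n" using GL_E[OF XY(2)] by metis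
    note car = XY[THEN GL_carrier_mat] GL_carrier_mat[OF X'(1)] GL_carrier_mat[OF Y'(1)]
    note pat' = pat[folded X_def Y_def]
    have one: "1\<^sub>m n \<in> units_on n ?S" "pattern n 0 (1\<^sub>m n) {}" by (simp_all add: units_on_one pattern_def)
    have "id_off n ?S (1\<^sub>m n * (Y' * (X * 1\<^sub>m n)))"
      using prefix_quotient[OF XY pat' one(1) one(1) one(2) one(2) Y'(1,2) one(1) _ le0 assms] by simp
    moreover have "id_off n ?S (1\<^sub>m n * (X' * (Y * 1\<^sub>m n)))"
      using prefix_quotient[OF XY(2,1) pat'(2,1) one(1) one(1) one(2) one(2) X'(1,2) one(1) _ le0 assms] by simp
    ultimately have h: "Y' * X \<in> units_on n ?S"
      using car X' Y' by (intro units_onI[of _ _ _ "X' * Y"])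
        (simp_all add: square_assoc[where n=n] left_inverse_cancel[where n=n])
    have eq: "b * g * c = b2 * g2 * c2 * (Y' * X)"
      using left_inverse_cancel[OF car(2,4,1) Y'(3)] by (simp add: X_def Y_def)
    show "\<exists>u\<in>units_on n ?R. \<exists>v\<in>units_on n ?S. g = u * g2 * v"
      by (rule double_coset_relI[OF tR b tS c h g eq])
  }
qed

section \<open>Two nested subspaces and a subspace of one summand\<close>

text \<open>The columns of \<open>X\<close> below \<open>m2\<close> describe the larger subspace, those of \<open>x\<close> below \<open>m1\<close> describe the smaller one in
  terms of this basis of the larger one.

  Let \<open>M\<close> be the matrix after the first elimination. For a column \<open>k\<close>, the number \<open>\<nu> k\<close> is \<open>0\<close>, \<open>1\<close> or \<open>2\<close>
  according to whether its \<open>I0\<close> part is zero, has its pivot in \<open>U\<close>, or has its pivot outside \<open>U\<close>; and \<open>\<mu> k\<close> is \<open>0\<close>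
  or \<open>1\<close> according to whether its \<open>I1\<close> part is zero. Adding column \<open>l\<close> to column \<open>k\<close> can be undone by
  row operations in the stabiliser of \<open>U\<close> as soon as \<open>\<nu> l \<le> \<nu> k\<close> and \<open>\<mu> l \<le> \<mu> k\<close>. The pairs \<open>(\<nu>, \<mu>)\<close> are not totally
  ordered, but \<open>(0,0) \<le> (1,0) \<le> (2,0) \<le> (2,1)\<close> and \<open>(0,1) \<le> (1,1)\<close> are two chains that exhaust them, and on
  each chain the order is that of \<open>\<nu> + \<mu>\<close>.\<close>

lemma two_step_normal_form:
  assumes I: "I0 \<union> I1 = {..<n}" "I0 \<inter> I1 = {}" and U: "U \<subseteq> I0" and m: "m1 \<le> m2" "m2 \<le> n"
    and g: "g \<in> carrier (GL n)"
  shows "\<exists>b\<in>units_on n (\<lambda>i j. (i \<in> I0 \<longleftrightarrow> j \<in> I0) \<and> (j \<in> U \<longrightarrow> i \<in> U)).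
    \<exists>c\<in>units_on n (\<lambda>i j. (j < m1 \<longrightarrow> i < m1) \<and> (j < m2 \<longrightarrow> i < m2)).
    \<exists>X\<in>carrier (GL n). \<exists>x\<in>units_on n (\<lambda>i j. j < m2 \<longrightarrow> i < m2). b * g * c = X * x \<and>
      (\<forall>i<n. \<forall>k<m2. X $$ (i, k) = 0 \<or> X $$ (i, k) = 1) \<and> (\<forall>i<n. \<forall>k<m1. x $$ (i, k) = 0 \<or> x $$ (i, k) = 1)"
    (is "\<exists>b\<in>units_on n ?Q. \<exists>c\<in>units_on n ?P. _")
proof -
  define J where "J = {..<m2}"
  have Jn: "J \<subseteq> {..<n}" and I0n: "I0 \<subseteq> {..<n}" and I1n: "I1 \<subseteq> {..<n}" using m I by (auto simp: J_def)
  have gc: "g \<in> carrier_mat n n" using g by (rule GL_carrier_mat)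
  \<comment> \<open>Rank \<open>0\<close> for \<open>U\<close> below rank \<open>1\<close> for the rest of \<open>I0\<close> encodes the stabiliser of \<open>U\<close>.\<close>
  define \<rho> :: "nat \<Rightarrow> nat" where "\<rho> i = (if i \<in> U \<or> i \<in> I1 then 0 else 1)" for i
  obtain b1 c1 where b1: "b1 \<in> units_on n (\<lambda>i j. chain I0 \<rho> i j \<or> chain I1 \<rho> i j)"
    and c1: "c1 \<in> units_on n (\<lambda>i j. i \<in> J \<and> j \<in> J)"
    and pp: "partial_perm_on I0 J (b1 * g * c1)" "partial_perm_on I1 J (b1 * g * c1)"
    using two_chain_elimination[OF I0n I1n I(2) Jn gc, of \<rho>] by auto
  define M where "M = b1 * g * c1"
  note pp = pp[folded M_def]
  obtain c1' where c1': "c1' \<in> units_on n (\<lambda>i j. i \<in> J \<and> j \<in> J)" "c1 * c1' = 1\<^sub>m n" "c1' * c1 = 1\<^sub>m n"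
    using units_onE[OF c1] by metis
  note car1 = units_on_carrier[OF b1] units_on_carrier[OF c1] units_on_carrier[OF c1'(1)] gc
  have Mc: "M \<in> carrier_mat n n" using car1 by (simp add: M_def)
  define \<nu> :: "nat \<Rightarrow> nat" where
    "\<nu> k = (if \<exists>i\<in>U. M $$ (i, k) \<noteq> 0 then 1 else if \<exists>i\<in>I0. M $$ (i, k) \<noteq> 0 then 2 else 0)" for k
  define \<mu> :: "nat \<Rightarrow> nat" where "\<mu> k = (if \<exists>i\<in>I1. M $$ (i, k) \<noteq> 0 then 1 else 0)" for k
  define r where "r k = \<nu> k + \<mu> k" for k
  define K0 where "K0 = {k \<in> J. \<mu> k = 0 \<or> \<nu> k = 2}"
  define K1 where "K1 = J - K0"
  define S where "S l k \<longleftrightarrow> chain K0 r l k \<or> chain K1 r l k" for l k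
  have S_J: "l \<in> J \<and> k \<in> J" if "S l k" for l k using that by (auto simp: S_def chain_def K0_def K1_def)
  have range: "\<nu> k \<in> {0, 1, 2}" "\<mu> k \<in> {0, 1}" for k by (auto simp: \<nu>_def \<mu>_def)
  have S_mono: "\<nu> l \<le> \<nu> k \<and> \<mu> l \<le> \<mu> k" if "S l k" for l k
    using that range[of l] range[of k] by (auto simp: S_def chain_def K0_def K1_def r_def)
  have \<nu>I: "\<nu> k = (if i \<in> U then 1 else 2)" if "i \<in> I0" "k \<in> J" "M $$ (i, k) \<noteq> 0" for i k
  proof (cases "i \<in> U")
    case True
    then show ?thesis using that by (auto simp: \<nu>_def)
  next
    case False
    then have "\<not> (\<exists>i'\<in>U. M $$ (i', k) \<noteq> 0)"
      using partial_perm_onD(2)[OF pp(1) that(1) _ that(2,3)] U by blast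
    then show ?thesis using that False by (auto simp: \<nu>_def)
  qed
  have K: "K0 \<subseteq> {..<n}" "K1 \<subseteq> {..<n}" "K0 \<inter> K1 = {}" and J1: "{..<m1} \<subseteq> {..<n}"
    using Jn m by (auto simp: K0_def K1_def)
  \<comment> \<open>The inverse of the column operation \<open>c1\<close> of the first elimination is treated as the matrix of the
    smaller subspace: its rows are the columns of \<open>M\<close>.\<close>
  obtain y z where y: "y \<in> units_on n S"
    and z: "z \<in> units_on n (\<lambda>i j. i \<in> {..<m1} \<and> j \<in> {..<m1})"
    and pp2: "partial_perm_on K0 {..<m1} (y * c1' * z)" "partial_perm_on K1 {..<m1} (y * c1' * z)"
    using two_chain_elimination[OF K J1 car1(3), of r] unfolding S_def by auto
  obtain y' where y': "y' \<in> units_on n S" "y * y' = 1\<^sub>m n" "y' * y = 1\<^sub>m n" using units_onE[OF y] by metis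
  note car2 = units_on_carrier[OF y] units_on_carrier[OF y'(1)] units_on_carrier[OF z]
  have "\<exists>b\<in>units_on n (chain I0 \<rho>). \<forall>Y \<in> carrier_mat n n.
     (\<forall>i\<in>I0. \<forall>k\<in>J. Y $$ (i, k) = (M * y') $$ (i, k)) \<longrightarrow>
     (\<forall>i\<in>I0. \<forall>k\<in>J. (b * Y) $$ (i, k) = M $$ (i, k)) \<and>
     (\<forall>i\<in>{..<n} - I0. \<forall>k<n. (b * Y) $$ (i, k) = Y $$ (i, k))"
  proof (rule transport_repair[OF I0n Jn Mc pp(1) y'(1)])
    fix l k i assume a: "S l k" "i \<in> I0" "M $$ (i, l) \<noteq> 0"
    then have "\<nu> k \<noteq> 0" using \<nu>I[of i l] S_mono[of l k] S_J[of l k] by (auto split: if_splits)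
    then show "\<exists>i'\<in>I0. M $$ (i', k) \<noteq> 0" using U by (auto simp: \<nu>_def split: if_splits)
  next
    fix l k i i' assume a: "S l k" "i \<in> I0" "i' \<in> I0" "M $$ (i, l) \<noteq> 0" "M $$ (i', k) \<noteq> 0"
    then have "i' \<in> U \<longrightarrow> i \<in> U"
      using \<nu>I[of i l] \<nu>I[of i' k] S_mono[of l k] S_J[of l k] by (auto split: if_splits)
    then show "chain I0 \<rho> i i'" using a I by (auto simp: chain_def \<rho>_def)
  qed (use S_J in \<open>auto simp: chain_def\<close>)
  then obtain b2 where b2: "b2 \<in> units_on n (chain I0 \<rho>)"
    and fix2: "\<And>Y. Y \<in> carrier_mat n n \<Longrightarrow> \<forall>i\<in>I0. \<forall>k\<in>J. Y $$ (i, k) = (M * y') $$ (i, k) \<Longrightarrow>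
     (\<forall>i\<in>I0. \<forall>k\<in>J. (b2 * Y) $$ (i, k) = M $$ (i, k)) \<and>
     (\<forall>i\<in>{..<n} - I0. \<forall>k<n. (b2 * Y) $$ (i, k) = Y $$ (i, k))"
    by blast
  have "\<exists>b\<in>units_on n (\<lambda>i i'. i \<in> I1 \<and> i' \<in> I1). \<forall>Y \<in> carrier_mat n n.
     (\<forall>i\<in>I1. \<forall>k\<in>J. Y $$ (i, k) = (M * y') $$ (i, k)) \<longrightarrow>
     (\<forall>i\<in>I1. \<forall>k\<in>J. (b * Y) $$ (i, k) = M $$ (i, k)) \<and>
     (\<forall>i\<in>{..<n} - I1. \<forall>k<n. (b * Y) $$ (i, k) = Y $$ (i, k))"
  proof (rule transport_repair[OF I1n Jn Mc pp(2) y'(1)])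
    fix l k i assume a: "S l k" "i \<in> I1" "M $$ (i, l) \<noteq> 0"
    then have "\<mu> k \<noteq> 0" using S_mono[of l k] by (auto simp: \<mu>_def split: if_splits)
    then show "\<exists>i'\<in>I1. M $$ (i', k) \<noteq> 0" by (auto simp: \<mu>_def split: if_splits)
  qed (use S_J in auto)
  then obtain b3 where b3: "b3 \<in> units_on n (\<lambda>i i'. i \<in> I1 \<and> i' \<in> I1)"
    and fix3: "\<And>Y. Y \<in> carrier_mat n n \<Longrightarrow> \<forall>i\<in>I1. \<forall>k\<in>J. Y $$ (i, k) = (M * y') $$ (i, k) \<Longrightarrow>
     (\<forall>i\<in>I1. \<forall>k\<in>J. (b3 * Y) $$ (i, k) = M $$ (i, k)) \<and>
     (\<forall>i\<in>{..<n} - I1. \<forall>k<n. (b3 * Y) $$ (i, k) = Y $$ (i, k))"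
    by blast
  note car3 = units_on_carrier[OF b2] units_on_carrier[OF b3]
  have My': "M * y' \<in> carrier_mat n n" "b2 * (M * y') \<in> carrier_mat n n" using Mc car2 car3 by simp_all
  have r2: "\<forall>i\<in>I0. \<forall>k\<in>J. (b2 * (M * y')) $$ (i, k) = M $$ (i, k)"
    and r2': "\<forall>i\<in>{..<n} - I0. \<forall>k<n. (b2 * (M * y')) $$ (i, k) = (M * y') $$ (i, k)"
    using fix2[OF My'(1)] by auto
  define X where "X = b3 * (b2 * (M * y'))"
  have "\<forall>i\<in>I1. \<forall>k\<in>J. (b2 * (M * y')) $$ (i, k) = (M * y') $$ (i, k)"
    using r2' I I1n Jn by blast
  then have r3: "\<forall>i\<in>I1. \<forall>k\<in>J. X $$ (i, k) = M $$ (i, k)"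
    and r3': "\<forall>i\<in>{..<n} - I1. \<forall>k<n. X $$ (i, k) = (b2 * (M * y')) $$ (i, k)"
    using fix3[OF My'(2)] unfolding X_def by blast+
  have XM: "X $$ (i, k) = M $$ (i, k)" if "i < n" "k < m2" for i k
  proof (cases "i \<in> I1")
    case True
    then show ?thesis using r3 that by (simp add: J_def)
  next
    case False
    then have "i \<in> I0" using that I by auto
    then show ?thesis using False r3' r2 that m by (simp add: J_def)
  qed
  have X01: "X $$ (i, k) = 0 \<or> X $$ (i, k) = 1" if "i < n" "k < m2" for i k
  proof -
    have "k \<in> J" "i \<in> I0 \<or> i \<in> I1" using that I by (auto simp: J_def)
    then show ?thesis using XM[OF that] partial_perm_onD(1)[OF pp(1), of i k] partial_perm_onD(1)[OF pp(2), of i k]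
      by auto
  qed
  define x where "x = y * c1' * z"
  have tJ: "transp (\<lambda>i j. i \<in> J \<and> j \<in> J)" by (auto simp: transp_def)
  have x: "x \<in> units_on n (\<lambda>i j. i \<in> J \<and> j \<in> J)"
    unfolding x_def using m
    by (intro units_on_mult[OF tJ] c1'(1) units_on_mono[OF y] units_on_mono[OF z])
      (auto simp: J_def dest: S_J[unfolded J_def])
  have x01: "x $$ (i, k) = 0 \<or> x $$ (i, k) = 1" if "i < n" "k < m1" for i k
  proof (cases "i \<in> J")
    case True
    then have "i \<in> K0 \<or> i \<in> K1" by (auto simp: K1_def)
    then show ?thesis
      using partial_perm_onD(1)[OF pp2(1), of i k] partial_perm_onD(1)[OF pp2(2), of i k] that
      by (auto simp: x_def)
  next
    case False
    then show ?thesis using units_on_off[OF x that(1), of k] that m by auto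
  qed
  have Xc: "X \<in> carrier_mat n n" using My' car3 by (simp add: X_def)
  have eq: "(b3 * (b2 * b1)) * g * z = X * x"
    unfolding X_def x_def M_def using car1 car2 car3 y'(3) c1'(2)
    by (simp add: square_assoc[where n=n] left_inverse_cancel[where n=n])
  have y'G: "y' \<in> carrier (GL n)" "b1 \<in> carrier (GL n)" "c1 \<in> carrier (GL n)" "b2 \<in> carrier (GL n)"
    "b3 \<in> carrier (GL n)"
    using y' b1 c1 b2 b3 units_on_GL by auto
  then have XG: "X \<in> carrier (GL n)" using g unfolding X_def M_def by (intro GL_mult)
  have tQ: "transp ?Q" by (auto simp: transp_def)
  have "b3 * (b2 * b1) \<in> units_on n ?Q"
    using I U by (intro units_on_mult[OF tQ] units_on_mono[OF b1] units_on_mono[OF b2] units_on_mono[OF b3])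
      (auto simp: chain_def \<rho>_def split: if_splits)
  moreover have "z \<in> units_on n ?P" by (rule units_on_mono[OF z]) (use m in auto)
  moreover have "x \<in> units_on n (\<lambda>i j. j < m2 \<longrightarrow> i < m2)" by (rule units_on_mono[OF x]) (auto simp: J_def)
  ultimately show ?thesis using XG eq X01 x01 by blast
qed

text \<open>The label of \<open>g\<close> consists of the two zero-one matrices from \<open>two_step_normal_form\<close>; by
  \<open>prefix_quotient\<close> they determine the double coset.\<close>

lemma finite_double_cosets_two_step:
  assumes I: "I0 \<union> I1 = {..<n}" "I0 \<inter> I1 = {}" and U: "U \<subseteq> I0" and m: "m1 \<le> m2" "m2 \<le> n"
  shows "finite_double_cosets n (units_on n (\<lambda>i j. (i \<in> I0 \<longleftrightarrow> j \<in> I0) \<and> (j \<in> U \<longrightarrow> i \<in> U)))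
    (units_on n (\<lambda>i j. (j < m1 \<longrightarrow> i < m1) \<and> (j < m2 \<longrightarrow> i < m2)))"
    (is "finite_double_cosets n (units_on n ?Q) (units_on n ?P)")
proof -
  let ?W = "units_on n (\<lambda>i j. j < m2 \<longrightarrow> i < m2)"
  define \<Phi> where "\<Phi> g SS \<longleftrightarrow> (\<exists>b\<in>units_on n ?Q. \<exists>c\<in>units_on n ?P. \<exists>X\<in>carrier (GL n). \<exists>x\<in>?W.
     b * g * c = X * x \<and> pattern n m2 X (fst SS) \<and> pattern n m1 x (snd SS))" for g SS
  have tQ: "transp ?Q" and tP: "transp ?P" by (auto simp: transp_def)
  show ?thesis
  proof (rule finite_double_cosetsI[where \<Phi> = \<Phi> and Y = "Pow ({..<n} \<times> {..<n}) \<times> Pow ({..<n} \<times> {..<n})"])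
    fix g assume g: "g \<in> carrier (GL n)"
    obtain b c X x where b: "b \<in> units_on n ?Q" "c \<in> units_on n ?P" "X \<in> carrier (GL n)" "x \<in> ?W"
      "b * g * c = X * x" and X01: "\<And>i k. i < n \<Longrightarrow> k < m2 \<Longrightarrow> X $$ (i, k) = 0 \<or> X $$ (i, k) = 1"
      and x01: "\<And>i k. i < n \<Longrightarrow> k < m1 \<Longrightarrow> x $$ (i, k) = 0 \<or> x $$ (i, k) = 1"
      using two_step_normal_form[OF I U m g] by auto
    obtain S where S: "S \<in> Pow ({..<n} \<times> {..<n})" "pattern n m2 X S"
      using pattern_exists[OF X01 m(2)] by metis
    obtain S' where S': "S' \<in> Pow ({..<n} \<times> {..<n})" "pattern n m1 x S'"
      using pattern_exists[of n m1 x, OF x01] m by force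
    have "\<Phi> g (S, S')" unfolding \<Phi>_def using b S S' by auto
    then show "\<exists>y\<in>Pow ({..<n} \<times> {..<n}) \<times> Pow ({..<n} \<times> {..<n}). \<Phi> g y" using S S' by blast
  next
    fix g g2 SS assume g: "g \<in> carrier (GL n)" "g2 \<in> carrier (GL n)" and phi: "\<Phi> g SS" "\<Phi> g2 SS"
    obtain b c X x where b: "b \<in> units_on n ?Q" and c: "c \<in> units_on n ?P" and X: "X \<in> carrier (GL n)"
      and x: "x \<in> ?W" and eq: "b * g * c = X * x" and pX: "pattern n m2 X (fst SS)" and px: "pattern n m1 x (snd SS)"
      using phi(1) unfolding \<Phi>_def by auto
    obtain b2 c2 Y y where b2: "b2 \<in> units_on n ?Q" and c2: "c2 \<in> units_on n ?P" and Y: "Y \<in> carrier (GL n)"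
      and y: "y \<in> ?W" and eq2: "b2 * g2 * c2 = Y * y" and pY: "pattern n m2 Y (fst SS)" and py: "pattern n m1 y (snd SS)"
      using phi(2) unfolding \<Phi>_def by auto
    obtain X' where X': "X' \<in> carrier (GL n)" "X * X' = 1\<^sub>m n" "X' * X = 1\<^sub>m n" using GL_E[OF X] by metis
    obtain Y' where Y': "Y' \<in> carrier (GL n)" "Y * Y' = 1\<^sub>m n" "Y' * Y = 1\<^sub>m n" using GL_E[OF Y] by metis
    obtain x' where x': "x' \<in> ?W" "x * x' = 1\<^sub>m n" "x' * x = 1\<^sub>m n" using units_onE[OF x] by metis
    obtain y' where y': "y' \<in> ?W" "y * y' = 1\<^sub>m n" "y' * y = 1\<^sub>m n" using units_onE[OF y] by metis
    note car = GL_carrier_mat[OF X] GL_carrier_mat[OF Y] GL_carrier_mat[OF X'(1)] GL_carrier_mat[OF Y'(1)]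
      units_on_carrier[OF x] units_on_carrier[OF y] units_on_carrier[OF x'(1)] units_on_carrier[OF y'(1)]
    have h: "y' * (Y' * (X * x)) \<in> units_on n ?P"
    proof (rule units_onI)
      show "id_off n ?P (y' * (Y' * (X * x)))"
        by (rule prefix_quotient[OF X Y pX pY x y px py Y'(1,3) y'(1,3) m])
      show "id_off n ?P (x' * (X' * (Y * y)))"
        by (rule prefix_quotient[OF Y X pY pX y x py px X'(1,3) x'(1,3) m])
    qed (use car X' Y' x' y' in \<open>simp_all add: square_assoc[where n=n] left_inverse_cancel[where n=n]\<close>)
    have "b * g * c = b2 * g2 * c2 * (y' * (Y' * (X * x)))"
      unfolding eq eq2 using car Y' y'
      by (simp add: square_assoc[where n=n] left_inverse_cancel[where n=n])
    then show "\<exists>u\<in>units_on n ?Q. \<exists>v\<in>units_on n ?P. g = u * g2 * v"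
      by (rule double_coset_relI[OF tQ b b2 tP c c2 h g])
  qed simp
qed

section \<open>A full flag and one line or hyperplane\<close>

text \<open>The row operations are now the full linear groups of the two classes, and only upper triangular column
  operations are allowed. The set \<open>D\<close> consists of the columns with a pivot in the top rows. Column operations inside \<open>D\<close> can
  be undone on the top rows because all row operations are available there; operations on the
  remaining columns do not affect the top rows at all. So the bottom rows may be treated with two chains of
  columns, \<open>D\<close> and its complement.\<close>

lemma flag_normal_form:
  fixes g :: "'a::field mat"
  assumes g: "g \<in> carrier_mat n n" and p: "p \<le> n"
  shows "\<exists>b\<in>units_on n (\<lambda>i j. i < p \<longleftrightarrow> j < p). \<exists>c\<in>units_on n (\<lambda>i j. i \<le> j). \<exists>D \<subseteq> {..<n}.
    partial_perm_on {..<p} {..<n} (b * g * c) \<and> partial_perm_on {p..<n} D (b * g * c) \<and>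
    partial_perm_on {p..<n} ({..<n} - D) (b * g * c) \<and>
    (\<forall>i<p. \<forall>k\<in>{..<n} - D. (b * g * c) $$ (i, k) = 0)"
    (is "\<exists>b\<in>units_on n ?K. \<exists>c\<in>units_on n ?B. _")
proof -
  have tK: "transp ?K" and tB: "transp ?B" by (auto simp: transp_def)
  have T: "{..<p} \<subseteq> {..<n}" and B: "{p..<n} \<subseteq> {..<n}" using p by auto
  obtain b1 c1 where b1: "b1 \<in> units_on n (chain {..<p} (\<lambda>_. 0))" and c1: "c1 \<in> units_on n (chain {..<n} (\<lambda>k. k))"
    and pp1: "partial_perm_on {..<p} {..<n} (b1 * g * c1)"
    using elimination[OF T order_refl g, of "\<lambda>_. 0" "\<lambda>k. k"] by auto
  define M1 where "M1 = b1 * g * c1"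
  note pp1 = pp1[folded M1_def]
  note car1 = units_on_carrier[OF b1] units_on_carrier[OF c1]
  have M1: "M1 \<in> carrier_mat n n" using car1 g by (simp add: M1_def)
  define D where "D = {k. k < n \<and> (\<exists>i<p. M1 $$ (i, k) \<noteq> 0)}"
  have D: "D \<subseteq> {..<n}" "{..<n} - D \<subseteq> {..<n}" "D \<inter> ({..<n} - D) = {}" by (auto simp: D_def)
  \<comment> \<open>The rank decreases since transposition turns it around; the operations are upper triangular.\<close>
  define \<sigma> where "\<sigma> k = n - k" for k
  define S where "S l k \<longleftrightarrow> chain D \<sigma> k l \<or> chain ({..<n} - D) \<sigma> k l" for l k
  obtain b2 c2 where b2: "b2 \<in> units_on n (\<lambda>i j. i \<in> {p..<n} \<and> j \<in> {p..<n})" and c2: "c2 \<in> units_on n S"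
    and pp2: "partial_perm_on {p..<n} D (b2 * M1 * c2)" "partial_perm_on {p..<n} ({..<n} - D) (b2 * M1 * c2)"
    using two_chain_elimination_columns[OF D B M1, of \<sigma>] unfolding S_def by auto
  note car2 = units_on_carrier[OF b2] units_on_carrier[OF c2]
  have S_lt: "l < n \<and> k < n \<and> l \<le> k" if "S l k" for l k
    using that by (auto simp: S_def chain_def D_def \<sigma>_def)
  have "\<exists>b\<in>units_on n (\<lambda>i j. i \<in> {..<p} \<and> j \<in> {..<p}). \<forall>Y \<in> carrier_mat n n.
     (\<forall>i\<in>{..<p}. \<forall>k\<in>{..<n}. Y $$ (i, k) = (M1 * c2) $$ (i, k)) \<longrightarrow>
     (\<forall>i\<in>{..<p}. \<forall>k\<in>{..<n}. (b * Y) $$ (i, k) = M1 $$ (i, k)) \<and>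
     (\<forall>i\<in>{..<n} - {..<p}. \<forall>k<n. (b * Y) $$ (i, k) = Y $$ (i, k))"
  proof (rule transport_repair[OF T order_refl M1 pp1 c2])
    fix l k i assume a: "S l k" "i \<in> {..<p}" "M1 $$ (i, l) \<noteq> 0"
    then have "l \<in> D" using S_lt[OF a(1)] by (auto simp: D_def)
    then have "k \<in> D" using a(1) by (auto simp: S_def chain_def)
    then show "\<exists>i'\<in>{..<p}. M1 $$ (i', k) \<noteq> 0" by (auto simp: D_def)
  qed (use S_lt in auto)
  then obtain b3 where b3: "b3 \<in> units_on n (\<lambda>i j. i \<in> {..<p} \<and> j \<in> {..<p})"
    and fix3: "\<And>Y. Y \<in> carrier_mat n n \<Longrightarrow> \<forall>i\<in>{..<p}. \<forall>k\<in>{..<n}. Y $$ (i, k) = (M1 * c2) $$ (i, k) \<Longrightarrow>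
     (\<forall>i\<in>{..<p}. \<forall>k\<in>{..<n}. (b3 * Y) $$ (i, k) = M1 $$ (i, k)) \<and>
     (\<forall>i\<in>{..<n} - {..<p}. \<forall>k<n. (b3 * Y) $$ (i, k) = Y $$ (i, k))"
    by blast
  note car3 = units_on_carrier[OF b3]
  have M1c2: "M1 * c2 \<in> carrier_mat n n" and Y: "b2 * (M1 * c2) \<in> carrier_mat n n" using M1 car2 by simp_all
  have "\<forall>i\<in>{..<p}. \<forall>k\<in>{..<n}. (b2 * (M1 * c2)) $$ (i, k) = (M1 * c2) $$ (i, k)"
    using T by (intro ballI units_on_mult_row[OF b2 M1c2]) auto
  then have top: "\<forall>i\<in>{..<p}. \<forall>k\<in>{..<n}. (b3 * (b2 * (M1 * c2))) $$ (i, k) = M1 $$ (i, k)"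
    and bot: "\<forall>i\<in>{..<n} - {..<p}. \<forall>k<n. (b3 * (b2 * (M1 * c2))) $$ (i, k) = (b2 * (M1 * c2)) $$ (i, k)"
    using fix3[OF Y] by blast+
  define X where "X = b3 * (b2 * (M1 * c2))"
  have eq: "X = (b3 * (b2 * b1)) * g * (c1 * c2)"
    unfolding X_def M1_def using car1 car2 car3 g by (simp add: square_assoc[where n=n])
  have "partial_perm_on {..<p} {..<n} X"
    by (rule partial_perm_on_cong[OF _ pp1]) (use top in \<open>auto simp: X_def\<close>)
  moreover have "partial_perm_on {p..<n} D X"
    by (rule partial_perm_on_cong[OF _ pp2(1)])
      (use bot D in \<open>auto simp: X_def square_assoc[OF car2(1) M1 car2(2)]\<close>)
  moreover have "partial_perm_on {p..<n} ({..<n} - D) X"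
    by (rule partial_perm_on_cong[OF _ pp2(2)])
      (use bot in \<open>auto simp: X_def square_assoc[OF car2(1) M1 car2(2)]\<close>)
  moreover have "\<forall>i<p. \<forall>k\<in>{..<n} - D. X $$ (i, k) = 0"
    using top by (auto simp: X_def D_def)
  moreover have "b3 * (b2 * b1) \<in> units_on n ?K"
    by (intro units_on_mult[OF tK] units_on_mono[OF b1] units_on_mono[OF b2] units_on_mono[OF b3])
      (auto simp: chain_def)
  moreover have "c1 * c2 \<in> units_on n ?B"
    by (intro units_on_mult[OF tB] units_on_mono[OF c1] units_on_mono[OF c2]) (auto simp: chain_def dest: S_lt)
  ultimately show ?thesis using D(1) unfolding eq by blast
qed

definition scaling_mat :: "nat \<Rightarrow> (nat \<Rightarrow> 'a::field) \<Rightarrow> 'a mat" where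
  "scaling_mat n s = mat n n (\<lambda>(i, j). if i = j then s i else 0)"

lemma scaling_mat_carrier: "scaling_mat n s \<in> carrier_mat n n"
  by (simp add: scaling_mat_def)

lemma scaling_mat_mult:
  assumes "M \<in> carrier_mat n n" "i < n" "j < n"
  shows "(scaling_mat n s * M) $$ (i, j) = s i * M $$ (i, j)"
    and "(M * scaling_mat n s) $$ (i, j) = M $$ (i, j) * s j"
proof -
  have "scaling_mat n s $$ (i, k) * M $$ (k, j) = (if k = i then s i * M $$ (i, j) else 0)" if "k < n" for k
    using that assms by (simp add: scaling_mat_def)
  then show "(scaling_mat n s * M) $$ (i, j) = s i * M $$ (i, j)"
    using assms by (simp add: mult_entry[OF scaling_mat_carrier])
  have "M $$ (i, k) * scaling_mat n s $$ (k, j) = (if k = j then M $$ (i, j) * s j else 0)" if "k < n" for k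
    using that assms by (simp add: scaling_mat_def)
  then show "(M * scaling_mat n s) $$ (i, j) = M $$ (i, j) * s j"
    using assms by (simp add: mult_entry[OF _ scaling_mat_carrier])
qed

lemma scaling_mat_inverse:
  assumes "\<And>i. s i * t i = 1"
  shows "scaling_mat n s * scaling_mat n t = 1\<^sub>m n"
  by (rule eq_matI) (simp_all add: scaling_mat_mult[OF scaling_mat_carrier] carrier_matD[OF scaling_mat_carrier],
    simp_all add: scaling_mat_def assms)

lemma scaling_mat_units:
  assumes "\<And>i. s i \<noteq> 0" "\<And>i. R i i"
  shows "scaling_mat n s \<in> units_on n R"
  using assms
  by (intro units_onI[of _ _ _ "scaling_mat n (\<lambda>i. 1 / s i)"] scaling_mat_inverse)
    (auto simp: id_off_def scaling_mat_def)

text \<open>A column in \<open>D\<close> with two nonzero entries links a row of \<open>A\<close> to a row of \<open>B\<close>, and each row of \<open>B\<close> is linked to at most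
  one row of \<open>A\<close>. So \<open>t\<close> extends to the linked rows of \<open>B\<close>, by \<open>1\<close> to the others, and then all rows
  that are nonzero in a given column are scaled by the same factor \<open>\<tau>\<close>.\<close>

lemma torus_scaling:
  fixes X :: "'a::field mat" and t :: "nat \<Rightarrow> 'a"
  assumes AB: "A \<union> B = {..<n}" "A \<inter> B = {}" and pp: "partial_perm_on A D X" "partial_perm_on B D X"
    and out: "\<And>k i i'. k < n \<Longrightarrow> k \<notin> D \<Longrightarrow> i < n \<Longrightarrow> i' < n \<Longrightarrow> X $$ (i, k) \<noteq> 0 \<Longrightarrow> X $$ (i', k) \<noteq> 0 \<Longrightarrow> i = i'"
    and t: "\<And>i. t i \<noteq> 0"
  shows "\<exists>s \<tau>. (\<forall>i. s i \<noteq> 0) \<and> (\<forall>k. \<tau> k \<noteq> 0) \<and> (\<forall>a\<in>A. s a = t a) \<and>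
    (\<forall>i<n. \<forall>k<n. X $$ (i, k) \<noteq> 0 \<longrightarrow> s i = \<tau> k)"
proof -
  define link where "link a b \<longleftrightarrow> a \<in> A \<and> b \<in> B \<and> (\<exists>k\<in>D. X $$ (a, k) \<noteq> 0 \<and> X $$ (b, k) \<noteq> 0)" for a b
  have link_unique: "a = a'" if ll: "link a b" "link a' b" for a a' b
  proof -
    obtain k where k: "k \<in> D" "X $$ (a, k) \<noteq> 0" "X $$ (b, k) \<noteq> 0" and ab: "a \<in> A" "b \<in> B"
      using ll(1) unfolding link_def by blast
    obtain k' where k': "k' \<in> D" "X $$ (a', k') \<noteq> 0" "X $$ (b, k') \<noteq> 0" and a': "a' \<in> A"
      using ll(2) unfolding link_def by blast
    have "k = k'" by (rule partial_perm_onD(3)[OF pp(2) ab(2) k(1) k'(1) k(3) k'(3)])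
    then show ?thesis using partial_perm_onD(2)[OF pp(1) ab(1) a' k(1,2)] k'(2) by simp
  qed
  define s where "s i = (if i \<in> A then t i else if \<exists>a. link a i then t (SOME a. link a i) else 1)" for i
  have s_link: "s b = s a" if "link a b" for a b
  proof -
    have "link (SOME a. link a b) b" using that by (rule someI)
    then have "(SOME a. link a b) = a" using link_unique that by blast
    moreover have "a \<in> A" "b \<notin> A" using that AB by (auto simp: link_def)
    ultimately show ?thesis using that by (auto simp: s_def)
  qed
  define \<tau> where "\<tau> k = (if \<exists>i<n. X $$ (i, k) \<noteq> 0 then s (SOME i. i < n \<and> X $$ (i, k) \<noteq> 0) else 1)" for k
  have col: "s i = s i'" if ik: "i < n" "i' < n" "k < n" "X $$ (i, k) \<noteq> 0" "X $$ (i', k) \<noteq> 0" for i i' k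
  proof (cases "k \<in> D")
    case True
    consider "i \<in> A \<and> i' \<in> A" | "i \<in> B \<and> i' \<in> B" | "i \<in> A \<and> i' \<in> B" | "i \<in> B \<and> i' \<in> A"
      using ik AB by blast
    then show ?thesis
    proof cases
      case 1
      then show ?thesis using partial_perm_onD(2)[OF pp(1) _ _ True ik(4,5)] by simp
    next
      case 2
      then show ?thesis using partial_perm_onD(2)[OF pp(2) _ _ True ik(4,5)] by simp
    next
      case 3
      then have "link i i'" using True ik unfolding link_def by blast
      then show ?thesis using s_link by simp
    next
      case 4
      then have "link i' i" using True ik unfolding link_def by blast
      then show ?thesis using s_link by simp
    qed
  next
    case False
    then show ?thesis using out[OF ik(3) _ ik(1,2,4,5)] by simp
  qed
  have "s i = \<tau> k" if ik: "i < n" "k < n" "X $$ (i, k) \<noteq> 0" for i k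
  proof -
    have ex: "i < n \<and> X $$ (i, k) \<noteq> 0" using ik by simp
    have "(SOME i. i < n \<and> X $$ (i, k) \<noteq> 0) < n \<and> X $$ (SOME i. i < n \<and> X $$ (i, k) \<noteq> 0, k) \<noteq> 0"
      using someI[of "\<lambda>i. i < n \<and> X $$ (i, k) \<noteq> 0", OF ex] .
    then have "s i = s (SOME i. i < n \<and> X $$ (i, k) \<noteq> 0)" using col[OF ik(1) _ ik(2,3)] by simp
    then show ?thesis using ex by (auto simp: \<tau>_def)
  qed
  moreover have "s i \<noteq> 0" for i using t by (simp add: s_def)
  moreover from this have "\<tau> k \<noteq> 0" for k by (simp add: \<tau>_def)
  moreover have "s a = t a" if "a \<in> A" for a using that by (simp add: s_def)
  ultimately show ?thesis by (intro exI[of _ s] exI[of _ \<tau>]) simp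
qed

text \<open>Since \<open>s X = X \<tau>\<close>, the decomposition \<open>g = k X c\<close> can be replaced by \<open>g = (k s) X (\<tau>\<^sup>-\<^sup>1 c)\<close>. The factor in
  the symmetric subgroup is thus only determined up to a torus that acts on the chosen summand by arbitrary
  diagonal matrices.\<close>

lemma flag_torus_form:
  assumes g: "g \<in> carrier (GL n)" and p: "p \<le> n" and A: "A = {..<p} \<or> A = {p..<n}"
  shows "\<exists>k k' X. k \<in> units_on n (\<lambda>i j. i < p \<longleftrightarrow> j < p) \<and> k' \<in> units_on n (\<lambda>i j. i < p \<longleftrightarrow> j < p) \<and>
    X \<in> carrier (GL n) \<and> (\<forall>i<n. \<forall>j<n. X $$ (i, j) = 0 \<or> X $$ (i, j) = 1) \<and>
    (\<forall>t. (\<forall>i. t i \<noteq> 0) \<longrightarrow> (\<exists>s k1 k1' c1. (\<forall>a\<in>A. s a = t a) \<and>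
      k1 \<in> units_on n (\<lambda>i j. i < p \<longleftrightarrow> j < p) \<and> k1' \<in> units_on n (\<lambda>i j. i < p \<longleftrightarrow> j < p) \<and>
      c1 \<in> units_on n (\<lambda>i j. i \<le> j) \<and> k1 * k1' = 1\<^sub>m n \<and> k1' * k1 = 1\<^sub>m n \<and> g = k1 * X * c1 \<and>
      (\<forall>i<n. \<forall>j<n. k1 $$ (i, j) = k $$ (i, j) * s j \<and> k1' $$ (i, j) = k' $$ (i, j) / s i)))"
    (is "\<exists>k k' X. k \<in> units_on n ?K \<and> _ \<and> _ \<and> _ \<and> (\<forall>t. _ \<longrightarrow> ?scaled k k' X t)")
proof -
  have tK: "transp ?K" and tB: "transp (\<lambda>i j::nat. i \<le> j)" by (auto simp: transp_def)
  have gc: "g \<in> carrier_mat n n" using g by (rule GL_carrier_mat)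
  obtain b c D where b: "b \<in> units_on n ?K" and c: "c \<in> units_on n (\<lambda>i j. i \<le> j)" and D: "D \<subseteq> {..<n}"
    and pp: "partial_perm_on {..<p} {..<n} (b * g * c)" "partial_perm_on {p..<n} D (b * g * c)"
      "partial_perm_on {p..<n} ({..<n} - D) (b * g * c)"
    and z: "\<forall>i<p. \<forall>k\<in>{..<n} - D. (b * g * c) $$ (i, k) = 0"
    using flag_normal_form[OF gc p] by auto
  define X where "X = b * g * c"
  note pp = pp[folded X_def] and z = z[folded X_def]
  obtain b' where b': "b' \<in> units_on n ?K" "b * b' = 1\<^sub>m n" "b' * b = 1\<^sub>m n" using units_onE[OF b] by metis
  obtain c' where c': "c' \<in> units_on n (\<lambda>i j. i \<le> j)" "c * c' = 1\<^sub>m n" "c' * c = 1\<^sub>m n" using units_onE[OF c] by metis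
  note car = units_on_carrier[OF b] units_on_carrier[OF b'(1)] units_on_carrier[OF c] units_on_carrier[OF c'(1)] gc
  have Xc: "X \<in> carrier_mat n n" using car by (simp add: X_def)
  have XG: "X \<in> carrier (GL n)" unfolding X_def by (intro GL_mult g units_on_GL[OF b] units_on_GL[OF c])
  have X01: "X $$ (i, k) = 0 \<or> X $$ (i, k) = 1" if "i < n" "k < n" for i k
    using that partial_perm_onD(1)[OF pp(1), of i k] partial_perm_onD(1)[OF pp(2), of i k]
      partial_perm_onD(1)[OF pp(3), of i k] by (cases "i < p"; cases "k \<in> D") auto
  have ppA: "partial_perm_on {..<p} D X" using pp(1) D unfolding partial_perm_on_def by blast
  have out: "i = i'" if "k < n" "k \<notin> D" "i < n" "i' < n" "X $$ (i, k) \<noteq> 0" "X $$ (i', k) \<noteq> 0" for k i i'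
  proof -
    have "p \<le> i" "p \<le> i'" using z that by (auto simp: not_less[symmetric])
    then show ?thesis using partial_perm_onD(2)[OF pp(3), of i i' k] that by simp
  qed
  have "?scaled b' b X t" if t: "\<forall>i. t i \<noteq> 0" for t
  proof -
    have "\<exists>s \<tau>. (\<forall>i. s i \<noteq> 0) \<and> (\<forall>k. \<tau> k \<noteq> 0) \<and> (\<forall>a\<in>A. s a = t a) \<and>
      (\<forall>i<n. \<forall>k<n. X $$ (i, k) \<noteq> 0 \<longrightarrow> s i = \<tau> k)"
      using A
    proof
      assume A: "A = {..<p}"
      have "A \<union> {p..<n} = {..<n}" "A \<inter> {p..<n} = {}" using p A by auto
      then show ?thesis using torus_scaling[of A "{p..<n}" n D X t] ppA pp(2) out t A by blast
    next
      assume A: "A = {p..<n}"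
      have "A \<union> {..<p} = {..<n}" "A \<inter> {..<p} = {}" using p A by auto
      then show ?thesis using torus_scaling[of A "{..<p}" n D X t] ppA pp(2) out t A by blast
    qed
    then obtain s \<tau> where s: "\<forall>i. s i \<noteq> 0" "\<forall>k. \<tau> k \<noteq> 0" "\<forall>a\<in>A. s a = t a"
      and st: "\<forall>i<n. \<forall>k<n. X $$ (i, k) \<noteq> 0 \<longrightarrow> s i = \<tau> k" by blast
    let ?s = "scaling_mat n s" and ?s' = "scaling_mat n (\<lambda>i. 1 / s i)" and ?\<tau>' = "scaling_mat n (\<lambda>i. 1 / \<tau> i)"
    note carS = scaling_mat_carrier[of n s] scaling_mat_carrier[of n "\<lambda>i. 1 / s i"] scaling_mat_carrier[of n "\<lambda>i. 1 / \<tau> i"]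
    have ss: "?s * ?s' = 1\<^sub>m n" "?s' * ?s = 1\<^sub>m n" using s by (auto intro!: scaling_mat_inverse)
    have comm: "?s' * X = X * ?\<tau>'"
    proof (rule eq_matI)
      fix i j assume "i < dim_row (X * ?\<tau>')" "j < dim_col (X * ?\<tau>')"
      then have ij: "i < n" "j < n" using Xc carS by auto
      then show "(?s' * X) $$ (i, j) = (X * ?\<tau>') $$ (i, j)"
        using st by (cases "X $$ (i, j) = 0") (simp_all add: scaling_mat_mult[OF Xc])
    qed (use Xc carS in auto)
    have u: "?s \<in> units_on n ?K" "?s' \<in> units_on n ?K" "?\<tau>' \<in> units_on n (\<lambda>i j. i \<le> j)"
      using s by (auto intro!: scaling_mat_units)
    have "(b' * ?s) * X * (?\<tau>' * c') = b' * ?s * (X * ?\<tau>') * c'"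
      using car carS Xc by (simp add: square_assoc[where n=n])
    also have "\<dots> = b' * X * c'"
      unfolding comm[symmetric] using car carS Xc ss by (simp add: square_assoc[where n=n] left_inverse_cancel[where n=n])
    also have "\<dots> = g"
      unfolding X_def using car b' c' by (simp add: square_assoc[where n=n] left_inverse_cancel[where n=n])
    finally have eq: "g = (b' * ?s) * X * (?\<tau>' * c')" ..
    have inv: "(b' * ?s) * (?s' * b) = 1\<^sub>m n" "(?s' * b) * (b' * ?s) = 1\<^sub>m n"
      using car carS ss b' by (simp_all add: square_assoc[where n=n] left_inverse_cancel[where n=n])
    show ?thesis
      using s(3) u b b' c' eq inv car
      by (intro exI[of _ s] exI[of _ "b' * ?s"] exI[of _ "?s' * b"] exI[of _ "?\<tau>' * c'"])
        (auto intro!: units_on_mult[OF tK] units_on_mult[OF tB] simp: scaling_mat_mult)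
  qed
  then have sc: "\<forall>t. (\<forall>i. t i \<noteq> 0) \<longrightarrow> ?scaled b' b X t" by blast
  have X01': "\<forall>i<n. \<forall>j<n. X $$ (i, j) = 0 \<or> X $$ (i, j) = 1" using X01 by blast
  show ?thesis
    by (intro exI[of _ b'] exI[of _ b] exI[of _ X] conjI) (rule b'(1) b XG X01' sc)+
qed

lemma flag_coset_quotient:
  assumes "k \<in> units_on n R" "k' \<in> units_on n R" "k2 \<in> units_on n R" "k2' \<in> units_on n R"
    "c \<in> units_on n S" "c2 \<in> units_on n S" and X: "X \<in> carrier_mat n n" and "k2' * k2 = 1\<^sub>m n"
    and g: "g = k * X * c" "g2 = k2 * X * c2" and t: "transp S"
  shows "\<exists>v\<in>units_on n S. g = (k * k2') * g2 * v"
proof -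
  obtain c2' where c2': "c2' \<in> units_on n S" "c2 * c2' = 1\<^sub>m n" using units_onE[OF assms(6)] by metis
  note car = assms(1-6)[THEN units_on_carrier] units_on_carrier[OF c2'(1)] X
  have "g = (k * k2') * g2 * (c2' * c)"
    unfolding g using car c2' assms(8) by (simp add: square_assoc[where n=n] left_inverse_cancel[where n=n])
  then show ?thesis using units_on_mult[OF t c2'(1) assms(5)] by blast
qed

text \<open>The line is spanned by the first unit vector, so \<open>g = k X c\<close> is determined up to its double coset by \<open>X\<close> and
  the first column of the inverse of \<open>k\<close>. That column lies in the first summand, and the torus rescales its
  nonzero coordinates to \<open>1\<close>.\<close>

lemma finite_double_cosets_line:
  assumes p: "0 < p" "p \<le> n"
  shows "finite_double_cosets n {k \<in> units_on n (\<lambda>i j. i < p \<longleftrightarrow> j < p). \<forall>i<n. 0 < i \<longrightarrow> k $$ (i, 0) = 0}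
    (units_on n (\<lambda>i j. i \<le> j))" (is "finite_double_cosets n ?Q (units_on n ?B)")
proof -
  let ?K = "\<lambda>i j. i < p \<longleftrightarrow> j < p"
  have tK: "transp ?K" and tB: "transp ?B" by (auto simp: transp_def)
  define \<Phi> where "\<Phi> g SE \<longleftrightarrow> (\<exists>k\<in>units_on n ?K. \<exists>k'\<in>units_on n ?K. \<exists>c\<in>units_on n ?B. \<exists>X\<in>carrier (GL n).
     k * k' = 1\<^sub>m n \<and> k' * k = 1\<^sub>m n \<and> g = k * X * c \<and> pattern n n X (fst SE) \<and>
     (\<forall>i<n. k' $$ (i, 0) = of_bool (i \<in> snd SE)))" for g SE
  show ?thesis
  proof (rule finite_double_cosetsI[where \<Phi> = \<Phi> and Y = "Pow ({..<n} \<times> {..<n}) \<times> Pow {..<n}"])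
    fix g assume g: "g \<in> carrier (GL n)"
    obtain k k' X where k: "k \<in> units_on n ?K" "k' \<in> units_on n ?K" "X \<in> carrier (GL n)"
      and X01: "\<forall>i<n. \<forall>j<n. X $$ (i, j) = 0 \<or> X $$ (i, j) = 1"
      and scaled: "\<forall>t. (\<forall>i. t i \<noteq> 0) \<longrightarrow> (\<exists>s k1 k1' c1. (\<forall>a\<in>{..<p}. s a = t a) \<and>
        k1 \<in> units_on n ?K \<and> k1' \<in> units_on n ?K \<and> c1 \<in> units_on n ?B \<and> k1 * k1' = 1\<^sub>m n \<and>
        k1' * k1 = 1\<^sub>m n \<and> g = k1 * X * c1 \<and>
        (\<forall>i<n. \<forall>j<n. k1 $$ (i, j) = k $$ (i, j) * s j \<and> k1' $$ (i, j) = k' $$ (i, j) / s i))"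
      using flag_torus_form[OF g p(2), of "{..<p}"] by auto
    \<comment> \<open>Dividing by \<open>t\<close> turns the first column of \<open>k'\<close> into zeros and ones.\<close>
    define t where "t i = (if k' $$ (i, 0) = 0 then 1 else k' $$ (i, 0))" for i
    have "\<forall>i. t i \<noteq> 0" by (simp add: t_def)
    then obtain s k1 k1' c1 where s: "\<forall>a\<in>{..<p}. s a = t a" and k1: "k1 \<in> units_on n ?K" "k1' \<in> units_on n ?K"
      "c1 \<in> units_on n ?B" "k1 * k1' = 1\<^sub>m n" "k1' * k1 = 1\<^sub>m n" "g = k1 * X * c1"
      and e: "\<forall>i<n. \<forall>j<n. k1 $$ (i, j) = k $$ (i, j) * s j \<and> k1' $$ (i, j) = k' $$ (i, j) / s i"
      using mp[OF spec[OF scaled]] by blast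
    define E where "E = {i. i < p \<and> k' $$ (i, 0) \<noteq> 0}"
    have E: "k1' $$ (i, 0) = of_bool (i \<in> E)" if i: "i < n" for i
    proof (cases "i < p")
      case True
      then show ?thesis using e i p s by (simp add: E_def t_def)
    next
      case False
      then show ?thesis using units_on_off[OF k1(2) i, of 0] p by (simp add: E_def)
    qed
    obtain S where S: "S \<in> Pow ({..<n} \<times> {..<n})" "pattern n n X S"
      using pattern_exists[of n n X] X01 by auto
    have "\<Phi> g (S, E)"
      unfolding \<Phi>_def
      by (rule bexI[OF _ k1(1)], rule bexI[OF _ k1(2)], rule bexI[OF _ k1(3)], rule bexI[OF _ k(3)])
        (use k1(4-6) S(2) E in simp)
    moreover have "E \<in> Pow {..<n}" using p by (auto simp: E_def)
    ultimately show "\<exists>y\<in>Pow ({..<n} \<times> {..<n}) \<times> Pow {..<n}. \<Phi> g y" using S by blast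
  next
    fix g g2 SE assume phi: "\<Phi> g SE" "\<Phi> g2 SE"
    obtain k k' c X where k: "k \<in> units_on n ?K" "k' \<in> units_on n ?K" "c \<in> units_on n ?B" "X \<in> carrier (GL n)"
      "k * k' = 1\<^sub>m n" "g = k * X * c" "pattern n n X (fst SE)" "\<forall>i<n. k' $$ (i, 0) = of_bool (i \<in> snd SE)"
      using phi(1) unfolding \<Phi>_def by auto
    obtain k2 k2' c2 X2 where k2: "k2 \<in> units_on n ?K" "k2' \<in> units_on n ?K" "c2 \<in> units_on n ?B" "X2 \<in> carrier (GL n)"
      "k2' * k2 = 1\<^sub>m n" "g2 = k2 * X2 * c2" "pattern n n X2 (fst SE)" "\<forall>i<n. k2' $$ (i, 0) = of_bool (i \<in> snd SE)"
      using phi(2) unfolding \<Phi>_def by auto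
    have X2: "X2 = X" by (rule pattern_unique[OF k2(7) k(7) GL_carrier_mat[OF k2(4)] GL_carrier_mat[OF k(4)]])
    obtain v where v: "v \<in> units_on n ?B" "g = (k * k2') * g2 * v"
      using flag_coset_quotient[OF k(1,2) k2(1,2) k(3) k2(3) GL_carrier_mat[OF k(4)] k2(5) k(6) k2(6)[unfolded X2] tB]
      by blast
    have "(k * k2') $$ (i, 0) = (k * k') $$ (i, 0)" if "i < n" for i
      using that p k(8) k2(8) units_on_carrier[OF k(1)] units_on_carrier[OF k(2)] units_on_carrier[OF k2(2)]
      by (intro mult_pattern_column[where n=n]) auto
    then have "k * k2' \<in> ?Q" using k(5) p units_on_mult[OF tK k(1) k2(2)] by auto
    then show "\<exists>u\<in>?Q. \<exists>v\<in>units_on n ?B. g = u * g2 * v" using v by blast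
  qed simp
qed

text \<open>Dual to the previous lemma: a hyperplane is the kernel of the last coordinate, so the last row of \<open>k\<close> takes the place of
  the first column of its inverse. It is supported on the second summand.\<close>

lemma finite_double_cosets_hyperplane:
  assumes p: "p < n"
  shows "finite_double_cosets n {k \<in> units_on n (\<lambda>i j. i < p \<longleftrightarrow> j < p). \<forall>j<n - 1. k $$ (n - 1, j) = 0}
    (units_on n (\<lambda>i j. i \<le> j))" (is "finite_double_cosets n ?Q (units_on n ?B)")
proof -
  let ?K = "\<lambda>i j. i < p \<longleftrightarrow> j < p"
  have tK: "transp ?K" and tB: "transp ?B" by (auto simp: transp_def)
  have n1: "n - 1 < n" "\<not> n - 1 < p" using p by auto
  define \<Phi> where "\<Phi> g SE \<longleftrightarrow> (\<exists>k\<in>units_on n ?K. \<exists>k'\<in>units_on n ?K. \<exists>c\<in>units_on n ?B. \<exists>X\<in>carrier (GL n).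
     k * k' = 1\<^sub>m n \<and> k' * k = 1\<^sub>m n \<and> g = k * X * c \<and> pattern n n X (fst SE) \<and>
     (\<forall>j<n. k $$ (n - 1, j) = of_bool (j \<in> snd SE)))" for g SE
  show ?thesis
  proof (rule finite_double_cosetsI[where \<Phi> = \<Phi> and Y = "Pow ({..<n} \<times> {..<n}) \<times> Pow {..<n}"])
    fix g assume g: "g \<in> carrier (GL n)"
    obtain k k' X where k: "k \<in> units_on n ?K" "k' \<in> units_on n ?K" "X \<in> carrier (GL n)"
      and X01: "\<forall>i<n. \<forall>j<n. X $$ (i, j) = 0 \<or> X $$ (i, j) = 1"
      and scaled: "\<forall>t. (\<forall>i. t i \<noteq> 0) \<longrightarrow> (\<exists>s k1 k1' c1. (\<forall>a\<in>{p..<n}. s a = t a) \<and>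
        k1 \<in> units_on n ?K \<and> k1' \<in> units_on n ?K \<and> c1 \<in> units_on n ?B \<and> k1 * k1' = 1\<^sub>m n \<and>
        k1' * k1 = 1\<^sub>m n \<and> g = k1 * X * c1 \<and>
        (\<forall>i<n. \<forall>j<n. k1 $$ (i, j) = k $$ (i, j) * s j \<and> k1' $$ (i, j) = k' $$ (i, j) / s i))"
      using flag_torus_form[OF g less_imp_le[OF p], of "{p..<n}"] by auto
    \<comment> \<open>Multiplying by \<open>t\<close> turns the last row of \<open>k\<close> into zeros and ones.\<close>
    define t where "t j = (if k $$ (n - 1, j) = 0 then 1 else 1 / k $$ (n - 1, j))" for j
    have "\<forall>i. t i \<noteq> 0" by (simp add: t_def)
    then obtain s k1 k1' c1 where s: "\<forall>a\<in>{p..<n}. s a = t a" and k1: "k1 \<in> units_on n ?K" "k1' \<in> units_on n ?K"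
      "c1 \<in> units_on n ?B" "k1 * k1' = 1\<^sub>m n" "k1' * k1 = 1\<^sub>m n" "g = k1 * X * c1"
      and e: "\<forall>i<n. \<forall>j<n. k1 $$ (i, j) = k $$ (i, j) * s j \<and> k1' $$ (i, j) = k' $$ (i, j) / s i"
      using mp[OF spec[OF scaled]] by blast
    define E where "E = {j. p \<le> j \<and> j < n \<and> k $$ (n - 1, j) \<noteq> 0}"
    have E: "k1 $$ (n - 1, j) = of_bool (j \<in> E)" if j: "j < n" for j
    proof (cases "j < p")
      case True
      then show ?thesis using units_on_off[OF k1(1) n1(1) j] n1 by (auto simp: E_def)
    next
      case False
      then show ?thesis using e j n1 s by (simp add: E_def t_def)
    qed
    obtain S where S: "S \<in> Pow ({..<n} \<times> {..<n})" "pattern n n X S"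
      using pattern_exists[of n n X] X01 by auto
    have "\<Phi> g (S, E)"
      unfolding \<Phi>_def
      by (rule bexI[OF _ k1(1)], rule bexI[OF _ k1(2)], rule bexI[OF _ k1(3)], rule bexI[OF _ k(3)])
        (use k1(4-6) S(2) E in simp)
    moreover have "E \<in> Pow {..<n}" by (auto simp: E_def)
    ultimately show "\<exists>y\<in>Pow ({..<n} \<times> {..<n}) \<times> Pow {..<n}. \<Phi> g y" using S by blast
  next
    fix g g2 SE assume phi: "\<Phi> g SE" "\<Phi> g2 SE"
    obtain k k' c X where k: "k \<in> units_on n ?K" "k' \<in> units_on n ?K" "c \<in> units_on n ?B" "X \<in> carrier (GL n)"
      "k * k' = 1\<^sub>m n" "g = k * X * c" "pattern n n X (fst SE)" "\<forall>j<n. k $$ (n - 1, j) = of_bool (j \<in> snd SE)"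
      using phi(1) unfolding \<Phi>_def by auto
    obtain k2 k2' c2 X2 where k2: "k2 \<in> units_on n ?K" "k2' \<in> units_on n ?K" "c2 \<in> units_on n ?B" "X2 \<in> carrier (GL n)"
      "k2' * k2 = 1\<^sub>m n" "g2 = k2 * X2 * c2" "pattern n n X2 (fst SE)" "\<forall>j<n. k2 $$ (n - 1, j) = of_bool (j \<in> snd SE)"
      "k2 * k2' = 1\<^sub>m n"
      using phi(2) unfolding \<Phi>_def by auto
    have X2: "X2 = X" by (rule pattern_unique[OF k2(7) k(7) GL_carrier_mat[OF k2(4)] GL_carrier_mat[OF k(4)]])
    obtain v where v: "v \<in> units_on n ?B" "g = (k * k2') * g2 * v"
      using flag_coset_quotient[OF k(1,2) k2(1,2) k(3) k2(3) GL_carrier_mat[OF k(4)] k2(5) k(6) k2(6)[unfolded X2] tB]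
      by blast
    have "(k * k2') $$ (n - 1, j) = (k2 * k2') $$ (n - 1, j)" if "j < n" for j
      using that n1 k(8) k2(8) units_on_carrier[OF k(1)] units_on_carrier[OF k2(1)] units_on_carrier[OF k2(2)]
      by (simp add: mult_entry)
    then have "k * k2' \<in> ?Q" using k2(9) n1 units_on_mult[OF tK k(1) k2(2)] by auto
    then show "\<exists>u\<in>?Q. \<exists>v\<in>units_on n ?B. g = u * g2 * v" using v by blast
  qed simp
qed

section \<open>Subgroups containing the upper triangular matrices\<close>

lemma column_mat_upper_triangular:
  assumes "r < n" "u r \<noteq> 0" "\<And>i. r < i \<Longrightarrow> i < n \<Longrightarrow> u i = 0"
  shows "column_mat n r u \<in> carrier (GL n)" "upper_triangular (column_mat n r u)"
proof -
  show "column_mat n r u \<in> carrier (GL n)"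
    using assms by (intro units_on_GL[of _ n "\<lambda>_ _. True"] column_mat_units) auto
  show "upper_triangular (column_mat n r u)"
    using assms by (intro upper_triangularI) auto
qed

lemma upper_triangular_units_on:
  assumes "c \<in> units_on n (\<lambda>i j. i \<le> j)"
  shows "upper_triangular c"
  using units_on_off[OF assms] units_on_carrier[OF assms] by (auto simp: upper_triangular_def)

text \<open>If \<open>r\<close> is the last nonzero position of the first column of \<open>y\<close>, upper triangular row operations with pivot \<open>r\<close> turn
  this column into any other vector whose last nonzero position is \<open>r\<close>.\<close>

lemma move_first_column:
  assumes mult: "\<And>x y. x \<in> X \<Longrightarrow> y \<in> X \<Longrightarrow> x * y \<in> X" and XG: "X \<subseteq> carrier (GL n)"
    and upper: "\<And>b. b \<in> carrier (GL n) \<Longrightarrow> upper_triangular b \<Longrightarrow> b \<in> X"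
    and y: "y \<in> X" "r < n" "y $$ (r, 0) \<noteq> 0" "\<And>i. r < i \<Longrightarrow> i < n \<Longrightarrow> y $$ (i, 0) = 0"
    and v: "v r \<noteq> 0" "\<And>i. r < i \<Longrightarrow> i < n \<Longrightarrow> v i = 0"
  shows "\<exists>z\<in>X. \<forall>i<n. z $$ (i, 0) = v i"
proof -
  define u where "u i = (if i = r then v r / y $$ (r, 0) else if i < r then (v i - y $$ (i, 0)) / y $$ (r, 0) else 0)" for i
  have yc: "y \<in> carrier_mat n n" using y XG GL_carrier_mat by blast
  have "column_mat n r u \<in> X"
    using column_mat_upper_triangular[of r n u] y v by (intro upper) (auto simp: u_def)
  then have "column_mat n r u * y \<in> X" using y mult by blast
  moreover have "(column_mat n r u * y) $$ (i, 0) = v i" if "i < n" for i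
    using column_mat_mult[OF yc y(2) that, of 0 u] y(2-4) v that by (auto simp: u_def)
  ultimately show ?thesis by blast
qed

text \<open>Gaussian elimination, with the statement for a matrix whose first \<open>k\<close> columns are already those of
  the identity, by descending induction on \<open>k\<close>. If the diagonal entry of column \<open>k\<close> vanishes, some entry below it does
  not, since otherwise column \<open>k\<close> would be a combination of the preceding ones, and its row is added
  to row \<open>k\<close> first.\<close>

lemma GL_generated_by_column_mats:
  assumes mult: "\<And>x y. x \<in> N \<Longrightarrow> y \<in> N \<Longrightarrow> x * y \<in> N" and one: "1\<^sub>m n \<in> N"
    and col: "\<And>r u. r < n \<Longrightarrow> u r \<noteq> 0 \<Longrightarrow> column_mat n r u \<in> N"
  shows "carrier (GL n) \<subseteq> N"
proof -
  have main: "g \<in> N" if "k \<le> n" "g \<in> carrier (GL n)"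
    "\<And>i j. i < n \<Longrightarrow> j < k \<Longrightarrow> g $$ (i, j) = (if i = j then 1 else 0)" for k g
    using that
  proof (induction k arbitrary: g rule: inc_induct)
    case base
    then have "g = 1\<^sub>m n" by (intro eq_matI) (auto dest: GL_carrier_mat)
    then show ?case using one by simp
  next
    case (step k)
    have gc: "g \<in> carrier_mat n n" using step.prems(1) by (rule GL_carrier_mat)
    have k: "k < n" using step.hyps by simp
    have pivot: "h \<in> N" if h: "h \<in> carrier (GL n)" "h $$ (k, k) \<noteq> 0"
      and hid: "\<And>i j. i < n \<Longrightarrow> j < k \<Longrightarrow> h $$ (i, j) = (if i = j then 1 else 0)" for h
    proof -
      have hc: "h \<in> carrier_mat n n" using h by (auto dest: GL_carrier_mat)
      define u where "u i = h $$ (i, k)" for i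
      define u' where "u' i = (if i = k then 1 / u k else - u i / u k)" for i
      have uk: "u k \<noteq> 0" "u' k \<noteq> 0" using h by (auto simp: u_def u'_def)
      have inv: "column_mat n k u * column_mat n k u' = 1\<^sub>m n"
        unfolding u'_def by (rule column_mat_inverse) (use k uk in auto)
      define h' where "h' = column_mat n k u' * h"
      have e: "h' $$ (i, j) = u' i * h $$ (k, j) + (if i = k then 0 else h $$ (i, j))" if "i < n" "j < n" for i j
        using that k hc by (simp add: h'_def column_mat_mult)
      have "h' \<in> N"
      proof (rule step.IH)
        show "h' \<in> carrier (GL n)"
          unfolding h'_def using k uk
          by (intro GL_mult h(1) units_on_GL[of _ n "\<lambda>_ _. True"] column_mat_units) auto
        fix i j assume ij: "i < n" "j < Suc k"
        show "h' $$ (i, j) = (if i = j then 1 else 0)"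
        proof (cases "j = k")
          case True
          then show ?thesis using e[of i j] ij k h(2) by (simp add: u'_def u_def)
        next
          case False
          then show ?thesis using e[of i j] ij k hid[of i j] hid[of k j] by auto
        qed
      qed
      moreover have "h = column_mat n k u * h'"
        unfolding h'_def by (rule left_inverse_cancel[symmetric, OF _ _ hc inv]) auto
      ultimately show ?thesis using mult col[of k u] k uk by metis
    qed
    show ?case
    proof (cases "g $$ (k, k) = 0")
      case False
      then show ?thesis using pivot step.prems by blast
    next
      case True
      obtain g' where g': "g' \<in> carrier (GL n)" "g' * g = 1\<^sub>m n" using GL_E[OF step.prems(1)] by metis
      have "\<exists>i. k < i \<and> i < n \<and> g $$ (i, k) \<noteq> 0"
      proof (rule ccontr)
        assume "\<not> ?thesis"
        then have z: "g $$ (i, k) = 0" if "k \<le> i" "i < n" for i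
          using that True by (cases "i = k") auto
        have "(g' * g) $$ (k, k) = (\<Sum>l<n. g' $$ (k, l) * g $$ (l, k))"
          using g' gc k by (intro mult_entry) (auto dest: GL_carrier_mat)
        also have "\<dots> = (\<Sum>l<n. 0)"
        proof (rule sum.cong)
          fix l assume l: "l \<in> {..<n}"
          show "g' $$ (k, l) * g $$ (l, k) = 0"
          proof (cases "l < k")
            case True
            have "g' $$ (k, i) * g $$ (i, l) = (if i = l then g' $$ (k, l) else 0)" if "i < n" for i
              using step.prems(2)[OF that True] by simp
            then have "g' $$ (k, l) = (\<Sum>i<n. g' $$ (k, i) * g $$ (i, l))" using l by simp
            also have "\<dots> = (g' * g) $$ (k, l)"
              using g' gc k l by (intro mult_entry[symmetric]) (auto dest: GL_carrier_mat)
            also have "\<dots> = 0" using g' True k l by simp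
            finally show ?thesis by simp
          qed (use z l in auto)
        qed simp
        finally show False using g' k by simp
      qed
      then obtain i0 where i0: "k < i0" "i0 < n" "g $$ (i0, k) \<noteq> 0" by blast
      define u :: "nat \<Rightarrow> complex" where "u i = (if i = i0 then 1 else if i = k then 1 else 0)" for i
      define w :: "nat \<Rightarrow> complex" where "w i = (if i = i0 then 1 else if i = k then - 1 else 0)" for i
      have "u = (\<lambda>i. if i = i0 then 1 / w i0 else - w i / w i0)" using i0 by (auto simp: u_def w_def)
      then have inv: "column_mat n i0 w * column_mat n i0 u = 1\<^sub>m n"
        using column_mat_inverse[of i0 n w] i0 by (simp only:) (simp add: w_def)
      define h where "h = column_mat n i0 u * g"
      have e: "h $$ (i, j) = u i * g $$ (i0, j) + (if i = i0 then 0 else g $$ (i, j))" if "i < n" "j < n" for i j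
        using that i0 gc by (simp add: h_def column_mat_mult)
      have "h \<in> N"
      proof (rule pivot)
        show "h \<in> carrier (GL n)"
          unfolding h_def using i0
          by (intro GL_mult step.prems(1) units_on_GL[of _ n "\<lambda>_ _. True"] column_mat_units) (auto simp: u_def)
        show "h $$ (k, k) \<noteq> 0" using e[OF k k] i0 True by (simp add: u_def)
        fix i j assume ij: "i < n" "j < k"
        then have "g $$ (i0, j) = 0" "i0 \<noteq> j" "j < n" using step.prems(2)[of i0 j] i0 k by auto
        then show "h $$ (i, j) = (if i = j then 1 else 0)"
          using e[of i j] step.prems(2)[OF ij] ij by (cases "i = j") simp_all
      qed
      moreover have "g = column_mat n i0 w * h"
        unfolding h_def by (rule left_inverse_cancel[symmetric, OF _ _ gc inv]) auto
      moreover have "column_mat n i0 w \<in> N" using i0 by (intro col) (auto simp: w_def)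
      ultimately show ?thesis using mult by metis
    qed
  qed
  show ?thesis using main[of 0] by auto
qed

text \<open>Let \<open>r\<close> be the lowest position that is nonzero in the first column of some element of \<open>X\<close>. The first columns of
  elements of \<open>X\<close> then include all vectors with last nonzero position \<open>r\<close>, and these span the
  coordinate subspace of dimension \<open>r + 1\<close>, which is therefore stable under \<open>X\<close>.

  If that is the whole space, take \<open>z\<close> in \<open>X\<close> with a prescribed first column \<open>v\<close> whose last entry is nonzero. Conjugating by \<open>z\<close> an
  upper unipotent matrix that differs from the identity in the first row only gives the transvection with
  column \<open>v\<close>, which lies in \<open>N\<close> by normality. Hence \<open>N\<close> contains generators of the general linear group.

  Two groups \<open>N\<close> and \<open>X\<close> appear because of products: for a subgroup of \<open>GL\<^sub>p \<times> GL\<^sub>q\<close>, \<open>X\<close> is the projection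
  to one factor and \<open>N\<close> the intersection with it.\<close>

lemma full_or_stabilises:
  assumes n: "0 < n" and XG: "X \<subseteq> carrier (GL n)" and NX: "N \<subseteq> X"
    and multX: "\<And>x y. x \<in> X \<Longrightarrow> y \<in> X \<Longrightarrow> x * y \<in> X" and multN: "\<And>x y. x \<in> N \<Longrightarrow> y \<in> N \<Longrightarrow> x * y \<in> N"
    and normal: "\<And>x x' y. x \<in> X \<Longrightarrow> x' \<in> carrier (GL n) \<Longrightarrow> x * x' = 1\<^sub>m n \<Longrightarrow> x' * x = 1\<^sub>m n \<Longrightarrow>
      y \<in> N \<Longrightarrow> x * y * x' \<in> N"
    and upper: "\<And>b. b \<in> carrier (GL n) \<Longrightarrow> upper_triangular b \<Longrightarrow> b \<in> N"
  shows "carrier (GL n) \<subseteq> N \<or> (\<exists>m. 0 < m \<and> m < n \<and> (\<forall>x\<in>X. \<forall>i<n. \<forall>j<m. m \<le> i \<longrightarrow> x $$ (i, j) = 0))"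
proof -
  have upperX: "b \<in> X" if "b \<in> carrier (GL n)" "upper_triangular b" for b using upper[OF that] NX by blast
  have one: "1\<^sub>m n \<in> N" by (rule upper) (auto simp: carrier_GL)
  define A where "A = {i. i < n \<and> (\<exists>x\<in>X. x $$ (i, 0) \<noteq> 0)}"
  have A: "finite A" "A \<noteq> {}" using one NX n by (auto simp: A_def intro!: exI[of _ 0] bexI[of _ "1\<^sub>m n"])
  define r where "r = Max A"
  have "r \<in> A" using Max_in[OF A] by (simp add: r_def)
  then obtain y where y: "r < n" "y \<in> X" "y $$ (r, 0) \<noteq> 0" by (auto simp: A_def)
  have below: "x $$ (i, 0) = 0" if "x \<in> X" "r < i" "i < n" for x i
  proof (rule ccontr)
    assume "x $$ (i, 0) \<noteq> 0"
    then have "i \<in> A" using that by (auto simp: A_def)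
    then show False using Max_ge[OF A(1), of i] that by (auto simp: r_def)
  qed
  show ?thesis
  proof (cases "Suc r = n")
    case False
    have "x $$ (i, j) = 0" if x: "x \<in> X" and i: "i < n" "Suc r \<le> i" and j: "j < Suc r" for x i j
    proof -
      have xc: "x \<in> carrier_mat n n" using x XG GL_carrier_mat by blast
      have sum0: "(\<Sum>l<n. x $$ (i, l) * v l) = 0" if v: "v r \<noteq> 0" "\<And>i. r < i \<Longrightarrow> i < n \<Longrightarrow> v i = 0" for v
      proof -
        obtain z where z: "z \<in> X" "\<forall>i<n. z $$ (i, 0) = v i"
          using move_first_column[where v=v, OF multX XG upperX y(2,1,3) below[OF y(2)] v] by blast
        have "(x * z) $$ (i, 0) = (\<Sum>l<n. x $$ (i, l) * z $$ (l, 0))"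
          using xc z XG GL_carrier_mat i n by (intro mult_entry) auto
        then show ?thesis using below[OF multX[OF x z(1)], of i] i z by simp
      qed
      have "x $$ (i, l) * (if l = r then 1 else 0) = (if l = r then x $$ (i, r) else 0)" for l
        by simp
      then have xr: "x $$ (i, r) = 0"
        using sum0[of "\<lambda>l. if l = r then 1 else 0"] y(1) by simp
      show ?thesis
      proof (cases "j = r")
        case False
        have "x $$ (i, l) * (if l = r \<or> l = j then 1 else 0) =
            (if l = r then x $$ (i, r) else 0) + (if l = j then x $$ (i, j) else 0)" for l
          using False by auto
        then have "x $$ (i, r) + x $$ (i, j) = 0"
          using sum0[of "\<lambda>l. if l = r \<or> l = j then 1 else 0"] y(1) j by (simp add: sum.distrib)
        then show ?thesis using xr by simp
      qed (use xr in simp)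
    qed
    then show ?thesis using False y(1) by (intro disjI2 exI[of _ "Suc r"]) auto
  next
    case last: True
    have star: "column_mat n s u \<in> N" if s: "s < r" and u: "u s = 1" "u r \<noteq> 0" for s u
    proof -
      define v where "v i = (if i = s then 0 else u i)" for i
      have vr: "v r \<noteq> 0" using s u by (simp add: v_def)
      obtain z where z: "z \<in> X" "\<And>i. i < n \<Longrightarrow> z $$ (i, 0) = v i"
        using move_first_column[where v=v, OF multX XG upperX y(2,1,3) below[OF y(2)] vr] last by auto
      have zc: "z \<in> carrier_mat n n" using z XG GL_carrier_mat by blast
      obtain z' where z': "z' \<in> carrier (GL n)" "z * z' = 1\<^sub>m n" "z' * z = 1\<^sub>m n" using GL_E z XG by blast
      \<comment> \<open>\<open>W\<close> is the identity plus row \<open>s\<close> of \<open>z\<close> placed in the first row; since \<open>z\<close> has first column \<open>v\<close> and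
        \<open>v s = 0\<close>, it is unipotent.\<close>
      define w where "w j = (if j = 0 then 1 else z $$ (s, j))" for j
      define W where "W = transpose_mat (column_mat n 0 w)"
      have sn: "s < n" using s y by simp
      have "column_mat n 0 w \<in> units_on n (\<lambda>_ _. True)" using n by (intro column_mat_units) (auto simp: w_def)
      then have "W \<in> carrier (GL n)" unfolding W_def by (intro units_on_GL[OF units_on_transpose])
      then have W: "W \<in> N" by (rule upper) (auto simp: W_def upper_triangular_def)
      have Wc: "W \<in> carrier_mat n n" by (simp add: W_def)
      have "z * W = column_mat n s u * z"
      proof (rule eq_matI)
        fix i j assume "i < dim_row (column_mat n s u * z)" "j < dim_col (column_mat n s u * z)"
        then have ij: "i < n" "j < n" using zc by auto
        show "(z * W) $$ (i, j) = (column_mat n s u * z) $$ (i, j)"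
          using mult_column_mat_transpose[OF zc n ij, of w] column_mat_mult[OF zc sn ij, of u] z(2) ij sn u
          by (auto simp: W_def w_def v_def)
      qed (use zc Wc in auto)
      then have "z * W * z' = column_mat n s u * z * z'" by (simp only:)
      also have "\<dots> = column_mat n s u * (z * z')"
        by (rule square_assoc[OF column_mat_carrier zc GL_carrier_mat[OF z'(1)]])
      also have "\<dots> = column_mat n s u" using z'(2) by (simp add: right_mult_one_mat[OF column_mat_carrier])
      finally have "z * W * z' = column_mat n s u" .
      then show ?thesis using normal[OF z(1) z' W] by simp
    qed
    \<comment> \<open>If the last entry of \<open>u\<close> vanishes, the transvection is a product of two whose last entries do not.\<close>
    have unit_col: "column_mat n s u \<in> N" if s: "s < r" and u: "u s = 1" for s u
    proof (cases "u r = 0")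
      case True
      let ?a = "\<lambda>i. if i = r then 1 else u i" and ?b = "\<lambda>i. if i = r then - 1 else if i = s then 1 else (0::complex)"
      have "column_mat n s u = column_mat n s ?a * column_mat n s ?b"
      proof (rule eq_matI)
        fix i j assume "i < dim_row (column_mat n s ?a * column_mat n s ?b)" "j < dim_col (column_mat n s ?a * column_mat n s ?b)"
        then have "i < n" "j < n" by auto
        then show "column_mat n s u $$ (i, j) = (column_mat n s ?a * column_mat n s ?b) $$ (i, j)"
          using s u y(1) True by (auto simp: column_mat_mult[OF column_mat_carrier])
      qed auto
      moreover have "column_mat n s ?a \<in> N" "column_mat n s ?b \<in> N" using s u by (auto intro!: star)
      ultimately show ?thesis using multN by simp
    qed (use star s u in blast)
    have "column_mat n s u \<in> N" if s: "s < n" and u: "u s \<noteq> 0" for s u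
    proof (cases "s = r")
      case True
      then show ?thesis using column_mat_upper_triangular[of s n u] s u last by (intro upper) auto
    next
      case False
      let ?a = "\<lambda>i. u i / u s" and ?b = "\<lambda>i. if i = s then u s else 0"
      have "column_mat n s u = column_mat n s ?a * column_mat n s ?b"
      proof (rule eq_matI)
        fix i j assume "i < dim_row (column_mat n s ?a * column_mat n s ?b)" "j < dim_col (column_mat n s ?a * column_mat n s ?b)"
        then have "i < n" "j < n" by auto
        then show "column_mat n s u $$ (i, j) = (column_mat n s ?a * column_mat n s ?b) $$ (i, j)"
          using s u by (auto simp: column_mat_mult[OF column_mat_carrier])
      qed auto
      moreover have "column_mat n s ?a \<in> N" using False s u last by (intro unit_col) auto
      moreover have "column_mat n s ?b \<in> N"
        using column_mat_upper_triangular[of s n ?b] s u by (intro upper) auto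
      ultimately show ?thesis using multN by simp
    qed
    then show ?thesis using GL_generated_by_column_mats[OF multN one] by blast
  qed
qed

section \<open>The symmetric subgroup\<close>

lemma GL_GL_sel [simp]: "g \<otimes>\<^bsub>GL_GL p q\<^esub> h = g * h" "\<one>\<^bsub>GL_GL p q\<^esub> = 1\<^sub>m (p + q)"
  by (simp_all add: GL_GL_def)

lemma block_diag_carrier:
  assumes "a \<in> carrier_mat p p" "d \<in> carrier_mat q q"
  shows "block_diag a d \<in> carrier_mat (p + q) (p + q)"
  using assms by (auto simp: block_diag_def)

lemma index_block_diag:
  assumes "a \<in> carrier_mat p p" "d \<in> carrier_mat q q" "i < p + q" "j < p + q"
  shows "block_diag a d $$ (i, j) = (if i < p \<and> j < p then a $$ (i, j)
    else if p \<le> i \<and> p \<le> j then d $$ (i - p, j - p) else 0)"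
  using assms by (auto simp: block_diag_def)

lemma block_diag_mult:
  assumes "a \<in> carrier_mat p p" "d \<in> carrier_mat q q" "a' \<in> carrier_mat p p" "d' \<in> carrier_mat q q"
  shows "block_diag a d * block_diag a' d' = block_diag (a * a') (d * d')"
  using assms by (simp add: block_diag_def mult_four_block_mat[of _ p p _ q _ q _ _ p _ q])

lemma block_diag_one: "block_diag (1\<^sub>m p) (1\<^sub>m q) = 1\<^sub>m (p + q)"
  by (simp add: block_diag_def)

lemma GL_GL_E:
  assumes "g \<in> carrier (GL_GL p q)"
  obtains a d where "a \<in> carrier (GL p)" "d \<in> carrier (GL q)" "g = block_diag a d"
  using assms by (auto simp: GL_GL_def block_prod_def)

lemma GL_GL_I: "a \<in> carrier (GL p) \<Longrightarrow> d \<in> carrier (GL q) \<Longrightarrow> block_diag a d \<in> carrier (GL_GL p q)"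
  by (auto simp: GL_GL_def block_prod_def)

text \<open>An invertible matrix without entries between the two classes of indices commutes with the involution
  \<open>diag(1\<^sub>p, -1\<^sub>q)\<close>, so it is one of its fixed points.\<close>

lemma GL_GL_units_on: "carrier (GL_GL p q) = units_on (p + q) (\<lambda>i j. i < p \<longleftrightarrow> j < p)"
proof (intro equalityI subsetI)
  fix g assume g: "g \<in> carrier (GL_GL p q)"
  interpret group "GL_GL p q" by (rule group_GL_GL)
  have off: "id_off (p + q) (\<lambda>i j. i < p \<longleftrightarrow> j < p) k" if k: "k \<in> carrier (GL_GL p q)" for k
  proof -
    obtain a d where ad: "a \<in> carrier_mat p p" "d \<in> carrier_mat q q" "k = block_diag a d"
      using GL_GL_E[OF k] GL_carrier_mat by metis
    then show ?thesis by (auto simp: id_off_def block_diag_carrier index_block_diag)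
  qed
  show "g \<in> units_on (p + q) (\<lambda>i j. i < p \<longleftrightarrow> j < p)"
    using off[OF g] off[OF inv_closed[OF g]] r_inv[OF g] l_inv[OF g]
    by (intro units_onI[of _ _ _ "inv\<^bsub>GL_GL p q\<^esub> g"]) simp_all
next
  fix g :: "complex mat" assume g: "g \<in> units_on (p + q) (\<lambda>i j. i < p \<longleftrightarrow> j < p)"
  interpret group "GL (p + q)" by (rule group_GL)
  define s :: "complex mat" where "s = block_diag (1\<^sub>m p) (- 1\<^sub>m q)"
  have sc: "s = scaling_mat (p + q) (\<lambda>i. if i < p then 1 else - 1)"
  proof (rule eq_matI)
    fix i j assume "i < dim_row (scaling_mat (p + q) (\<lambda>i. if i < p then 1 else - 1 :: complex))"
      "j < dim_col (scaling_mat (p + q) (\<lambda>i. if i < p then 1 else - 1 :: complex))"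
    then have ij: "i < p + q" "j < p + q" by (auto simp: scaling_mat_def)
    then show "s $$ (i, j) = scaling_mat (p + q) (\<lambda>i. if i < p then 1 else - 1) $$ (i, j)"
      by (auto simp: s_def index_block_diag[of _ p _ q] scaling_mat_def)
  qed (simp_all add: s_def block_diag_def scaling_mat_def)
  have "s \<in> units_on (p + q) (\<lambda>_ _. True)" unfolding sc by (rule scaling_mat_units) auto
  then have sG: "s \<in> carrier (GL (p + q))" by (rule units_on_GL)
  have gG: "g \<in> carrier (GL (p + q))" using g by (rule units_on_GL)
  have gc: "g \<in> carrier_mat (p + q) (p + q)" using g by (rule units_on_carrier)
  have "s * g = g * s"
  proof (rule eq_matI)
    fix i j assume "i < dim_row (g * s)" "j < dim_col (g * s)"
    then have ij: "i < p + q" "j < p + q" using gc sc by (auto simp: scaling_mat_def)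
    show "(s * g) $$ (i, j) = (g * s) $$ (i, j)"
      unfolding sc scaling_mat_mult[OF gc ij] using units_on_off[OF g ij] ij by (cases "i = j") auto
  qed (use gc sc in \<open>auto simp: scaling_mat_def\<close>)
  then have "s \<otimes>\<^bsub>GL (p + q)\<^esub> g \<otimes>\<^bsub>GL (p + q)\<^esub> inv\<^bsub>GL (p + q)\<^esub> s = g"
    using inv_solve_right'[of g "s * g" s] sG gG m_closed[OF sG gG] by simp
  then show "g \<in> carrier (GL_GL p q)"
    using gG unfolding carrier_GL_GL_fixed_points s_def by simp
qed

lemma GL_GL_inverse_GL:
  assumes "h \<in> carrier (GL_GL p q)"
  shows "h \<in> carrier (GL (p + q))" "inv\<^bsub>GL_GL p q\<^esub> h \<in> carrier (GL (p + q))" "h * inv\<^bsub>GL_GL p q\<^esub> h = 1\<^sub>m (p + q)"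
proof -
  interpret group "GL_GL p q" by (rule group_GL_GL)
  show "h * inv\<^bsub>GL_GL p q\<^esub> h = 1\<^sub>m (p + q)" using r_inv[OF assms] by simp
  show "h \<in> carrier (GL (p + q))" "inv\<^bsub>GL_GL p q\<^esub> h \<in> carrier (GL (p + q))"
    using assms inv_closed[OF assms] units_on_GL by (auto simp: GL_GL_units_on)
qed

section \<open>Maximal parabolic subgroups\<close>

lemma parabolic_contains_conjugate:
  assumes mult: "\<And>a b. a \<otimes>\<^bsub>H\<^esub> b = a * b" and P: "parabolic_subgroup H P"
  shows "\<exists>h\<in>carrier H. \<forall>b\<in>carrier H. upper_triangular b \<longrightarrow> h * b * inv\<^bsub>H\<^esub> h \<in> P"
proof -
  obtain B h where h: "h \<in> carrier H" and B: "B = (h <#\<^bsub>H\<^esub> {b \<in> carrier H. upper_triangular b}) #>\<^bsub>H\<^esub> inv\<^bsub>H\<^esub> h" "B \<subseteq> P"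
    using P by (auto simp: parabolic_subgroup_def borel_subgroup_def conjugate_in_def)
  have "h * b * inv\<^bsub>H\<^esub> h \<in> B" if "b \<in> carrier H" "upper_triangular b" for b
    using that by (auto simp: B(1) l_coset_def r_coset_def mult)
  then show ?thesis using h B(2) by blast
qed

text \<open>Conjugating by \<open>h\<close> allows one to assume that a parabolic subgroup contains the upper triangular
  elements.\<close>

lemma conjugate_preimage:
  assumes grp: "group H" and sub: "subgroup P H" and h: "h \<in> carrier H"
  defines "S \<equiv> {g \<in> carrier H. h \<otimes>\<^bsub>H\<^esub> g \<otimes>\<^bsub>H\<^esub> inv\<^bsub>H\<^esub> h \<in> P}"
  shows "x \<in> S \<Longrightarrow> y \<in> S \<Longrightarrow> x \<otimes>\<^bsub>H\<^esub> y \<in> S" and "x \<in> S \<Longrightarrow> inv\<^bsub>H\<^esub> x \<in> S"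
    and "S = carrier H \<Longrightarrow> P = carrier H"
proof -
  interpret group H by (rule grp)
  interpret P: subgroup P H by (rule sub)
  have cancel: "inv\<^bsub>H\<^esub> h \<otimes>\<^bsub>H\<^esub> (h \<otimes>\<^bsub>H\<^esub> v) = v" "h \<otimes>\<^bsub>H\<^esub> (inv\<^bsub>H\<^esub> h \<otimes>\<^bsub>H\<^esub> v) = v" if "v \<in> carrier H" for v
    using that h by (simp_all flip: m_assoc)
  show "x \<otimes>\<^bsub>H\<^esub> y \<in> S" if "x \<in> S" "y \<in> S"
  proof -
    have xy: "x \<in> carrier H" "y \<in> carrier H" using that by (auto simp: S_def)
    have "h \<otimes>\<^bsub>H\<^esub> (x \<otimes>\<^bsub>H\<^esub> y) \<otimes>\<^bsub>H\<^esub> inv\<^bsub>H\<^esub> h =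
        (h \<otimes>\<^bsub>H\<^esub> x \<otimes>\<^bsub>H\<^esub> inv\<^bsub>H\<^esub> h) \<otimes>\<^bsub>H\<^esub> (h \<otimes>\<^bsub>H\<^esub> y \<otimes>\<^bsub>H\<^esub> inv\<^bsub>H\<^esub> h)"
      using xy h by (simp add: m_assoc cancel)
    then show ?thesis using that xy by (auto simp: S_def)
  qed
  show "inv\<^bsub>H\<^esub> x \<in> S" if "x \<in> S"
  proof -
    have x: "x \<in> carrier H" using that by (auto simp: S_def)
    have "h \<otimes>\<^bsub>H\<^esub> inv\<^bsub>H\<^esub> x \<otimes>\<^bsub>H\<^esub> inv\<^bsub>H\<^esub> h = inv\<^bsub>H\<^esub> (h \<otimes>\<^bsub>H\<^esub> x \<otimes>\<^bsub>H\<^esub> inv\<^bsub>H\<^esub> h)"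
      using x h by (simp add: inv_mult_group m_assoc)
    then show ?thesis using that x by (auto simp: S_def)
  qed
  show "P = carrier H" if "S = carrier H"
  proof
    show "carrier H \<subseteq> P"
    proof
      fix g assume g: "g \<in> carrier H"
      then have "inv\<^bsub>H\<^esub> h \<otimes>\<^bsub>H\<^esub> g \<otimes>\<^bsub>H\<^esub> h \<in> S" using that h by simp
      then have "h \<otimes>\<^bsub>H\<^esub> (inv\<^bsub>H\<^esub> h \<otimes>\<^bsub>H\<^esub> g \<otimes>\<^bsub>H\<^esub> h) \<otimes>\<^bsub>H\<^esub> inv\<^bsub>H\<^esub> h \<in> P" by (simp add: S_def)
      moreover have "h \<otimes>\<^bsub>H\<^esub> (inv\<^bsub>H\<^esub> h \<otimes>\<^bsub>H\<^esub> g \<otimes>\<^bsub>H\<^esub> h) \<otimes>\<^bsub>H\<^esub> inv\<^bsub>H\<^esub> h = g"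
        using g h by (simp add: m_assoc cancel)
      ultimately show "g \<in> P" by simp
    qed
  qed (rule P.subset)
qed

text \<open>The conjugate by \<open>h\<close> of the stabiliser \<open>units_on n R\<close> is a subgroup that contains \<open>P\<close>, hence it is parabolic; as it is a
  proper subgroup, maximality makes it equal to \<open>P\<close>.\<close>

lemma maximal_parabolic_contains:
  assumes grp: "group H" and mult: "\<And>a b. a \<otimes>\<^bsub>H\<^esub> b = a * b" and one: "\<one>\<^bsub>H\<^esub> = 1\<^sub>m n"
    and car: "carrier H = units_on n T" and max: "maximal_parabolic_subgroup H P"
    and R: "transp R" "\<And>i j. R i j \<Longrightarrow> T i j" and h: "h \<in> carrier H"
    and stab: "\<And>g. g \<in> carrier H \<Longrightarrow> h * g * inv\<^bsub>H\<^esub> h \<in> P \<Longrightarrow> id_off n R g"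
    and proper: "x \<in> carrier H" "x \<notin> units_on n R"
  shows "\<forall>v\<in>units_on n R. h * v * inv\<^bsub>H\<^esub> h \<in> P"
proof -
  interpret group H by (rule grp)
  define c where "c v = h \<otimes>\<^bsub>H\<^esub> v \<otimes>\<^bsub>H\<^esub> inv\<^bsub>H\<^esub> h" for v
  have sub: "subgroup P H" and par: "parabolic_subgroup H P"
    and maxP: "\<And>P'. parabolic_subgroup H P' \<Longrightarrow> P \<subseteq> P' \<Longrightarrow> P' = P \<or> P' = carrier H"
    using max by (auto simp: maximal_parabolic_subgroup_def parabolic_subgroup_def)
  have unitsH: "units_on n R \<subseteq> carrier H" using R(2) by (auto simp: car intro: units_on_mono)
  have cancel: "inv\<^bsub>H\<^esub> h \<otimes>\<^bsub>H\<^esub> (h \<otimes>\<^bsub>H\<^esub> v) = v" "h \<otimes>\<^bsub>H\<^esub> (inv\<^bsub>H\<^esub> h \<otimes>\<^bsub>H\<^esub> v) = v" if "v \<in> carrier H" for v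
    using that h by (simp_all flip: m_assoc)
  have c_mult: "c v \<otimes>\<^bsub>H\<^esub> c w = c (v \<otimes>\<^bsub>H\<^esub> w)" if "v \<in> carrier H" "w \<in> carrier H" for v w
    using that h by (simp add: c_def m_assoc cancel)
  have c_closed: "c v \<in> carrier H" if "v \<in> carrier H" for v using that h by (simp add: c_def)
  have c_inj: "v = w" if "v \<in> carrier H" "w \<in> carrier H" "c v = c w" for v w
    using that h by (simp add: c_def)
  have c_one: "c \<one>\<^bsub>H\<^esub> = \<one>\<^bsub>H\<^esub>" using h by (simp add: c_def)
  have c_inv: "inv\<^bsub>H\<^esub> (c v) = c (inv\<^bsub>H\<^esub> v)" if "v \<in> carrier H" for v
    using that c_mult[of "inv\<^bsub>H\<^esub> v" v] c_closed c_one by (intro inv_equality) auto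
  have c_surj: "\<exists>v\<in>carrier H. g = c v" if "g \<in> carrier H" for g
    using that h by (intro bexI[of _ "inv\<^bsub>H\<^esub> h \<otimes>\<^bsub>H\<^esub> g \<otimes>\<^bsub>H\<^esub> h"]) (simp_all add: c_def m_assoc cancel)
  have units_inv: "inv\<^bsub>H\<^esub> v \<in> units_on n R" if v: "v \<in> units_on n R" for v
  proof -
    obtain v' where v': "v' \<in> units_on n R" "v' * v = 1\<^sub>m n" using units_onE[OF v] by metis
    then have "inv\<^bsub>H\<^esub> v = v'" using v unitsH by (intro inv_equality) (auto simp: mult one)
    then show ?thesis using v' by simp
  qed
  have stabc: "id_off n R v" if "v \<in> carrier H" "c v \<in> P" for v
    using stab[OF that(1)] that(2) by (simp add: c_def mult)
  have "P \<subseteq> c ` units_on n R"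
  proof
    fix g assume g: "g \<in> P"
    then obtain v where v: "v \<in> carrier H" "g = c v" using c_surj subgroup.mem_carrier[OF sub] by blast
    have "c (inv\<^bsub>H\<^esub> v) \<in> P" using subgroup.m_inv_closed[OF sub g] c_inv v by simp
    then have "id_off n R (inv\<^bsub>H\<^esub> v)" using stabc v by simp
    moreover have "v * inv\<^bsub>H\<^esub> v = 1\<^sub>m n" "inv\<^bsub>H\<^esub> v * v = 1\<^sub>m n"
      using r_inv[OF v(1)] l_inv[OF v(1)] by (simp_all add: mult one)
    ultimately have "v \<in> units_on n R" using stabc[OF v(1)] g v(2) by (intro units_onI) auto
    then show "g \<in> c ` units_on n R" using v by blast
  qed
  moreover have "subgroup (c ` units_on n R) H"
  proof (rule subgroupI)
    show "c ` units_on n R \<subseteq> carrier H" using unitsH c_closed by blast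
    show "c ` units_on n R \<noteq> {}" using units_on_one by blast
    show "inv\<^bsub>H\<^esub> a \<in> c ` units_on n R" if a: "a \<in> c ` units_on n R" for a
    proof -
      obtain v where v: "v \<in> units_on n R" "a = c v" using a by blast
      then have "inv\<^bsub>H\<^esub> a = c (inv\<^bsub>H\<^esub> v)" using c_inv unitsH by blast
      then show ?thesis using units_inv[OF v(1)] by blast
    qed
    show "a \<otimes>\<^bsub>H\<^esub> b \<in> c ` units_on n R" if ab: "a \<in> c ` units_on n R" "b \<in> c ` units_on n R" for a b
    proof -
      obtain v w where vw: "v \<in> units_on n R" "w \<in> units_on n R" "a = c v" "b = c w" using ab by blast
      then have "v * w \<in> units_on n R" using units_on_mult[OF R(1)] by blast
      moreover have "v \<in> carrier H" "w \<in> carrier H" using vw unitsH by blast+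
      then have "a \<otimes>\<^bsub>H\<^esub> b = c (v * w)" using c_mult[of v w] vw(3,4) mult[of v w] by simp
      ultimately show ?thesis by blast
    qed
  qed
  ultimately have "parabolic_subgroup H (c ` units_on n R)"
    using par unfolding parabolic_subgroup_def by blast
  moreover have "c ` units_on n R \<noteq> carrier H"
  proof
    assume "c ` units_on n R = carrier H"
    then obtain v where "v \<in> units_on n R" "c x = c v" using c_closed[OF proper(1)] by blast
    then show False using c_inj[of x v] proper unitsH by blast
  qed
  ultimately have "c ` units_on n R = P" using maxP \<open>P \<subseteq> c ` units_on n R\<close> by blast
  then show ?thesis by (auto simp: c_def mult)
qed

text \<open>A transvection that does not preserve the coordinate subspace given by \<open>R\<close>, which shows that its stabiliser is a proper
  subgroup.\<close>

lemma lower_entry_column_mat: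
  assumes "r < m" "m < n" and T: "T r r" "T m r" and R: "\<not> R m r"
  shows "column_mat n r (\<lambda>i. if i = r \<or> i = m then 1 else 0 :: complex) \<in> units_on n T"
    "column_mat n r (\<lambda>i. if i = r \<or> i = m then 1 else 0 :: complex) \<notin> units_on n R"
proof -
  let ?x = "column_mat n r (\<lambda>i. if i = r \<or> i = m then 1 else 0 :: complex)"
  show "?x \<in> units_on n T" using assms by (intro column_mat_units) (auto split: if_splits)
  show "?x \<notin> units_on n R" using units_on_off[of ?x n R m r] assms by auto
qed

lemma maximal_parabolic_GL:
  assumes n: "0 < n" and max: "maximal_parabolic_subgroup (GL n) P"
  shows "\<exists>m\<le>n. \<exists>h\<in>carrier (GL n). \<forall>v\<in>units_on n (\<lambda>i j. j < m \<longrightarrow> i < m). h * v * inv\<^bsub>GL n\<^esub> h \<in> P"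
proof -
  interpret group "GL n" by (rule group_GL)
  have par: "parabolic_subgroup (GL n) P" and sub: "subgroup P (GL n)" and ne: "P \<noteq> carrier (GL n)"
    using max by (auto simp: maximal_parabolic_subgroup_def parabolic_subgroup_def)
  obtain h where h: "h \<in> carrier (GL n)"
    and upper: "\<And>b. b \<in> carrier (GL n) \<Longrightarrow> upper_triangular b \<Longrightarrow> h * b * inv\<^bsub>GL n\<^esub> h \<in> P"
    using parabolic_contains_conjugate[OF _ par] by auto
  define S where "S = {g \<in> carrier (GL n). h * g * inv\<^bsub>GL n\<^esub> h \<in> P}"
  have S: "x * y \<in> S" if "x \<in> S" "y \<in> S" for x y
    using conjugate_preimage(1)[OF group_GL sub h, of x y] that by (simp add: S_def)
  have Sinv: "inv\<^bsub>GL n\<^esub> x \<in> S" if "x \<in> S" for x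
    using conjugate_preimage(2)[OF group_GL sub h, of x] that by (simp add: S_def)
  have Sne: "S \<noteq> carrier (GL n)"
    using conjugate_preimage(3)[OF group_GL sub h] ne by (auto simp: S_def)
  have "x' \<in> S" if "x \<in> S" "x' \<in> carrier (GL n)" "x' * x = 1\<^sub>m n" for x x'
    using Sinv[OF that(1)] inv_equality[of x' x] that by (auto simp: S_def)
  then have "carrier (GL n) \<subseteq> S \<or> (\<exists>m. 0 < m \<and> m < n \<and> (\<forall>x\<in>S. \<forall>i<n. \<forall>j<m. m \<le> i \<longrightarrow> x $$ (i, j) = 0))"
    using n S upper by (intro full_or_stabilises) (auto simp: S_def)
  then obtain m where m: "0 < m" "m < n" and st: "\<And>x i j. x \<in> S \<Longrightarrow> i < n \<Longrightarrow> j < m \<Longrightarrow> m \<le> i \<Longrightarrow> x $$ (i, j) = 0"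
    using Sne by (auto simp: S_def)
  have "\<forall>v\<in>units_on n (\<lambda>i j. j < m \<longrightarrow> i < m). h * v * inv\<^bsub>GL n\<^esub> h \<in> P"
  proof (rule maximal_parabolic_contains[OF group_GL _ _ GL_units_on max _ _ h])
    show "id_off n (\<lambda>i j. j < m \<longrightarrow> i < m) g" if "g \<in> carrier (GL n)" "h * g * inv\<^bsub>GL n\<^esub> h \<in> P" for g
      using that st[of g] by (auto simp: id_off_def S_def GL_carrier_mat)
    show "column_mat n 0 (\<lambda>i. if i = 0 \<or> i = m then 1 else 0) \<in> carrier (GL n)"
      unfolding GL_units_on by (rule lower_entry_column_mat(1)[of 0 m]) (use m in auto)
    show "column_mat n 0 (\<lambda>i. if i = 0 \<or> i = m then 1 else 0 :: complex) \<notin> units_on n (\<lambda>i j. j < m \<longrightarrow> i < m)"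
      by (rule lower_entry_column_mat(2)[where T = "\<lambda>_ _. True"]) (use m in auto)
  qed (auto simp: transp_def)
  then show ?thesis using m h by (intro exI[of _ m]) auto
qed

text \<open>\<open>full_or_stabilises\<close> is applied to the projection of \<open>S\<close> to each factor and to the intersection of \<open>S\<close> with it. If both
  intersections are everything, so is \<open>S\<close>.\<close>

lemma GL_GL_subgroup_cases:
  assumes p: "0 < p" and q: "0 < q" and SK: "S \<subseteq> carrier (GL_GL p q)"
    and mult: "\<And>x y. x \<in> S \<Longrightarrow> y \<in> S \<Longrightarrow> x * y \<in> S"
    and inv: "\<And>x x'. x \<in> S \<Longrightarrow> x' \<in> carrier (GL_GL p q) \<Longrightarrow> x' * x = 1\<^sub>m (p + q) \<Longrightarrow> x' \<in> S"
    and upper: "\<And>b. b \<in> carrier (GL_GL p q) \<Longrightarrow> upper_triangular b \<Longrightarrow> b \<in> S"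
  shows "carrier (GL_GL p q) \<subseteq> S \<or>
    (\<exists>m. 0 < m \<and> m < p \<and> (\<forall>g\<in>S. \<forall>i<p. \<forall>j<m. m \<le> i \<longrightarrow> g $$ (i, j) = 0)) \<or>
    (\<exists>m. 0 < m \<and> m < q \<and> (\<forall>g\<in>S. \<forall>i<q. \<forall>j<m. m \<le> i \<longrightarrow> g $$ (p + i, p + j) = 0))"
proof -
  let ?bd = block_diag
  have oneG: "1\<^sub>m k \<in> carrier (GL k)" for k by (simp add: carrier_GL)
  have gc: "a \<in> carrier_mat k k" if "a \<in> carrier (GL k)" for a k using that by (rule GL_carrier_mat)
  have bm: "?bd a d * ?bd a' d' = ?bd (a * a') (d * d')"
    if "a \<in> carrier (GL p)" "d \<in> carrier (GL q)" "a' \<in> carrier (GL p)" "d' \<in> carrier (GL q)" for a d a' d'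
    using that by (intro block_diag_mult[where p=p and q=q] gc)
  have bup: "upper_triangular (?bd a d)"
    if "a \<in> carrier (GL p)" "d \<in> carrier (GL q)" "upper_triangular a" "upper_triangular d" for a d
    using that gc[OF that(1)] gc[OF that(2)] block_diag_carrier[OF gc[OF that(1)] gc[OF that(2)]]
    by (auto simp: upper_triangular_def index_block_diag[of a p d q])
  have binv: "?bd a' d' \<in> S"
    if "?bd a d \<in> S" "a \<in> carrier (GL p)" "d \<in> carrier (GL q)" "a' \<in> carrier (GL p)" "d' \<in> carrier (GL q)"
      "a' * a = 1\<^sub>m p" "d' * d = 1\<^sub>m q" for a d a' d'
    by (rule inv[OF that(1) GL_GL_I[OF that(4,5)]]) (simp add: bm that block_diag_one)
  define X1 where "X1 = {a \<in> carrier (GL p). \<exists>d\<in>carrier (GL q). ?bd a d \<in> S}"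
  define N1 where "N1 = {a \<in> carrier (GL p). ?bd a (1\<^sub>m q) \<in> S}"
  define X2 where "X2 = {d \<in> carrier (GL q). \<exists>a\<in>carrier (GL p). ?bd a d \<in> S}"
  define N2 where "N2 = {d \<in> carrier (GL q). ?bd (1\<^sub>m p) d \<in> S}"
  have 1: "carrier (GL p) \<subseteq> N1 \<or> (\<exists>m. 0 < m \<and> m < p \<and> (\<forall>x\<in>X1. \<forall>i<p. \<forall>j<m. m \<le> i \<longrightarrow> x $$ (i, j) = 0))"
  proof (rule full_or_stabilises[OF p])
    show "x * y \<in> X1" if xy: "x \<in> X1" "y \<in> X1" for x y
    proof -
      obtain d d' where "d \<in> carrier (GL q)" "?bd x d \<in> S" "d' \<in> carrier (GL q)" "?bd y d' \<in> S"
        using xy by (auto simp: X1_def)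
      then show ?thesis
        using xy mult[of "?bd x d" "?bd y d'"] bm[of x d y d'] GL_mult[of d q d'] GL_mult[of x p y]
        by (auto simp: X1_def)
    qed
    show "x * y \<in> N1" if "x \<in> N1" "y \<in> N1" for x y
      using that mult[of "?bd x (1\<^sub>m q)" "?bd y (1\<^sub>m q)"] bm[of x "1\<^sub>m q" y "1\<^sub>m q"] oneG GL_mult[of x p y]
      by (auto simp: N1_def)
    show "x * y * x' \<in> N1" if x: "x \<in> X1" "x' \<in> carrier (GL p)" "x * x' = 1\<^sub>m p" "x' * x = 1\<^sub>m p" and y: "y \<in> N1" for x x' y
    proof -
      obtain d where d: "d \<in> carrier (GL q)" "?bd x d \<in> S" using x by (auto simp: X1_def)
      obtain d' where d': "d' \<in> carrier (GL q)" "d * d' = 1\<^sub>m q" "d' * d = 1\<^sub>m q" using GL_E[OF d(1)] by metis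
      have G: "x \<in> carrier (GL p)" "y \<in> carrier (GL p)" "?bd y (1\<^sub>m q) \<in> S" using x y by (auto simp: X1_def N1_def)
      have "?bd x d * ?bd y (1\<^sub>m q) * ?bd x' d' \<in> S"
        using binv[OF d(2) G(1) d(1) x(2) d'(1) x(4) d'(3)] G d mult by blast
      moreover have "?bd x d * ?bd y (1\<^sub>m q) * ?bd x' d' = ?bd (x * y * x') (1\<^sub>m q)"
        using bm[OF G(1) d(1) G(2) oneG] bm[OF GL_mult[OF G(1,2)] d(1) x(2) d'(1)] d' gc[OF d(1)] by simp
      ultimately show ?thesis using GL_mult[OF GL_mult[OF G(1,2)] x(2)] by (simp add: N1_def)
    qed
    show "b \<in> N1" if "b \<in> carrier (GL p)" "upper_triangular b" for b
      using that bup[of b "1\<^sub>m q"] oneG upper[OF GL_GL_I[OF that(1) oneG]] by (auto simp: N1_def)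
  qed (use oneG in \<open>auto simp: X1_def N1_def\<close>)
  have 2: "carrier (GL q) \<subseteq> N2 \<or> (\<exists>m. 0 < m \<and> m < q \<and> (\<forall>x\<in>X2. \<forall>i<q. \<forall>j<m. m \<le> i \<longrightarrow> x $$ (i, j) = 0))"
  proof (rule full_or_stabilises[OF q])
    show "x * y \<in> X2" if xy: "x \<in> X2" "y \<in> X2" for x y
    proof -
      obtain d d' where "d \<in> carrier (GL p)" "?bd d x \<in> S" "d' \<in> carrier (GL p)" "?bd d' y \<in> S"
        using xy by (auto simp: X2_def)
      then show ?thesis
        using xy mult[of "?bd d x" "?bd d' y"] bm[of d x d' y] GL_mult[of d p d'] GL_mult[of x q y]
        by (auto simp: X2_def)
    qed
    show "x * y \<in> N2" if "x \<in> N2" "y \<in> N2" for x y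
      using that mult[of "?bd (1\<^sub>m p) x" "?bd (1\<^sub>m p) y"] bm[of "1\<^sub>m p" x "1\<^sub>m p" y] oneG GL_mult[of x q y]
      by (auto simp: N2_def)
    show "x * y * x' \<in> N2" if x: "x \<in> X2" "x' \<in> carrier (GL q)" "x * x' = 1\<^sub>m q" "x' * x = 1\<^sub>m q" and y: "y \<in> N2" for x x' y
    proof -
      obtain d where d: "d \<in> carrier (GL p)" "?bd d x \<in> S" using x by (auto simp: X2_def)
      obtain d' where d': "d' \<in> carrier (GL p)" "d * d' = 1\<^sub>m p" "d' * d = 1\<^sub>m p" using GL_E[OF d(1)] by metis
      have G: "x \<in> carrier (GL q)" "y \<in> carrier (GL q)" "?bd (1\<^sub>m p) y \<in> S" using x y by (auto simp: X2_def N2_def)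
      have "?bd d x * ?bd (1\<^sub>m p) y * ?bd d' x' \<in> S"
        using binv[OF d(2) d(1) G(1) d'(1) x(2) d'(3) x(4)] G d mult by blast
      moreover have "?bd d x * ?bd (1\<^sub>m p) y * ?bd d' x' = ?bd (1\<^sub>m p) (x * y * x')"
        using bm[OF d(1) G(1) oneG G(2)] bm[OF d(1) GL_mult[OF G(1,2)] d'(1) x(2)] d' gc[OF d(1)] by simp
      ultimately show ?thesis using GL_mult[OF GL_mult[OF G(1,2)] x(2)] by (simp add: N2_def)
    qed
    show "b \<in> N2" if "b \<in> carrier (GL q)" "upper_triangular b" for b
      using that bup[of "1\<^sub>m p" b] oneG upper[OF GL_GL_I[OF oneG that(1)]] by (auto simp: N2_def)
  qed (use oneG in \<open>auto simp: X2_def N2_def\<close>)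
  have entries: "\<exists>a\<in>X1. \<exists>d\<in>X2. g = ?bd a d \<and> a \<in> carrier_mat p p \<and> d \<in> carrier_mat q q" if g: "g \<in> S" for g
  proof -
    obtain a d where "a \<in> carrier (GL p)" "d \<in> carrier (GL q)" "g = ?bd a d" using GL_GL_E[of g p q] g SK by blast
    then show ?thesis using g gc unfolding X1_def X2_def by blast
  qed
  consider "carrier (GL p) \<subseteq> N1 \<and> carrier (GL q) \<subseteq> N2"
    | m where "0 < m" "m < p" "\<forall>x\<in>X1. \<forall>i<p. \<forall>j<m. m \<le> i \<longrightarrow> x $$ (i, j) = 0"
    | m where "0 < m" "m < q" "\<forall>x\<in>X2. \<forall>i<q. \<forall>j<m. m \<le> i \<longrightarrow> x $$ (i, j) = 0"
    using 1 2 by blast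
  then show ?thesis
  proof cases
    case 1
    have "g \<in> S" if g: "g \<in> carrier (GL_GL p q)" for g
    proof -
      obtain a d where ad: "a \<in> carrier (GL p)" "d \<in> carrier (GL q)" "g = ?bd a d" using GL_GL_E[OF g] .
      then have "?bd a (1\<^sub>m q) * ?bd (1\<^sub>m p) d \<in> S" using 1 mult by (auto simp: N1_def N2_def)
      then show ?thesis using bm[OF ad(1) oneG oneG ad(2)] ad(3) gc[OF ad(1)] gc[OF ad(2)] by simp
    qed
    then show ?thesis by blast
  next
    case (2 m)
    have "g $$ (i, j) = 0" if gij: "g \<in> S" "i < p" "j < m" "m \<le> i" for g i j
    proof -
      obtain a d where ad: "a \<in> X1" "g = ?bd a d" "a \<in> carrier_mat p p" "d \<in> carrier_mat q q" using entries[OF gij(1)] by blast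
      then show ?thesis using 2 gij by (simp add: index_block_diag[of a p d q])
    qed
    then show ?thesis using 2 by blast
  next
    case (3 m)
    have "g $$ (p + i, p + j) = 0" if gij: "g \<in> S" "i < q" "j < m" "m \<le> i" for g i j
    proof -
      obtain a d where ad: "d \<in> X2" "g = ?bd a d" "a \<in> carrier_mat p p" "d \<in> carrier_mat q q" using entries[OF gij(1)] by blast
      then show ?thesis using 3 gij by (simp add: index_block_diag[of a p d q])
    qed
    then show ?thesis using 3 by blast
  qed
qed

text \<open>In the proof, \<open>r\<close> and \<open>m\<close> are the first index in \<open>U\<close> and the first one after it; the transvection adding row \<open>r\<close> to row
  \<open>m\<close> witnesses that the stabiliser of \<open>U\<close> is a proper subgroup.\<close>

lemma maximal_parabolic_GL_GL:
  assumes p: "0 < p" and q: "0 < q" and max: "maximal_parabolic_subgroup (GL_GL p q) Q"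
  shows "\<exists>h\<in>carrier (GL_GL p q). \<exists>U. (U \<subseteq> {..<p} \<or> U \<subseteq> {p..<p + q}) \<and>
    (\<forall>v\<in>units_on (p + q) (\<lambda>i j. (i < p \<longleftrightarrow> j < p) \<and> (j \<in> U \<longrightarrow> i \<in> U)). h * v * inv\<^bsub>GL_GL p q\<^esub> h \<in> Q)"
proof -
  interpret group "GL_GL p q" by (rule group_GL_GL)
  have par: "parabolic_subgroup (GL_GL p q) Q" and sub: "subgroup Q (GL_GL p q)" and ne: "Q \<noteq> carrier (GL_GL p q)"
    using max by (auto simp: maximal_parabolic_subgroup_def parabolic_subgroup_def)
  obtain h where h: "h \<in> carrier (GL_GL p q)"
    and upper: "\<And>b. b \<in> carrier (GL_GL p q) \<Longrightarrow> upper_triangular b \<Longrightarrow> h * b * inv\<^bsub>GL_GL p q\<^esub> h \<in> Q"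
    using parabolic_contains_conjugate[OF _ par] by auto
  define S where "S = {g \<in> carrier (GL_GL p q). h * g * inv\<^bsub>GL_GL p q\<^esub> h \<in> Q}"
  have S: "x * y \<in> S" if "x \<in> S" "y \<in> S" for x y
    using conjugate_preimage(1)[OF group_GL_GL sub h, of x y] that by (simp add: S_def)
  have Sinv: "inv\<^bsub>GL_GL p q\<^esub> x \<in> S" if "x \<in> S" for x
    using conjugate_preimage(2)[OF group_GL_GL sub h, of x] that by (simp add: S_def)
  have Sne: "S \<noteq> carrier (GL_GL p q)"
    using conjugate_preimage(3)[OF group_GL_GL sub h] ne by (auto simp: S_def)
  have Sinv': "x' \<in> S" if "x \<in> S" "x' \<in> carrier (GL_GL p q)" "x' * x = 1\<^sub>m (p + q)" for x x'
    using Sinv[OF that(1)] inv_equality[of x' x] that by (auto simp: S_def)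
  have SK: "S \<subseteq> carrier (GL_GL p q)" by (auto simp: S_def)
  have Supper: "b \<in> S" if "b \<in> carrier (GL_GL p q)" "upper_triangular b" for b
    using that upper by (simp add: S_def)
  have off: "g $$ (i, j) = 0" if "g \<in> S" "i < p + q" "j < p + q" "(i < p) \<noteq> (j < p)" for g i j
    using units_on_off[of g "p + q" "\<lambda>i j. i < p \<longleftrightarrow> j < p" i j] that SK by (auto simp: GL_GL_units_on)
  have "carrier (GL_GL p q) \<subseteq> S \<or>
    (\<exists>m. 0 < m \<and> m < p \<and> (\<forall>g\<in>S. \<forall>i<p. \<forall>j<m. m \<le> i \<longrightarrow> g $$ (i, j) = 0)) \<or>
    (\<exists>m. 0 < m \<and> m < q \<and> (\<forall>g\<in>S. \<forall>i<q. \<forall>j<m. m \<le> i \<longrightarrow> g $$ (p + i, p + j) = 0))"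
    by (rule GL_GL_subgroup_cases[OF p q SK]) (fact S | fact Sinv' | fact Supper)+
  then have "\<exists>U r m. (U \<subseteq> {..<p} \<or> U \<subseteq> {p..<p + q}) \<and> r < m \<and> m < p + q \<and> (m < p \<longleftrightarrow> r < p) \<and> r \<in> U \<and> m \<notin> U \<and>
      (\<forall>g\<in>S. \<forall>i<p + q. \<forall>j\<in>U. i \<notin> U \<longrightarrow> g $$ (i, j) = 0)"
  proof (elim disjE exE conjE)
    assume "carrier (GL_GL p q) \<subseteq> S"
    then show ?thesis using Sne SK by blast
  next
    fix m assume m: "0 < m" "m < p" and st: "\<forall>g\<in>S. \<forall>i<p. \<forall>j<m. m \<le> i \<longrightarrow> g $$ (i, j) = 0"
    have "g $$ (i, j) = 0" if "g \<in> S" "i < p + q" "j < m" "m \<le> i" for g i j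
      using that st off[of g i j] m by (cases "i < p") auto
    then show ?thesis using m by (intro exI[of _ "{..<m}"] exI[of _ 0] exI[of _ m]) auto
  next
    fix m assume m: "0 < m" "m < q" and st: "\<forall>g\<in>S. \<forall>i<q. \<forall>j<m. m \<le> i \<longrightarrow> g $$ (p + i, p + j) = 0"
    have "g $$ (i, j) = 0" if ij: "g \<in> S" "i < p + q" "j \<in> {p..<p + m}" "i \<notin> {p..<p + m}" for g i j
    proof (cases "i < p")
      case True
      then show ?thesis using off[of g i j] ij m by auto
    next
      case False
      then have "i - p < q" "j - p < m" "m \<le> i - p" using ij by auto
      then have "g $$ (p + (i - p), p + (j - p)) = 0" using st ij(1) by blast
      then show ?thesis using False ij by simp
    qed
    then show ?thesis using m by (intro exI[of _ "{p..<p + m}"] exI[of _ p] exI[of _ "p + m"]) auto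
  qed
  then obtain U r m where Urm: "(U \<subseteq> {..<p} \<or> U \<subseteq> {p..<p + q}) \<and> r < m \<and> m < p + q \<and>
      (m < p \<longleftrightarrow> r < p) \<and> r \<in> U \<and> m \<notin> U \<and> (\<forall>g\<in>S. \<forall>i<p + q. \<forall>j\<in>U. i \<notin> U \<longrightarrow> g $$ (i, j) = 0)"
    by (elim exE)
  then have U: "U \<subseteq> {..<p} \<or> U \<subseteq> {p..<p + q}"
    and rm: "r < m" "m < p + q" "m < p \<longleftrightarrow> r < p" "r \<in> U" "m \<notin> U" by simp_all
  have st: "g $$ (i, j) = 0" if "g \<in> S" "i < p + q" "j \<in> U" "i \<notin> U" for g i j
    using Urm that by simp
  let ?R = "\<lambda>i j. (i < p \<longleftrightarrow> j < p) \<and> (j \<in> U \<longrightarrow> i \<in> U)"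
  let ?x = "column_mat (p + q) r (\<lambda>i. if i = r \<or> i = m then 1 else 0 :: complex)"
  have "\<forall>v\<in>units_on (p + q) ?R. h * v * inv\<^bsub>GL_GL p q\<^esub> h \<in> Q"
  proof (rule maximal_parabolic_contains[OF group_GL_GL _ _ GL_GL_units_on max _ _ h])
    show "id_off (p + q) ?R g" if g: "g \<in> carrier (GL_GL p q)" "h * g * inv\<^bsub>GL_GL p q\<^esub> h \<in> Q" for g
    proof -
      have gS: "g \<in> S" using g by (simp add: S_def)
      have "g \<in> carrier_mat (p + q) (p + q)" using g(1) units_on_carrier by (auto simp: GL_GL_units_on)
      then show ?thesis using st[OF gS] off[OF gS] unfolding id_off_def by auto
    qed
    show "?x \<in> carrier (GL_GL p q)"
      unfolding GL_GL_units_on by (rule lower_entry_column_mat(1)[of r m]) (use rm in auto)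
    show "?x \<notin> units_on (p + q) ?R"
      by (rule lower_entry_column_mat(2)[where T = "\<lambda>_ _. True"]) (use rm in auto)
  qed (auto simp: transp_def)
  then show ?thesis using h U by blast
qed

section \<open>Orbits on the double flag variety\<close>

text \<open>If \<open>k\<^sup>-\<^sup>1 g = u f v\<close> with \<open>u\<close> in \<open>Q\<close> and \<open>v\<close> in \<open>P\<close>, then the point \<open>(g P, k Q)\<close> equals \<open>(k u) (f P, Q)\<close>, so the orbits are those
  of the points \<open>(f P, Q)\<close>.\<close>

lemma finite_orbits_if_finite_double_cosets:
  assumes n: "n = p + q" and P: "subgroup P (GL n)" and Q: "subgroup Q (GL_GL p q)"
    and fin: "finite_double_cosets n Q P"
  shows "finite (orbits (GL_GL p q) (double_flag (GL n) (GL_GL p q) P Q) (diagonal_action (GL n) (GL_GL p q)))"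
proof -
  let ?G = "GL n" and ?K = "GL_GL p q"
  interpret G: group ?G by (rule group_GL)
  interpret K: group ?K by (rule group_GL_GL)
  interpret P: subgroup P ?G by (rule P)
  interpret Q: subgroup Q ?K by (rule Q)
  let ?a = "diagonal_action ?G ?K"
  have KG: "k \<in> carrier ?G" if "k \<in> carrier ?K" for k
    using that n units_on_GL by (auto simp: GL_GL_units_on)
  obtain F where F: "finite F" "F \<subseteq> carrier ?G" and FG: "\<forall>g\<in>carrier ?G. \<exists>u\<in>Q. \<exists>f\<in>F. \<exists>v\<in>P. g = u * f * v"
    using fin unfolding finite_double_cosets_def by auto
  have act: "?a s (?a t (X, Y)) = ?a (s \<otimes>\<^bsub>?K\<^esub> t) (X, Y)"
    if "s \<in> carrier ?K" "t \<in> carrier ?K" "X \<subseteq> carrier ?G" "Y \<subseteq> carrier ?K" for s t X Y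
    using that G.lcos_m_assoc[OF that(3) KG[OF that(1)] KG[OF that(2)]] K.lcos_m_assoc[OF that(4,1,2)]
    by (simp add: diagonal_action_def)
  have orbit_eq: "orbit ?K ?a (?a t (X, Y)) = orbit ?K ?a (X, Y)"
    if t: "t \<in> carrier ?K" and XY: "X \<subseteq> carrier ?G" "Y \<subseteq> carrier ?K" for t X Y
  proof (intro equalityI subsetI)
    fix z assume "z \<in> orbit ?K ?a (?a t (X, Y))"
    then obtain s where "s \<in> carrier ?K" "z = ?a s (?a t (X, Y))" by (auto simp: orbit_def)
    then show "z \<in> orbit ?K ?a (X, Y)"
      using act[OF _ t XY, of s] K.m_closed[of s t] t unfolding orbit_def by blast
  next
    fix z assume "z \<in> orbit ?K ?a (X, Y)"
    then obtain s where s: "s \<in> carrier ?K" "z = ?a s (X, Y)" by (auto simp: orbit_def)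
    have st: "s \<otimes>\<^bsub>?K\<^esub> inv\<^bsub>?K\<^esub> t \<in> carrier ?K" using s t by blast
    have "s \<otimes>\<^bsub>?K\<^esub> inv\<^bsub>?K\<^esub> t \<otimes>\<^bsub>?K\<^esub> t = s"
      using s(1) t by (simp only: K.m_assoc K.inv_closed K.l_inv K.r_one)
    then have "z = ?a (s \<otimes>\<^bsub>?K\<^esub> inv\<^bsub>?K\<^esub> t) (?a t (X, Y))" using act[OF st t XY] s(2) by simp
    then show "z \<in> orbit ?K ?a (?a t (X, Y))" using st unfolding orbit_def by blast
  qed
  have "orbits ?K (double_flag ?G ?K P Q) ?a \<subseteq> (\<lambda>f. orbit ?K ?a (f <#\<^bsub>?G\<^esub> P, Q)) ` F"
  proof
    fix O' assume "O' \<in> orbits ?K (double_flag ?G ?K P Q) ?a"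
    then obtain g k where g: "g \<in> carrier ?G" and k: "k \<in> carrier ?K"
      and O': "O' = orbit ?K ?a (g <#\<^bsub>?G\<^esub> P, k <#\<^bsub>?K\<^esub> Q)"
      by (auto simp: orbits_def double_flag_def LCOSETS_def)
    have kG: "k \<in> carrier ?G" by (rule KG[OF k])
    obtain u f v where u: "u \<in> Q" and f: "f \<in> F" and v: "v \<in> P" and eq: "inv\<^bsub>?G\<^esub> k * g = u * f * v"
      using bspec[OF FG, of "inv\<^bsub>?G\<^esub> k * g"] G.m_closed[OF G.inv_closed[OF kG] g] by auto
    have uK: "u \<in> carrier ?K" and uG: "u \<in> carrier ?G" and fG: "f \<in> carrier ?G" and vG: "v \<in> carrier ?G"
      using u f v F KG by auto
    have ku: "k \<otimes>\<^bsub>?K\<^esub> u \<in> carrier ?K" using k uK by blast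
    have "g = k \<otimes>\<^bsub>?G\<^esub> (inv\<^bsub>?G\<^esub> k \<otimes>\<^bsub>?G\<^esub> g)"
      using G.m_assoc[OF kG G.inv_closed[OF kG] g] G.r_inv[OF kG] G.l_one[OF g] by metis
    also have "\<dots> = k \<otimes>\<^bsub>?G\<^esub> (u \<otimes>\<^bsub>?G\<^esub> f \<otimes>\<^bsub>?G\<^esub> v)" using eq by simp
    also have "\<dots> = (k \<otimes>\<^bsub>?G\<^esub> u) \<otimes>\<^bsub>?G\<^esub> f \<otimes>\<^bsub>?G\<^esub> v"
      using kG uG fG vG by (simp only: G.m_assoc G.m_closed)
    finally have "g <#\<^bsub>?G\<^esub> P = ((k \<otimes>\<^bsub>?G\<^esub> u) \<otimes>\<^bsub>?G\<^esub> f \<otimes>\<^bsub>?G\<^esub> v) <#\<^bsub>?G\<^esub> P" by (simp only:)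
    also have "\<dots> = ((k \<otimes>\<^bsub>?G\<^esub> u) \<otimes>\<^bsub>?G\<^esub> f) <#\<^bsub>?G\<^esub> (v <#\<^bsub>?G\<^esub> P)"
      using kG uG fG vG by (intro G.lcos_m_assoc[symmetric] P.subset G.m_closed)
    also have "v <#\<^bsub>?G\<^esub> P = P" using G.coset_join3[OF vG P v] .
    also have "((k \<otimes>\<^bsub>?G\<^esub> u) \<otimes>\<^bsub>?G\<^esub> f) <#\<^bsub>?G\<^esub> P = (k \<otimes>\<^bsub>?G\<^esub> u) <#\<^bsub>?G\<^esub> (f <#\<^bsub>?G\<^esub> P)"
      using kG uG fG by (intro G.lcos_m_assoc[symmetric] P.subset G.m_closed)
    finally have 1: "g <#\<^bsub>?G\<^esub> P = (k \<otimes>\<^bsub>?K\<^esub> u) <#\<^bsub>?G\<^esub> (f <#\<^bsub>?G\<^esub> P)" by simp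
    have "k <#\<^bsub>?K\<^esub> Q = k <#\<^bsub>?K\<^esub> (u <#\<^bsub>?K\<^esub> Q)" using K.coset_join3[OF uK Q u] by simp
    also have "\<dots> = (k \<otimes>\<^bsub>?K\<^esub> u) <#\<^bsub>?K\<^esub> Q" by (rule K.lcos_m_assoc[OF Q.subset k uK])
    finally have "(g <#\<^bsub>?G\<^esub> P, k <#\<^bsub>?K\<^esub> Q) = ?a (k \<otimes>\<^bsub>?K\<^esub> u) (f <#\<^bsub>?G\<^esub> P, Q)"
      using 1 by (simp add: diagonal_action_def)
    then have "O' = orbit ?K ?a (f <#\<^bsub>?G\<^esub> P, Q)"
      using orbit_eq[OF ku G.l_coset_subset_G[OF P.subset fG] Q.subset] O' by simp
    then show "O' \<in> (\<lambda>f. orbit ?K ?a (f <#\<^bsub>?G\<^esub> P, Q)) ` F" using f by blast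
  qed
  then show ?thesis using F(1) finite_surj by blast
qed

lemma conjugate_inD:
  assumes "conjugate_in (GL k) A B"
  shows "\<exists>x\<in>carrier (GL k). \<exists>x'\<in>carrier (GL k). x * x' = 1\<^sub>m k \<and> (\<forall>a\<in>A. x * a * x' \<in> B)"
proof -
  interpret group "GL k" by (rule group_GL)
  obtain x where x: "x \<in> carrier (GL k)" "B = (x <#\<^bsub>GL k\<^esub> A) #>\<^bsub>GL k\<^esub> inv\<^bsub>GL k\<^esub> x"
    using assms by (auto simp: conjugate_in_def)
  have "x * a * inv\<^bsub>GL k\<^esub> x \<in> B" if "a \<in> A" for a
    using that by (auto simp: x(2) l_coset_def r_coset_def)
  moreover have "x * inv\<^bsub>GL k\<^esub> x = 1\<^sub>m k" using r_inv[OF x(1)] by simp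
  ultimately show ?thesis using x(1) inv_closed[OF x(1)] by blast
qed

lemma standard_parabolic_line:
  assumes "a \<in> carrier (GL p)" "0 < p" "\<And>i. 0 < i \<Longrightarrow> i < p \<Longrightarrow> a $$ (i, 0) = 0"
  shows "a \<in> standard_parabolic [1, p - 1]"
proof -
  have "a $$ (i, j) = 0" if "k \<le> length [1, p - 1]" "i \<in> {sum_list (take k [1, p - 1])..<p}" "j < sum_list (take k [1, p - 1])" for k i j
  proof -
    have "k = 0 \<or> k = 1 \<or> k = 2" using that(1) by auto
    then show ?thesis using that assms by auto
  qed
  then show ?thesis using assms by (simp add: standard_parabolic_def Let_def)
qed

lemma standard_parabolic_hyperplane:
  assumes "a \<in> carrier (GL q)" "0 < q" "\<And>j. j < q - 1 \<Longrightarrow> a $$ (q - 1, j) = 0"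
  shows "a \<in> standard_parabolic [q - 1, 1]"
proof -
  have "a $$ (i, j) = 0" if "k \<le> length [q - 1, 1]" "i \<in> {sum_list (take k [q - 1, 1])..<q}" "j < sum_list (take k [q - 1, 1])" for k i j
  proof -
    have "k = 0 \<or> k = 1 \<or> k = 2" using that(1) by auto
    moreover have "i = q - 1" if "q - 1 \<le> i" "i < q" using that by simp
    ultimately show ?thesis using that assms by auto
  qed
  then show ?thesis using assms by (simp add: standard_parabolic_def Let_def)
qed

lemma standard_parabolic_three:
  assumes "v \<in> units_on (l1 + l2 + l3) (\<lambda>i j. (j < l1 \<longrightarrow> i < l1) \<and> (j < l1 + l2 \<longrightarrow> i < l1 + l2))"
  shows "v \<in> standard_parabolic [l1, l2, l3]"
proof -
  have "v $$ (i, j) = 0" if "k \<le> length [l1, l2, l3]" "i \<in> {sum_list (take k [l1, l2, l3])..<l1 + l2 + l3}"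
    "j < sum_list (take k [l1, l2, l3])" for k i j
  proof -
    have "k = 0 \<or> k = 1 \<or> k = 2 \<or> k = 3" using that(1) by auto
    then show ?thesis using that units_on_off[OF assms, of i j] by (auto simp: numeral_3_eq_3 numeral_2_eq_2)
  qed
  then show ?thesis using units_on_GL[OF assms] by (simp add: standard_parabolic_def Let_def add.assoc)
qed

lemma finite_double_cosets_stabiliser_of_line_or_hyperplane:
  assumes p: "0 < p" and q: "0 < q"
    and Q: "(partition_type p [1, p - 1] Q1 \<and> Q2 = carrier (GL q)) \<or> (Q1 = carrier (GL p) \<and> partition_type q [q - 1, 1] Q2)"
    and y: "y \<in> carrier (GL (p + q))" "y' \<in> carrier (GL (p + q))" "y * y' = 1\<^sub>m (p + q)"
    and P: "\<And>b. b \<in> carrier (GL (p + q)) \<Longrightarrow> upper_triangular b \<Longrightarrow> y * b * y' \<in> P"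
  shows "finite_double_cosets (p + q) (block_prod Q1 Q2) P"
  using Q
proof (elim disjE conjE)
  let ?n = "p + q"
  let ?K = "units_on ?n (\<lambda>i j. i < p \<longleftrightarrow> j < p)"
  have uP: "y * c * y' \<in> P" if "c \<in> units_on ?n (\<lambda>i j. i \<le> j)" for c
    by (rule P[OF units_on_GL[OF that] upper_triangular_units_on[OF that]])
  have uG: "units_on ?n R \<subseteq> carrier (GL ?n)" for R using units_on_GL by blast
  {
    assume "partition_type p [1, p - 1] Q1" and Q2: "Q2 = carrier (GL q)"
    then obtain x x' where x: "x \<in> carrier (GL p)" "x' \<in> carrier (GL p)" "x * x' = 1\<^sub>m p"
      and xQ: "\<And>a. a \<in> standard_parabolic [1, p - 1] \<Longrightarrow> x * a * x' \<in> Q1"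
      using conjugate_inD[of p "standard_parabolic [1, p - 1]" Q1] by (auto simp: partition_type_def)
    have one: "1\<^sub>m q \<in> carrier (GL q)" by (simp add: carrier_GL)
    let ?x = "block_diag x (1\<^sub>m q)" and ?x' = "block_diag x' (1\<^sub>m q)"
    note xc = x(1,2)[THEN GL_carrier_mat]
    have xG: "?x \<in> carrier (GL ?n)" "?x' \<in> carrier (GL ?n)" "?x * ?x' = 1\<^sub>m ?n"
      using x xc GL_GL_inverse_GL(1)[OF GL_GL_I[OF x(1) one]] GL_GL_inverse_GL(1)[OF GL_GL_I[OF x(2) one]]
      by (simp_all add: block_diag_mult[of _ p _ q] block_diag_one)
    show ?thesis
    proof (rule finite_double_cosets_conj[OF finite_double_cosets_line[OF p le_add1] _ _ xG y _ uP])
      fix u :: "complex mat" assume u: "u \<in> {k \<in> ?K. \<forall>i<?n. 0 < i \<longrightarrow> k $$ (i, 0) = 0}"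
      then obtain a d where ad: "a \<in> carrier (GL p)" "d \<in> carrier (GL q)" "u = block_diag a d"
        using GL_GL_E[of u p q] by (auto simp: GL_GL_units_on)
      note adc = ad(1,2)[THEN GL_carrier_mat]
      have "a $$ (i, 0) = 0" if "0 < i" "i < p" for i
        using u that index_block_diag[OF adc, of i 0] ad(3) p by auto
      then have "x * a * x' \<in> Q1" by (intro xQ standard_parabolic_line[OF ad(1) p])
      moreover have "?x * u * ?x' = block_diag (x * a * x') d"
        using adc xc by (simp add: ad(3) block_diag_mult[of _ p _ q])
      ultimately show "?x * u * ?x' \<in> block_prod Q1 Q2" using Q2 ad(2) by (auto simp: block_prod_def)
    qed (use uG in auto)
  next
    assume Q1: "Q1 = carrier (GL p)" and "partition_type q [q - 1, 1] Q2"
    then obtain x x' where x: "x \<in> carrier (GL q)" "x' \<in> carrier (GL q)" "x * x' = 1\<^sub>m q"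
      and xQ: "\<And>a. a \<in> standard_parabolic [q - 1, 1] \<Longrightarrow> x * a * x' \<in> Q2"
      using conjugate_inD[of q "standard_parabolic [q - 1, 1]" Q2] by (auto simp: partition_type_def)
    have one: "1\<^sub>m p \<in> carrier (GL p)" by (simp add: carrier_GL)
    let ?x = "block_diag (1\<^sub>m p) x" and ?x' = "block_diag (1\<^sub>m p) x'"
    note xc = x(1,2)[THEN GL_carrier_mat]
    have xG: "?x \<in> carrier (GL ?n)" "?x' \<in> carrier (GL ?n)" "?x * ?x' = 1\<^sub>m ?n"
      using x xc GL_GL_inverse_GL(1)[OF GL_GL_I[OF one x(1)]] GL_GL_inverse_GL(1)[OF GL_GL_I[OF one x(2)]]
      by (simp_all add: block_diag_mult[of _ p _ q] block_diag_one)
    have pn: "p < ?n" using q by simp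
    show ?thesis
    proof (rule finite_double_cosets_conj[OF finite_double_cosets_hyperplane[OF pn] _ _ xG y _ uP])
      fix u :: "complex mat" assume u: "u \<in> {k \<in> ?K. \<forall>j<?n - 1. k $$ (?n - 1, j) = 0}"
      then obtain a d where ad: "a \<in> carrier (GL p)" "d \<in> carrier (GL q)" "u = block_diag a d"
        using GL_GL_E[of u p q] by (auto simp: GL_GL_units_on)
      note adc = ad(1,2)[THEN GL_carrier_mat]
      have "d $$ (q - 1, j) = 0" if "j < q - 1" for j
      proof -
        have "u $$ (?n - 1, p + j) = 0" using u that by auto
        moreover have "u $$ (?n - 1, p + j) = d $$ (?n - 1 - p, p + j - p)"
          using index_block_diag[OF adc, of "?n - 1" "p + j"] that ad(3) by auto
        ultimately show ?thesis using q by simp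
      qed
      then have "x * d * x' \<in> Q2" by (intro xQ standard_parabolic_hyperplane[OF ad(2) q])
      moreover have "?x * u * ?x' = block_diag a (x * d * x')"
        using adc xc by (simp add: ad(3) block_diag_mult[of _ p _ q])
      ultimately show "?x * u * ?x' \<in> block_prod Q1 Q2" using Q1 ad(1) by (auto simp: block_prod_def)
    qed (use uG in auto)
  }
qed

theorem proposition6p2:
  fixes n p q :: nat and P Q :: "complex mat set"
  assumes "p \<ge> 1" and "q \<ge> 1" and "n = p + q"
    and "parabolic_subgroup (GL n) P"
    and "parabolic_subgroup (GL_GL p q) Q"
    and "(\<exists>Q1 Q2. Q = block_prod Q1 Q2 \<and>
            ((partition_type p [1, p - 1] Q1 \<and> Q2 = carrier (GL q)) \<or>
             (Q1 = carrier (GL p) \<and> partition_type q [q - 1, 1] Q2)))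
       \<or> maximal_parabolic_subgroup (GL n) P
       \<or> ((\<exists>l. composition_of n l \<and> length l = 3 \<and> P = standard_parabolic l) \<and>
           maximal_parabolic_subgroup (GL_GL p q) Q)"
  shows "finite (orbits (GL_GL p q) (double_flag (GL n) (GL_GL p q) P Q)
                   (diagonal_action (GL n) (GL_GL p q)))"
proof -
  have n0: "0 < n" and pq: "0 < p" "0 < q" using assms(1-3) by auto
  have sub: "subgroup P (GL n)" "subgroup Q (GL_GL p q)"
    using assms(4,5) by (auto simp: parabolic_subgroup_def)
  have uG: "units_on n R \<subseteq> carrier (GL n)" for R using units_on_GL by blast
  have GL_inv: "h \<in> carrier (GL n) \<Longrightarrow> inv\<^bsub>GL n\<^esub> h \<in> carrier (GL n)"
    "h \<in> carrier (GL n) \<Longrightarrow> h * inv\<^bsub>GL n\<^esub> h = 1\<^sub>m n" for h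
    using group.inv_closed[OF group_GL] group.r_inv[OF group_GL, of h n] by auto
  note K_inv = GL_GL_inverse_GL[of _ p q, folded assms(3)]
  consider (1) Q1 Q2 where "Q = block_prod Q1 Q2"
      "(partition_type p [1, p - 1] Q1 \<and> Q2 = carrier (GL q)) \<or> (Q1 = carrier (GL p) \<and> partition_type q [q - 1, 1] Q2)"
    | (2) "maximal_parabolic_subgroup (GL n) P"
    | (3) l where "composition_of n l" "length l = 3" "P = standard_parabolic l"
      "maximal_parabolic_subgroup (GL_GL p q) Q"
    using assms(6) by auto
  then have "finite_double_cosets n Q P"
  proof cases
    case (1 Q1 Q2)
    obtain h where h: "h \<in> carrier (GL n)"
      and up: "\<And>b. b \<in> carrier (GL n) \<Longrightarrow> upper_triangular b \<Longrightarrow> h * b * inv\<^bsub>GL n\<^esub> h \<in> P"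
      using parabolic_contains_conjugate[OF _ assms(4)] by auto
    show ?thesis
      using finite_double_cosets_stabiliser_of_line_or_hyperplane[OF pq 1(2), folded assms(3), OF h GL_inv(1)[OF h] GL_inv(2)[OF h] up]
      by (simp add: 1(1))
  next
    case 2
    then obtain m h where m: "m \<le> n" and h: "h \<in> carrier (GL n)"
      and hP: "\<And>v. v \<in> units_on n (\<lambda>i j. j < m \<longrightarrow> i < m) \<Longrightarrow> h * v * inv\<^bsub>GL n\<^esub> h \<in> P"
      using maximal_parabolic_GL[OF n0] by blast
    obtain k where k: "k \<in> carrier (GL_GL p q)"
      and up: "\<And>b. b \<in> carrier (GL_GL p q) \<Longrightarrow> upper_triangular b \<Longrightarrow> k * b * inv\<^bsub>GL_GL p q\<^esub> k \<in> Q"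
      using parabolic_contains_conjugate[OF _ assms(5)] by auto
    show ?thesis
    proof (rule finite_double_cosets_conj[OF finite_double_cosets_subspace[OF m, of p] uG uG K_inv[OF k] h GL_inv(1)[OF h] GL_inv(2)[OF h] _ hP])
      fix u :: "complex mat" assume u: "u \<in> units_on n (\<lambda>i j. (i < p \<longleftrightarrow> j < p) \<and> i \<le> j)"
      have "u \<in> carrier (GL_GL p q)"
        unfolding GL_GL_units_on by (rule units_on_mono[OF u[unfolded assms(3)]]) simp
      moreover have "u \<in> units_on n (\<lambda>i j. i \<le> j)" by (rule units_on_mono[OF u]) simp
      ultimately show "k * u * inv\<^bsub>GL_GL p q\<^esub> k \<in> Q" by (intro up upper_triangular_units_on)
    qed
  next
    case l: (3 l)
    obtain l1 l2 l3 where l': "l = [l1, l2, l3]"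
      using l(2) by (auto simp: numeral_3_eq_3 length_Suc_conv)
    have ln: "n = l1 + l2 + l3" using l(1) by (simp add: l' composition_of_def)
    obtain h U where h: "h \<in> carrier (GL_GL p q)" and U: "U \<subseteq> {..<p} \<or> U \<subseteq> {p..<n}"
      and hQ: "\<And>v. v \<in> units_on n (\<lambda>i j. (i < p \<longleftrightarrow> j < p) \<and> (j \<in> U \<longrightarrow> i \<in> U)) \<Longrightarrow> h * v * inv\<^bsub>GL_GL p q\<^esub> h \<in> Q"
      using maximal_parabolic_GL_GL[OF pq l(4)] unfolding assms(3)[symmetric] by blast
    \<comment> \<open>\<open>I0\<close> is the set of coordinates of the summand that contains the subspace belonging to \<open>Q\<close>.\<close>
    define I0 where "I0 = (if U \<subseteq> {..<p} then {..<p} else {p..<n})"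
    define I1 where "I1 = {..<n} - I0"
    have I: "I0 \<union> I1 = {..<n}" "I0 \<inter> I1 = {}" "U \<subseteq> I0"
      using U assms(3) by (auto simp: I0_def I1_def)
    have same: "i < p \<longleftrightarrow> j < p" if "i < n" "j < n" "i \<in> I0 \<longleftrightarrow> j \<in> I0" for i j
      using that by (auto simp: I0_def split: if_splits)
    have m: "l1 \<le> l1 + l2" "l1 + l2 \<le> n" using ln by auto
    have one: "1\<^sub>m n \<in> carrier (GL n)" "1\<^sub>m n * 1\<^sub>m n = (1\<^sub>m n :: complex mat)" by (simp_all add: carrier_GL)
    show ?thesis
    proof (rule finite_double_cosets_conj[OF finite_double_cosets_two_step[OF I m] uG uG K_inv[OF h] one(1) one(1) one(2)])
      fix u :: "complex mat" assume u: "u \<in> units_on n (\<lambda>i j. (i \<in> I0 \<longleftrightarrow> j \<in> I0) \<and> (j \<in> U \<longrightarrow> i \<in> U))"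
      show "h * u * inv\<^bsub>GL_GL p q\<^esub> h \<in> Q"
        by (rule hQ[OF units_on_mono[OF u]]) (use same in blast)
    next
      fix v :: "complex mat" assume v: "v \<in> units_on n (\<lambda>i j. (j < l1 \<longrightarrow> i < l1) \<and> (j < l1 + l2 \<longrightarrow> i < l1 + l2))"
      then have "v \<in> P" using standard_parabolic_three[of v l1 l2 l3] by (simp add: l(3) l' ln)
      then show "1\<^sub>m n * v * 1\<^sub>m n \<in> P" using units_on_carrier[OF v] by simp
    qed
  qed
  then show ?thesis by (rule finite_orbits_if_finite_double_cosets[OF assms(3) sub])
qed

end
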